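(* Let $\alpha>0$, $1\leq p<\infty$, and let $\mu$ be a nonnegative Borel measure on $\mathbb{C}^n$ satisfying the admissibility condition $\int_{\mathbb{C}^n}|K_w(z)|^2e^{-\alpha|w|^2}\,d\mu(w)<\infty$ for every $z\in\mathbb{C}^n$. Then: (i) $T_\mu:\mathcal{F}_\alpha^p\to\mathcal{F}_\alpha^\infty$ is bounded if and only if $\mu$ is a $(1,q)$ Fock--Carleson measure for some finite $q\geq p$, and equivalently if and only if $\mu$ is a $(1,q)$ Fock--Carleson measure for every finite $q\geq p$. Furthermore, in this case $\|T_\mu\|\simeq\|I_\mu\|$, where $I_\mu$ is the embedding map $I_\mu:\mathcal{F}_\alpha^1\to L^1(\sigma_1)$. (ii) $T_\mu:\mathcal{F}_\alpha^p\to\mathcal{F}_\alpha^\infty$ is compact if and only if $\mu$ is a $(1,q)$ vanishing Fock--Carleson measure for some finite $q\geq p$, and equivalently if and only if $\mu$ is a $(1,q)$ vanishing Fock--Carleson measure for every finite $q\geq p$.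
   Context: Fix $n\ge 1$ and $\alpha>0$. For $\langle z,w\rangle=\sum_{j=1}^n z_j\overline{w_j}$ and $|z|=\sqrt{\langle z,z\rangle}$ on $\mathbb{C}^n$, let $K_w(z)=e^{\alpha\langle z,w\rangle}$. Let $dV$ be Lebesgue measure on $\mathbb{C}^n$. Fock spaces: for $1\le p<\infty$, $\mathcal{F}_\alpha^p$ is the space of entire functions $f$ on $\mathbb{C}^n$ with $\|f\|_{(p,\alpha)}^p=\left(\frac{\alpha p}{2\pi}\right)^n\int_{\mathbb{C}^n}|f(z)|^pe^{-\frac{\alpha p}{2}|z|^2}\,dV(z)<\infty$; $\mathcal{F}_\alpha^\infty$ is the space of entire functions $f$ with $\|f\|_{(\infty,\alpha)}=\sup_{z\in\mathbb{C}^n}|f(z)|e^{-\frac{\alpha}{2}|z|^2}<\infty$. Toeplitz operator: $T_\mu f(z)=\int_{\mathbb{C}^n}K_w(z)f(w)e^{-\alpha|w|^2}\,d\mu(w)$. It is bounded from one Fock space $X$ to another $Y$ if for every $f\in X$ the integral converges absolutely for every $z$, $T_\mu f\in Y$, and $\|T_\mu f\|_Y\le C\|f\|_X$ with $C$ independent of $f$; $\|T_\mu\|$ is the operator norm. Compactness is in the usual sense of linear operators between Banach spaces. Fock--Carleson measures: for $0<p\le\infty$ (with $\mathcal{F}_\alpha^p$ and $\|\cdot\|_{(p,\alpha)}$ given by the same formula when $0<p<1$) and $0<q<\infty$, $\mu$ is a $(p,q)$ Fock--Carleson measure if there is a constant $C$ with $\int_{\mathbb{C}^n}|f(z)|^qe^{-\frac{\alpha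 q}{2}|z|^2}\,d\mu(z)\le C\|f\|_{(p,\alpha)}^q$ for all $f\in\mathcal{F}_\alpha^p$, i.e. the embedding map $I_\mu:\mathcal{F}_\alpha^p\to L^q(\sigma_q)$, $I_\mu f=f$, is bounded, where $d\sigma_q(z)=e^{-q\alpha|z|^2/2}\,d\mu(z)$. It is a $(p,q)$ vanishing Fock--Carleson measure if this embedding is compact. $A\simeq B$ means $C^{-1}B\le A\le CB$ for some constant $C>0$; in norm estimates the constant does not depend on $\mu$. *)

theory Defs
  imports "HOL-Analysis.Analysis"
begin

text \<open>
  The space of \<open>n\<close>-tuples of complex numbers is \<open>complex ^ 'n\<close> with \<open>n = CARD('n) \<ge> 1\<close>; its library
  norm is the Euclidean norm, and \<open>lborel\<close> on it is Lebesgue measure in the \<open>2n\<close> real coordinates.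
\<close>

definition herm :: "complex ^ 'n \<Rightarrow> complex ^ 'n \<Rightarrow> complex" where
  "herm z w = (\<Sum>j\<in>UNIV. z $ j * cnj (w $ j))"

definition fock_kernel :: "real \<Rightarrow> complex ^ 'n \<Rightarrow> complex ^ 'n \<Rightarrow> complex" where
  "fock_kernel \<alpha> w z = exp (of_real \<alpha> * herm z w)"

text \<open>Complex differentiability everywhere: the real Frechet derivative is complex linear.\<close>

definition entire :: "(complex ^ 'n \<Rightarrow> complex) \<Rightarrow> bool" where
  "entire f \<longleftrightarrow>
    (\<forall>z. \<exists>f'. (f has_derivative f') (at z) \<and> (\<forall>c v. f' (c *s v) = c * f' v))"

text \<open>
  The exponent ranges over \<open>(0, \<infinity>]\<close>. Values of \<open>fock_norm\<close> are meaningful only on \<open>fock_space\<close>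
  (outside it the Bochner integral and the real supremum are arbitrary).
\<close>

definition fock_space :: "real \<Rightarrow> ennreal \<Rightarrow> (complex ^ 'n \<Rightarrow> complex) set" where
  "fock_space \<alpha> p = {f. entire f \<and>
    (if p = \<infinity> then bdd_above (range (\<lambda>z. norm (f z) * exp (- (\<alpha> / 2) * (norm z)\<^sup>2)))
     else integrable lborel
       (\<lambda>z. norm (f z) powr enn2real p * exp (- (\<alpha> * enn2real p / 2) * (norm z)\<^sup>2)))}"

definition fock_norm :: "real \<Rightarrow> ennreal \<Rightarrow> (complex ^ 'n \<Rightarrow> complex) \<Rightarrow> real" where
  "fock_norm \<alpha> p f =
    (if p = \<infinity> then (SUP z. norm (f z) * exp (- (\<alpha> / 2) * (norm z)\<^sup>2))
     else ((\<alpha> * enn2real p / (2 * pi)) ^ CARD('n) *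
       (LINT z|lborel. norm (f z) powr enn2real p *
          exp (- (\<alpha> * enn2real p / 2) * (norm z)\<^sup>2))) powr (1 / enn2real p))"

text \<open>
  Elements of \<open>L\<^sup>q\<close> are represented by functions rather than by classes modulo null sets; all
  notions below depend only on the (quasi-)seminorm \<open>Lq_norm\<close>, hence only on the classes.
\<close>

definition Lq_space :: "real \<Rightarrow> 'a measure \<Rightarrow> ('a \<Rightarrow> complex) set" where
  "Lq_space q M = {f \<in> borel_measurable M. integrable M (\<lambda>z. norm (f z) powr q)}"

definition Lq_norm :: "real \<Rightarrow> 'a measure \<Rightarrow> ('a \<Rightarrow> complex) \<Rightarrow> real" where
  "Lq_norm q M f = (LINT z|M. norm (f z) powr q) powr (1 / q)"

text \<open>
  In the next three definitions \<open>T\<close> is a linear operator between two spaces of functions, each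
  given by its carrier (\<open>X\<close>, \<open>Y\<close>) and its norm (\<open>NX\<close>, \<open>NY\<close>).
\<close>

definition op_bound ::
  "('a \<Rightarrow> complex) set \<Rightarrow> (('a \<Rightarrow> complex) \<Rightarrow> real) \<Rightarrow>
   ('b \<Rightarrow> complex) set \<Rightarrow> (('b \<Rightarrow> complex) \<Rightarrow> real) \<Rightarrow>
   (('a \<Rightarrow> complex) \<Rightarrow> ('b \<Rightarrow> complex)) \<Rightarrow> real \<Rightarrow> bool" where
  "op_bound X NX Y NY T C \<longleftrightarrow> (\<forall>f\<in>X. T f \<in> Y \<and> NY (T f) \<le> C * NX f)"

text \<open>The operator norm is \<open>\<infinity>\<close> when there is no finite bound.\<close>

definition op_norm ::
  "('a \<Rightarrow> complex) set \<Rightarrow> (('a \<Rightarrow> complex) \<Rightarrow> real) \<Rightarrow>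
   ('b \<Rightarrow> complex) set \<Rightarrow> (('b \<Rightarrow> complex) \<Rightarrow> real) \<Rightarrow>
   (('a \<Rightarrow> complex) \<Rightarrow> ('b \<Rightarrow> complex)) \<Rightarrow> ennreal" where
  "op_norm X NX Y NY T = Inf (ennreal ` {C. 0 \<le> C \<and> op_bound X NX Y NY T C})"

text \<open>
  Compact: the image of every bounded sequence has a subsequence converging in the norm of the
  target space to an element of that space.
\<close>

definition op_compact ::
  "('a \<Rightarrow> complex) set \<Rightarrow> (('a \<Rightarrow> complex) \<Rightarrow> real) \<Rightarrow>
   ('b \<Rightarrow> complex) set \<Rightarrow> (('b \<Rightarrow> complex) \<Rightarrow> real) \<Rightarrow>
   (('a \<Rightarrow> complex) \<Rightarrow> ('b \<Rightarrow> complex)) \<Rightarrow> bool" where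
  "op_compact X NX Y NY T \<longleftrightarrow>
    (\<forall>f\<in>X. T f \<in> Y) \<and>
    (\<forall>f :: nat \<Rightarrow> 'a \<Rightarrow> complex. (\<forall>k. f k \<in> X) \<and> (\<exists>B. \<forall>k. NX (f k) \<le> B) \<longrightarrow>
      (\<exists>g\<in>Y. \<exists>r :: nat \<Rightarrow> nat. strict_mono r \<and>
        (\<lambda>k. NY (\<lambda>z. T (f (r k)) z - g z)) \<longlonglongrightarrow> 0))"

definition toeplitz ::
  "real \<Rightarrow> (complex ^ 'n) measure \<Rightarrow> (complex ^ 'n \<Rightarrow> complex) \<Rightarrow> complex ^ 'n \<Rightarrow> complex" where
  "toeplitz \<alpha> \<mu> f z =
    (LINT w|\<mu>. fock_kernel \<alpha> w z * f w * of_real (exp (- \<alpha> * (norm w)\<^sup>2)))"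

definition toeplitz_defined_on ::
  "real \<Rightarrow> (complex ^ 'n) measure \<Rightarrow> (complex ^ 'n \<Rightarrow> complex) set \<Rightarrow> bool" where
  "toeplitz_defined_on \<alpha> \<mu> X \<longleftrightarrow>
    (\<forall>f\<in>X. \<forall>z.
      integrable \<mu> (\<lambda>w. fock_kernel \<alpha> w z * f w * of_real (exp (- \<alpha> * (norm w)\<^sup>2))))"

definition toeplitz_bounded ::
  "real \<Rightarrow> ennreal \<Rightarrow> ennreal \<Rightarrow> (complex ^ 'n) measure \<Rightarrow> bool" where
  "toeplitz_bounded \<alpha> p q \<mu> \<longleftrightarrow>
    toeplitz_defined_on \<alpha> \<mu> (fock_space \<alpha> p) \<and>
    (\<exists>C. op_bound (fock_space \<alpha> p) (fock_norm \<alpha> p) (fock_space \<alpha> q) (fock_norm \<alpha> q)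
          (toeplitz \<alpha> \<mu>) C)"

definition toeplitz_norm ::
  "real \<Rightarrow> ennreal \<Rightarrow> ennreal \<Rightarrow> (complex ^ 'n) measure \<Rightarrow> ennreal" where
  "toeplitz_norm \<alpha> p q \<mu> =
    op_norm (fock_space \<alpha> p) (fock_norm \<alpha> p) (fock_space \<alpha> q) (fock_norm \<alpha> q) (toeplitz \<alpha> \<mu>)"

definition toeplitz_compact ::
  "real \<Rightarrow> ennreal \<Rightarrow> ennreal \<Rightarrow> (complex ^ 'n) measure \<Rightarrow> bool" where
  "toeplitz_compact \<alpha> p q \<mu> \<longleftrightarrow>
    toeplitz_defined_on \<alpha> \<mu> (fock_space \<alpha> p) \<and>
    op_compact (fock_space \<alpha> p) (fock_norm \<alpha> p) (fock_space \<alpha> q) (fock_norm \<alpha> q) (toeplitz \<alpha> \<mu>)"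

definition fock_sigma :: "real \<Rightarrow> real \<Rightarrow> (complex ^ 'n) measure \<Rightarrow> (complex ^ 'n) measure" where
  "fock_sigma \<alpha> q \<mu> = density \<mu> (\<lambda>z. ennreal (exp (- (q * \<alpha> / 2) * (norm z)\<^sup>2)))"

definition fock_carleson ::
  "real \<Rightarrow> ennreal \<Rightarrow> real \<Rightarrow> (complex ^ 'n) measure \<Rightarrow> bool" where
  "fock_carleson \<alpha> p q \<mu> \<longleftrightarrow>
    (\<exists>C::real. \<forall>f\<in>fock_space \<alpha> p.
      (\<integral>\<^sup>+ z. ennreal (norm (f z) powr q * exp (- (\<alpha> * q / 2) * (norm z)\<^sup>2)) \<partial>\<mu>)
        \<le> ennreal (C * fock_norm \<alpha> p f powr q))"

definition embedding_norm ::
  "real \<Rightarrow> ennreal \<Rightarrow> real \<Rightarrow> (complex ^ 'n) measure \<Rightarrow> ennreal" where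
  "embedding_norm \<alpha> p q \<mu> =
    op_norm (fock_space \<alpha> p) (fock_norm \<alpha> p)
      (Lq_space q (fock_sigma \<alpha> q \<mu>)) (Lq_norm q (fock_sigma \<alpha> q \<mu>)) (\<lambda>f. f)"

definition vanishing_fock_carleson ::
  "real \<Rightarrow> ennreal \<Rightarrow> real \<Rightarrow> (complex ^ 'n) measure \<Rightarrow> bool" where
  "vanishing_fock_carleson \<alpha> p q \<mu> \<longleftrightarrow>
    op_compact (fock_space \<alpha> p) (fock_norm \<alpha> p)
      (Lq_space q (fock_sigma \<alpha> q \<mu>)) (Lq_norm q (fock_sigma \<alpha> q \<mu>)) (\<lambda>f. f)"

definition admissible :: "real \<Rightarrow> (complex ^ 'n) measure \<Rightarrow> bool" where
  "admissible \<alpha> \<mu> \<longleftrightarrow>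
    (\<forall>z. (\<integral>\<^sup>+ w. ennreal ((norm (fock_kernel \<alpha> w z))\<^sup>2 * exp (- \<alpha> * (norm w)\<^sup>2)) \<partial>\<mu>) < \<infinity>)"

end

theory Submission
  imports Defs "HOL-Complex_Analysis.Complex_Analysis"
begin

text \<open>
  The theorem holds because each of its conditions says the same thing about the numbers
  \<open>\<mu>(B(w, 1))\<close>, the masses of the Euclidean unit balls: boundedness (of the Toeplitz operator or of any
  embedding) means that they are bounded in \<open>w\<close>, compactness means that they tend to \<open>0\<close> as
  \<open>|w| \<rightarrow> \<infinity>\<close>. The exponents \<open>p\<close> and \<open>q\<close> disappear in this description. Throughout, a function is
  replaced by its weighted modulus \<open>|f(z)| exp(- \<alpha>|z|\<^sup>2/2)\<close> (\<open>fock_weight\<close>).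

  From operators to balls, the test functions are the normalized kernels \<open>k\<^sub>w\<close>, whose weighted modulus
  is the Gaussian \<open>exp(- \<alpha>|z - w|\<^sup>2/2)\<close>. By translation invariance their norms do not depend on \<open>w\<close>. An
  embedding constant therefore bounds a Gaussian integral of \<open>\<mu>\<close> centred at \<open>w\<close>, and the weighted
  modulus of \<open>T k\<^sub>w\<close> at the point \<open>w\<close> itself equals such an integral
  (\<open>toeplitz_normalized_kernel_diagonal\<close>). Either integral dominates the mass of the ball up to a
  constant. For compactness, \<open>k\<^sub>w\<close> and \<open>T k\<^sub>w\<close> tend to \<open>0\<close> pointwise as \<open>|w| \<rightarrow> \<infinity>\<close>; a norm limit of a
  subsequence has to be \<open>0\<close>, so the Gaussian integrals vanish at infinity too.

  From balls to operators, the tool is the sub-mean value property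
  \<open>|f(w)|\<^sup>p exp(- \<alpha>p|w|\<^sup>2/2) \<le> C \<integral>\<^bsub>B(w,1)\<^esub> |f|\<^sup>p exp(- \<alpha>p|u|\<^sup>2/2) du\<close> (\<open>fock_weight_submean\<close>).
  Integrating it against \<open>\<mu>\<close> and exchanging the integrals turns a bound for the balls into a Carleson
  inequality (\<open>nn_integral_fock_weight_powr_le\<close>); enlarging the ball to the whole
  space gives the pointwise bound \<open>F\<^sup>p \<subseteq> F\<^sup>\<infinity>\<close>. The weighted modulus of \<open>T f\<close> at \<open>z\<close> is at most the
  integral over \<open>\<mu>\<close> of \<open>exp(- \<alpha>|w - z|\<^sup>2/2)\<close> times the weighted modulus of \<open>f\<close>
  (\<open>fock_weight_toeplitz_le\<close>); the second factor is bounded, and the integral of the Gaussian is controlled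
  by the Carleson inequality for \<open>k\<^sub>z\<close>. For compactness, a norm-bounded
  sequence has a pointwise convergent subsequence (\<open>entire_pointwise_convergent_subsequence\<close>); on a large
  ball one uses dominated convergence, and outside it the Carleson inequality for the restricted
  measure, whose unit balls have small mass.

  All constants come from these inequalities and do not depend on \<open>\<mu>\<close>, so the comparison of the
  operator norms comes out of the same argument.
\<close>

section \<open>The Hermitian product, the kernel and entire functions\<close>

lemma herm_simps:
  "herm (x + y) w = herm x w + herm y w"
  "herm (x - y) w = herm x w - herm y w"
  "herm (c *s x) w = c * herm x w"
  "herm 0 w = 0"
  by (simp_all add: herm_def algebra_simps sum.distrib sum_subtractf sum_distrib_left)

lemma Re_herm: "Re (herm z w) = z \<bullet> w"
  by (simp add: herm_def inner_vec_def inner_complex_def)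

lemma norm_herm_le: "norm (herm z w) \<le> norm z * norm w"
proof -
  have "norm (herm z w) \<le> (\<Sum>j\<in>UNIV. norm (z $ j * cnj (w $ j)))"
    unfolding herm_def by (rule norm_sum)
  also have "\<dots> = (\<Sum>j\<in>UNIV. \<bar>norm (z $ j)\<bar> * \<bar>norm (w $ j)\<bar>)"
    by (simp add: norm_mult)
  also have "\<dots> \<le> L2_set (\<lambda>j. norm (z $ j)) UNIV * L2_set (\<lambda>j. norm (w $ j)) UNIV"
    by (rule L2_set_mult_ineq)
  finally show ?thesis
    by (simp add: norm_vec_def)
qed

lemma norm_diff_sq: "(norm (z - w))\<^sup>2 = (norm z)\<^sup>2 - 2 * (z \<bullet> w) + (norm w)\<^sup>2"
  for z w :: "'a::real_inner"
  by (simp add: power2_norm_eq_inner inner_diff_left inner_diff_right inner_commute)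

lemma norm_fock_kernel: "norm (fock_kernel \<alpha> w z) = exp (\<alpha> * (z \<bullet> w))"
  by (simp add: fock_kernel_def Re_herm)

lemma norm_scale_vec: "norm (c *s x) = norm c * norm x" for x :: "complex ^ 'n"
  by (simp add: norm_vec_def L2_set_def norm_mult power_mult_distrib real_sqrt_mult
      flip: sum_distrib_left)

lemma herm_has_derivative: "((\<lambda>z. herm z w) has_derivative (\<lambda>v. herm v w)) (at z)"
proof -
  have "bounded_linear (\<lambda>v. herm v w)"
  proof (rule bounded_linear_intro[where K = "norm w"])
    show "herm (r *\<^sub>R x) w = r *\<^sub>R herm x w" for r x
      by (simp add: herm_def scaleR_sum_right)
  qed (auto simp: herm_simps norm_herm_le)
  then show ?thesis
    by (rule bounded_linear_imp_has_derivative)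
qed

lemma entireE:
  assumes "entire f"
  obtains f' where "(f has_derivative f') (at z)" "\<And>c v. f' (c *s v) = c * f' v"
  using assms unfolding entire_def by metis

lemma entire_fock_kernel: "entire (fock_kernel \<alpha> w)"
  unfolding entire_def
proof
  fix z
  have "(fock_kernel \<alpha> w has_derivative
          (\<lambda>v. fock_kernel \<alpha> w z * (of_real \<alpha> * herm v w))) (at z)"
    unfolding fock_kernel_def
    by (rule has_derivative_compose[OF _ DERIV_exp[unfolded has_field_derivative_def]])
       (intro has_derivative_mult_right herm_has_derivative)
  then show "\<exists>f'. (fock_kernel \<alpha> w has_derivative f') (at z) \<and> (\<forall>c v. f' (c *s v) = c * f' v)"
    by (intro exI conjI) (auto simp: herm_simps)
qed

lemma entire_cmult:
  assumes "entire f"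
  shows "entire (\<lambda>z. c * f z)"
  unfolding entire_def
proof
  fix z
  obtain f' where f: "(f has_derivative f') (at z)" "\<And>c v. f' (c *s v) = c * f' v"
    using entireE \<open>entire f\<close> by blast
  show "\<exists>f'. ((\<lambda>z. c * f z) has_derivative f') (at z) \<and> (\<forall>c v. f' (c *s v) = c * f' v)"
    by (rule exI[of _ "\<lambda>v. c * f' v"]) (auto intro!: derivative_eq_intros f(1) simp: f(2))
qed

lemma entire_mult:
  assumes "entire f" "entire g"
  shows "entire (\<lambda>z. f z * g z)"
  unfolding entire_def
proof
  fix z
  obtain f' where f: "(f has_derivative f') (at z)" "\<And>c v. f' (c *s v) = c * f' v"
    using entireE \<open>entire f\<close> by blast
  obtain g' where g: "(g has_derivative g') (at z)" "\<And>c v. g' (c *s v) = c * g' v"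
    using entireE \<open>entire g\<close> by blast
  show "\<exists>f'. ((\<lambda>z. f z * g z) has_derivative f') (at z) \<and> (\<forall>c v. f' (c *s v) = c * f' v)"
    by (rule exI[of _ "\<lambda>v. f z * g' v + f' v * g z"])
       (auto intro!: derivative_eq_intros f(1) g(1) simp: f(2) g(2) algebra_simps)
qed

lemma entire_translate:
  assumes "entire f"
  shows "entire (\<lambda>z. f (z + w))"
  unfolding entire_def
proof
  fix z
  obtain f' where f: "(f has_derivative f') (at (z + w))" "\<And>c v. f' (c *s v) = c * f' v"
    using entireE assms by blast
  have "((\<lambda>z. f (z + w)) has_derivative f') (at z)"
    by (rule has_derivative_compose[of "\<lambda>z. z + w" "\<lambda>v. v", simplified])
       (auto intro!: derivative_eq_intros f(1))
  with f(2) show "\<exists>f'. ((\<lambda>z. f (z + w)) has_derivative f') (at z) \<and> (\<forall>c v. f' (c *s v) = c * f' v)"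
    by blast
qed

lemma entire_continuous: "entire f \<Longrightarrow> continuous_on UNIV f"
  by (force simp: entire_def intro: continuous_at_imp_continuous_on has_derivative_continuous)

lemma entire_measurable: "entire f \<Longrightarrow> f \<in> borel_measurable borel"
  by (simp add: entire_continuous borel_measurable_continuous_onI)

text \<open>
  Restriction to complex lines reduces all function theory used here to one complex variable.
\<close>

lemma entire_slice_holomorphic:
  assumes "entire f"
  shows "(\<lambda>s. f (a + s *s b)) holomorphic_on UNIV"
proof (rule holomorphic_onI)
  fix s :: complex
  obtain f' where f: "(f has_derivative f') (at (a + s *s b))" "\<And>c v. f' (c *s v) = c * f' v"
    using entireE assms by blast
  have lin: "bounded_linear (\<lambda>s::complex. s *s b)"
    by (rule bounded_linear_intro[where K = "norm b"])
       (auto simp: norm_scale_vec vec_eq_iff algebra_simps)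
  have 1: "((\<lambda>s. a + s *s b) has_derivative (\<lambda>t. t *s b)) (at s)"
    by (auto intro!: derivative_eq_intros bounded_linear_imp_has_derivative[OF lin])
  have "((\<lambda>s. f (a + s *s b)) has_derivative (\<lambda>t. f' (t *s b))) (at s)"
    by (rule has_derivative_compose[OF 1 f(1)])
  then have "((\<lambda>s. f (a + s *s b)) has_field_derivative f' b) (at s)"
    unfolding has_field_derivative_def by (simp add: f(2) mult.commute[of _ "f' b"])
  then show "(\<lambda>s. f (a + s *s b)) field_differentiable at s within UNIV"
    by (auto simp: field_differentiable_def)
qed

section \<open>Invariance of Lebesgue measure under linear isometries\<close>

lemma nn_integral_lborel_translate:
  fixes f :: "'a::euclidean_space \<Rightarrow> ennreal"
  assumes [measurable]: "f \<in> borel_measurable borel"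
  shows "(\<integral>\<^sup>+x. f (a + x) \<partial>lborel) = (\<integral>\<^sup>+x. f x \<partial>lborel)"
proof -
  have "(\<integral>\<^sup>+x. f x \<partial>lborel) = (\<integral>\<^sup>+x. f x \<partial>distr lborel borel ((+) a))"
    by (simp add: lborel_distr_plus)
  then show ?thesis
    by (simp add: nn_integral_distr)
qed

text \<open>
  Uniqueness of Haar measure, normalized on the unit ball \<open>B\<close>. The classical double integral
  \<open>\<integral>\<integral> 1\<^sub>A(x) 1\<^sub>B(y - x) dy d\<nu>(x)\<close> is \<open>\<nu>(A) |B|\<close> when \<open>y\<close> is integrated first and, after the substitution
  \<open>x \<mapsto> x + y\<close>, equals \<open>|A| \<nu>(- B)\<close>; the ball is symmetric, and the common factor cancels.
\<close>

lemma translation_invariant_eq_lborel: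
  fixes \<nu> :: "'a::euclidean_space measure"
  assumes sets[measurable_cong]: "sets \<nu> = sets borel" and "sigma_finite_measure \<nu>"
    and inv: "\<And>a A. A \<in> sets borel \<Longrightarrow> emeasure \<nu> ((+) a -` A) = emeasure \<nu> A"
    and ball: "emeasure \<nu> (ball 0 1) = emeasure lborel (ball (0::'a) 1)"
  shows "\<nu> = lborel"
proof (rule measure_eqI)
  show "sets \<nu> = sets lborel" by (simp add: sets)
  fix A assume "A \<in> sets \<nu>"
  then have A[measurable]: "A \<in> sets borel" by (simp add: sets)
  interpret nu: sigma_finite_measure \<nu> by fact
  interpret pair_sigma_finite \<nu> lborel ..
  define B where "B = ball (0::'a) 1"
  have [measurable]: "B \<in> sets borel" and sym: "- x \<in> B \<longleftrightarrow> x \<in> B" for x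
    by (simp_all add: B_def)
  have nu_inv: "(\<integral>\<^sup>+x. f (a + x) \<partial>\<nu>) = (\<integral>\<^sup>+x. f x \<partial>\<nu>)"
    if [measurable]: "f \<in> borel_measurable borel" for f a
  proof -
    have "distr \<nu> borel ((+) a) = \<nu>"
      by (rule measure_eqI) (auto simp: sets emeasure_distr inv sets_eq_imp_space_eq[OF sets])
    then have "(\<integral>\<^sup>+x. f x \<partial>\<nu>) = (\<integral>\<^sup>+x. f x \<partial>distr \<nu> borel ((+) a))" by simp
    then show ?thesis by (simp add: nn_integral_distr)
  qed
  have "emeasure \<nu> A * emeasure lborel B = (\<integral>\<^sup>+x. (\<integral>\<^sup>+y. indicator A x * indicator B y \<partial>lborel) \<partial>\<nu>)"
    by (subst nn_integral_cmult_indicator, simp, subst nn_integral_multc) (simp_all add: sets)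
  also have "\<dots> = (\<integral>\<^sup>+x. (\<integral>\<^sup>+y. indicator A x * indicator B (- x + y) \<partial>lborel) \<partial>\<nu>)"
    by (rule nn_integral_cong, rule nn_integral_lborel_translate[of "\<lambda>y. indicator A _ * indicator B y", symmetric])
       measurable
  also have "\<dots> = (\<integral>\<^sup>+y. (\<integral>\<^sup>+x. indicator A x * indicator B (- x + y) \<partial>\<nu>) \<partial>lborel)"
    by (rule Fubini'[symmetric]) (measurable)
  also have "\<dots> = (\<integral>\<^sup>+y. (\<integral>\<^sup>+x. indicator A (y + x) * indicator B (- (y + x) + y) \<partial>\<nu>) \<partial>lborel)"
    by (rule nn_integral_cong, rule nu_inv[of "\<lambda>x. indicator A x * indicator B (- x + _)", symmetric]) measurable
  also have "\<dots> = (\<integral>\<^sup>+y. (\<integral>\<^sup>+x. indicator A (x + y) * indicator B x \<partial>\<nu>) \<partial>lborel)"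
    by (intro nn_integral_cong) (simp add: indicator_def sym add.commute)
  also have "\<dots> = (\<integral>\<^sup>+x. (\<integral>\<^sup>+y. indicator A (x + y) * indicator B x \<partial>lborel) \<partial>\<nu>)"
    by (rule Fubini') measurable
  also have "\<dots> = (\<integral>\<^sup>+x. (\<integral>\<^sup>+y. indicator A y * indicator B x \<partial>lborel) \<partial>\<nu>)"
    by (rule nn_integral_cong, rule nn_integral_lborel_translate[of "\<lambda>y. indicator A y * indicator B _"]) measurable
  also have "\<dots> = emeasure lborel A * emeasure \<nu> B"
    by (simp add: nn_integral_cmult nn_integral_multc sets)
  finally have *: "emeasure \<nu> A * emeasure lborel B = emeasure lborel A * emeasure lborel B"
    by (simp add: ball B_def)
  have "emeasure lborel B \<noteq> 0" "emeasure lborel B \<noteq> \<infinity>"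
    using content_ball_pos[of 1 "0::'a"] emeasure_lborel_ball_finite[of "0::'a" 1]
    by (auto simp: measure_def B_def)
  with * show "emeasure \<nu> A = emeasure lborel A"
    by (metis ennreal_mult_cancel_left mult.commute infinity_ennreal_def)
qed

text \<open>
  The image of Lebesgue measure under a linear isometry is again translation invariant and gives the
  unit ball the same mass. Below, \<open>T\<close> is multiplication by a
  unimodular complex scalar.
\<close>

lemma nn_integral_lborel_isometry:
  fixes f :: "'a::euclidean_space \<Rightarrow> ennreal" and T :: "'a \<Rightarrow> 'a"
  assumes [measurable]: "f \<in> borel_measurable borel"
    and "linear T" and iso: "\<And>x. norm (T x) = norm x"
  shows "(\<integral>\<^sup>+x. f (T x) \<partial>lborel) = (\<integral>\<^sup>+x. f x \<partial>lborel)"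
proof -
  interpret linear T by fact
  have "continuous_on UNIV T"
    using \<open>linear T\<close> by (simp add: linear_continuous_on linear_conv_bounded_linear)
  then have [measurable]: "T \<in> borel_measurable borel"
    by (rule borel_measurable_continuous_onI)
  have "inj T"
    by (rule injI) (metis diff iso norm_eq_zero right_minus_eq)
  then have "surj T"
    using linear_injective_imp_surjective[OF \<open>linear T\<close>] by simp
  define \<nu> where "\<nu> = distr lborel borel T"
  have ball: "emeasure \<nu> (ball 0 r) = emeasure lborel (ball (0::'a) r)" for r
    by (simp add: \<nu>_def emeasure_distr) (rule arg_cong[of _ _ "emeasure lborel"], auto simp: iso)
  have "\<nu> = lborel"
  proof (rule translation_invariant_eq_lborel)
    show "sets \<nu> = sets borel" by (simp add: \<nu>_def)
    show "sigma_finite_measure \<nu>"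
    proof
      show "\<exists>A::'a set set. countable A \<and> A \<subseteq> sets \<nu> \<and> \<Union> A = space \<nu> \<and> (\<forall>a\<in>A. emeasure \<nu> a \<noteq> \<infinity>)"
      proof (intro exI conjI)
        show "countable (range (\<lambda>k::nat. ball (0::'a) k))" by simp
        show "\<Union> (range (\<lambda>k::nat. ball (0::'a) k)) = space \<nu>"
          by (auto simp: \<nu>_def reals_Archimedean2)
        show "\<forall>a\<in>range (\<lambda>k::nat. ball (0::'a) k). emeasure \<nu> a \<noteq> \<infinity>"
          by (auto simp: ball) (metis emeasure_lborel_ball_finite less_irrefl infinity_ennreal_def)
      qed (auto simp: \<nu>_def)
    qed
    show "emeasure \<nu> (ball 0 1) = emeasure lborel (ball (0::'a) 1)" by (rule ball)
    fix a :: 'a and A :: "'a set" assume A[measurable]: "A \<in> sets borel"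
    obtain b where b: "T b = a" using \<open>surj T\<close> by (metis surjD)
    have [measurable]: "(+) a -` A \<in> sets borel"
      using measurable_sets[of "(+) a" borel borel A] by simp
    have 1: "T -` (+) a -` A = (+) b -` (T -` A)" by (auto simp: b add)
    have [measurable]: "T -` A \<in> sets borel"
      using measurable_sets[of T borel borel A] by simp
    have "emeasure \<nu> ((+) a -` A) = emeasure lborel (T -` (+) a -` A)"
      by (simp add: \<nu>_def emeasure_distr)
    also have "\<dots> = emeasure (distr lborel borel ((+) b)) (T -` A)"
      unfolding 1 by (simp add: emeasure_distr)
    also have "\<dots> = emeasure \<nu> A"
      by (simp add: \<nu>_def emeasure_distr lborel_distr_plus)
    finally show "emeasure \<nu> ((+) a -` A) = emeasure \<nu> A" .
  qed
  then have "(\<integral>\<^sup>+x. f x \<partial>lborel) = (\<integral>\<^sup>+x. f x \<partial>\<nu>)" by simp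
  then show ?thesis by (simp add: \<nu>_def nn_integral_distr)
qed

section \<open>The sub-mean value property on balls\<close>

text \<open>
  The tangent line at \<open>a\<close> of the convex function \<open>x\<^sup>p\<close>. Integrated against a probability measure whose
  mean of \<open>x\<close> is at least \<open>a\<close>, it gives Jensen's inequality in the form used for \<open>|h|\<^sup>p\<close>.
\<close>

lemma powr_above_tangent:
  fixes a x p :: real
  assumes "1 \<le> p" "0 \<le> a" "0 \<le> x"
  shows "a powr p + p * a powr (p - 1) * (x - a) \<le> x powr p"
proof (cases "a = 0 \<or> x = 0")
  case True
  show ?thesis
  proof (cases "a = 0")
    case False
    with True have "x = 0" by simp
    have "a powr p + p * a powr (p - 1) * (- a) = (1 - p) * a powr p"
      using assms False by (simp add: powr_diff field_simps)
    also have "\<dots> \<le> 0" using assms by (simp add: mult_nonpos_nonneg)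
    finally show ?thesis using \<open>x = 0\<close> by simp
  qed (use assms in auto)
next
  case False
  then have "a > 0" "x > 0" using assms by auto
  have "convex_on {0<..} (\<lambda>x::real. x powr p)"
    by (rule f''_ge0_imp_convex[where f' = "\<lambda>x. p * x powr (p - 1)"
          and f'' = "\<lambda>x. p * ((p - 1) * x powr (p - 1 - 1))"])
       (use assms in \<open>auto intro!: derivative_eq_intros\<close>)
  then have "x powr p - a powr p \<ge> p * a powr (p - 1) * (x - a)"
    by (rule convex_on_imp_above_tangent)
       (use \<open>a > 0\<close> \<open>x > 0\<close> in \<open>auto intro!: derivative_eq_intros simp: connected_imp_connected_closure interior_open\<close>)
  then show ?thesis by simp
qed

lemma circle_mean_value:
  assumes "h holomorphic_on UNIV"
  shows "((\<lambda>t. h (exp (2 * pi * \<i> * of_real t))) has_integral h 0) {0..1}"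
proof -
  have "((\<lambda>u. h u / (u - 0)) has_contour_integral (2 * of_real pi * \<i> * h 0)) (circlepath 0 1)"
    by (rule Cauchy_integral_circlepath_simple) (use assms holomorphic_on_subset in auto)
  then have "((\<lambda>t. (2 * of_real pi * \<i>) * h (exp (2 * pi * \<i> * of_real t))) has_integral 
      2 * of_real pi * \<i> * h 0) {0..1}"
    unfolding has_contour_integral_def
    by (rule has_integral_eq[rotated])
       (simp only: vector_derivative_circlepath01 atLeastAtMost_iff, simp add: circlepath mult_ac)
  then have "((\<lambda>t. (1 / (2 * of_real pi * \<i>)) * ((2 * of_real pi * \<i>) * h (exp (2 * pi * \<i> * of_real t)))) has_integral 
      (1 / (2 * of_real pi * \<i>)) * (2 * of_real pi * \<i> * h 0)) {0..1}"
    by (rule has_integral_mult_right)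
  then show ?thesis by simp
qed

text \<open>
  By Cauchy's formula the mean of \<open>|h|\<close> over the circle is at least \<open>a = |h(0)|\<close>; integrating the tangent
  line of \<open>x\<^sup>p\<close> at \<open>a\<close> gives the claim.
\<close>

lemma circle_submean:
  assumes h: "h holomorphic_on UNIV" and p: "1 \<le> p"
  shows "ennreal (norm (h 0) powr p) \<le>
    (\<integral>\<^sup>+t. ennreal (norm (h (exp (2 * pi * \<i> * of_real t))) powr p) * indicator {0..1} t \<partial>lborel)"
proof -
  define e where "e t = exp (2 * pi * \<i> * of_real t)" for t :: real
  define a where "a = norm (h 0)"
  have conth: "continuous_on UNIV h"
    using h by (rule holomorphic_on_imp_continuous_on)
  have conte: "continuous_on {0..1} (\<lambda>t. h (e t))"
    unfolding e_def by (intro continuous_on_compose2[OF conth] continuous_intros) auto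
  have int1: "(\<lambda>t. norm (h (e t))) integrable_on {0..1}"
    by (intro integrable_continuous_real continuous_intros conte)
  have intp: "(\<lambda>t. norm (h (e t)) powr p) integrable_on {0..1}"
    by (intro integrable_continuous_real continuous_on_powr' continuous_intros conte) (use p in auto)
  have "a \<le> integral {0..1} (\<lambda>t. norm (h (e t)))"
    using circle_mean_value[OF h] int1 unfolding a_def e_def
    by (metis (mono_tags, lifting) integral_norm_bound_integral has_integral_integrable integral_unique order_refl)
  then have "a powr p \<le> a powr p + p * a powr (p - 1) * (integral {0..1} (\<lambda>t. norm (h (e t))) - a)"
    using p by simp
  also have "\<dots> = integral {0..1} (\<lambda>t. a powr p + p * a powr (p - 1) * (norm (h (e t)) - a))"
  proof -
    have "((\<lambda>t. a powr p + p * a powr (p - 1) * (norm (h (e t)) - a)) has_integral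
       (a powr p * 1 + p * a powr (p - 1) * (integral {0..1} (\<lambda>t. norm (h (e t))) - a * 1))) {0..1}"
      by (intro has_integral_add has_integral_mult_right has_integral_diff integrable_integral int1)
         (use has_integral_const_real[of _ 0 1] in auto)
    then show ?thesis by (simp add: integral_unique)
  qed
  also have "\<dots> \<le> integral {0..1} (\<lambda>t. norm (h (e t)) powr p)"
    by (rule integral_le)
       (use int1 intp p in \<open>auto simp: a_def intro!: powr_above_tangent integrable_add integrable_on_mult_right integrable_diff\<close>)
  finally have "ennreal (a powr p) \<le> ennreal (integral {0..1} (\<lambda>t. norm (h (e t)) powr p))"
    by (rule ennreal_leI)
  also have "\<dots> = (\<integral>\<^sup>+t. ennreal (norm (h (e t)) powr p) * indicator {0..1} t \<partial>lborel)"
  proof -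
    have "((\<lambda>t. norm (h (e t)) powr p) has_integral integral {0..1} (\<lambda>t. norm (h (e t)) powr p)) {0..1}"
      using intp by (rule integrable_integral)
    then show ?thesis
      by (intro nn_integral_has_integral_lebesgue'[symmetric]) auto
  qed
  finally show ?thesis
    by (simp add: a_def e_def)
qed

text \<open>
  The ball is invariant under \<open>u \<mapsto> e\<^bsup>it\<^esup> u\<close>, so averaging \<open>|f|\<^sup>p\<close> over the ball is the same as first
  averaging over each circle \<open>{e\<^bsup>it\<^esup> u}\<close>, on which the one-variable inequality applies. This avoids polar
  coordinates and iterated means over polydiscs.
\<close>

lemma ball_submean:
  fixes f :: "complex ^ 'n \<Rightarrow> complex"
  assumes f: "entire f" and p: "1 \<le> p"
  shows "ennreal (norm (f 0) powr p) * emeasure lborel (ball (0::complex ^ 'n) 1) \<le>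
    (\<integral>\<^sup>+u. ennreal (norm (f u) powr p) * indicator (ball 0 1) u \<partial>lborel)"
proof -
  define B where "B = ball (0::complex ^ 'n) 1"
  have [measurable]: "B \<in> sets borel" by (simp add: B_def)
  have B_scale: "c *s u \<in> B \<longleftrightarrow> u \<in> B" if "norm c = 1" for c u
    using that by (simp add: B_def norm_scale_vec)
  define e where "e t = exp (2 * pi * \<i> * of_real t)" for t :: real
  have ne: "norm (e t) = 1" for t by (simp add: e_def)
  have conte: "continuous_on UNIV e" unfolding e_def by (intro continuous_intros)
  have scale: "continuous_on UNIV (\<lambda>z::real \<times> (complex ^ 'n). e (fst z) *s snd z)"
    unfolding vector_scalar_mult_def 
    by (intro continuous_intros continuous_on_compose2[OF conte]) auto
  have [measurable]: "(\<lambda>z::real \<times> (complex ^ 'n). e (fst z) *s snd z) \<in> borel_measurable (borel \<Otimes>\<^sub>M borel)"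
    using borel_measurable_continuous_onI[OF scale] by (simp add: borel_prod)
  note [measurable] = entire_measurable[OF f]
  have lin: "linear (\<lambda>u::complex ^ 'n. e t *s u)" for t
    by (rule linearI) (auto simp: vec_eq_iff algebra_simps)
  have [measurable]: "(\<lambda>u::complex ^ 'n. e t *s u) \<in> borel_measurable borel" for t
    using lin[of t] by (intro borel_measurable_continuous_onI) (simp add: linear_continuous_on linear_conv_bounded_linear)
  have "ennreal (norm (f 0) powr p) * emeasure lborel B
     = (\<integral>\<^sup>+u. ennreal (norm (f 0) powr p) * indicator B u \<partial>lborel)"
    by (subst nn_integral_cmult_indicator) simp_all
  also have "\<dots> \<le> (\<integral>\<^sup>+u. (\<integral>\<^sup>+t. ennreal (norm (f (e t *s u)) powr p) * indicator {0..1::real} t * indicator B u \<partial>lborel) \<partial>lborel)"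
  proof (rule nn_integral_mono)
    fix u :: "complex ^ 'n"
    have "ennreal (norm (f 0) powr p) \<le> (\<integral>\<^sup>+t. ennreal (norm (f (e t *s u)) powr p) * indicator {0..1::real} t \<partial>lborel)"
      using circle_submean[OF entire_slice_holomorphic[OF f, of 0 u] p] by (simp add: e_def)
    then show "ennreal (norm (f 0) powr p) * indicator B u \<le>
       (\<integral>\<^sup>+t. ennreal (norm (f (e t *s u)) powr p) * indicator {0..1::real} t * indicator B u \<partial>lborel)"
      by (cases "u \<in> B") simp_all
  qed
  also have "\<dots> = (\<integral>\<^sup>+t. (\<integral>\<^sup>+u. ennreal (norm (f (e t *s u)) powr p) * indicator {0..1::real} t * indicator B u \<partial>lborel) \<partial>lborel)"
    by (rule lborel_pair.Fubini') measurable
  also have "\<dots> = (\<integral>\<^sup>+t. (\<integral>\<^sup>+u. ennreal (norm (f u) powr p) * indicator {0..1::real} t * indicator B u \<partial>lborel) \<partial>lborel)"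
  proof (rule nn_integral_cong)
    fix t :: real
    have "(\<integral>\<^sup>+u. ennreal (norm (f (e t *s u)) powr p) * indicator {0..1::real} t * indicator B u \<partial>lborel)
      = (\<integral>\<^sup>+u. ennreal (norm (f (e t *s u)) powr p) * indicator {0..1::real} t * indicator B (e t *s u) \<partial>lborel)"
      by (intro nn_integral_cong) (simp add: indicator_def B_scale ne)
    also have "\<dots> = (\<integral>\<^sup>+u. ennreal (norm (f u) powr p) * indicator {0..1::real} t * indicator B u \<partial>lborel)"
      by (rule nn_integral_lborel_isometry[OF _ lin[of t]]) (simp_all add: norm_scale_vec ne)
    finally show "(\<integral>\<^sup>+u. ennreal (norm (f (e t *s u)) powr p) * indicator {0..1::real} t * indicator B u \<partial>lborel) = \<dots>" .
  qed
  also have "\<dots> = (\<integral>\<^sup>+u. ennreal (norm (f u) powr p) * indicator B u \<partial>lborel)"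
    by (subst lborel_pair.Fubini', measurable) (simp add: nn_integral_multc nn_integral_cmult)
  finally show ?thesis by (simp add: B_def)
qed

section \<open>The weighted modulus\<close>

definition fock_weight :: "real \<Rightarrow> (complex ^ 'n \<Rightarrow> complex) \<Rightarrow> complex ^ 'n \<Rightarrow> real" where
  "fock_weight \<alpha> f z = norm (f z) * exp (- (\<alpha> / 2) * (norm z)\<^sup>2)"

lemma fock_weight_nonneg [simp]: "0 \<le> fock_weight \<alpha> f z"
  by (simp add: fock_weight_def)

lemma fock_weight_powr:
  "norm (f z) powr q * exp (- (\<alpha> * q / 2) * (norm z)\<^sup>2) = fock_weight \<alpha> f z powr q"
proof -
  have "exp (- (\<alpha> / 2) * (norm z)\<^sup>2) powr q = exp (- (\<alpha> * q / 2) * (norm z)\<^sup>2)"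
    by (simp add: powr_def)
  then show ?thesis
    by (simp add: fock_weight_def powr_mult)
qed

lemma fock_weight_measurable [measurable]:
  assumes "f \<in> borel_measurable borel"
  shows "fock_weight \<alpha> f \<in> borel_measurable borel"
  using assms unfolding fock_weight_def by measurable

lemma fock_weight_triangle: "fock_weight \<alpha> (\<lambda>z. f z - g z) z \<le> fock_weight \<alpha> f z + fock_weight \<alpha> g z"
  unfolding fock_weight_def by (simp add: norm_triangle_ineq4 flip: distrib_right)

lemma fock_space_infinity_iff:
  "f \<in> fock_space \<alpha> \<infinity> \<longleftrightarrow> entire f \<and> bdd_above (range (fock_weight \<alpha> f))"
  by (simp add: fock_space_def fock_weight_def [abs_def])

lemma fock_norm_infinity: "fock_norm \<alpha> \<infinity> f = (SUP z. fock_weight \<alpha> f z)"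
  by (simp add: fock_norm_def fock_weight_def)

lemma fock_space_iff:
  assumes "0 < p"
  shows "f \<in> fock_space \<alpha> (ennreal p) \<longleftrightarrow>
    entire f \<and> integrable lborel (\<lambda>z. fock_weight \<alpha> f z powr p)"
  using assms by (simp add: fock_space_def flip: fock_weight_powr)

lemma fock_norm_eq:
  fixes f :: "complex ^ 'n \<Rightarrow> complex"
  assumes "0 < p"
  shows "fock_norm \<alpha> (ennreal p) f =
    ((\<alpha> * p / (2 * pi)) ^ CARD('n) * (LINT z|lborel. fock_weight \<alpha> f z powr p)) powr (1 / p)"
  using assms by (simp add: fock_norm_def flip: fock_weight_powr)

lemma fock_norm_nonneg: "0 < p \<Longrightarrow> 0 \<le> fock_norm \<alpha> (ennreal p) f"
  by (simp add: fock_norm_eq)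

lemma nn_integral_fock_weight:
  fixes f :: "complex ^ 'n \<Rightarrow> complex"
  assumes "0 < \<alpha>" "0 < p" "f \<in> fock_space \<alpha> (ennreal p)"
  shows "(\<integral>\<^sup>+z. ennreal (fock_weight \<alpha> f z powr p) \<partial>lborel) =
    ennreal ((2 * pi / (\<alpha> * p)) ^ CARD('n) * fock_norm \<alpha> (ennreal p) f powr p)"
proof -
  define I where "I = (LINT z|lborel. fock_weight \<alpha> f z powr p)"
  have "0 \<le> I" by (simp add: I_def)
  have "(\<integral>\<^sup>+z. ennreal (fock_weight \<alpha> f z powr p) \<partial>lborel) = ennreal I"
    unfolding I_def using assms by (intro nn_integral_eq_integral) (simp_all add: fock_space_iff)
  moreover have "fock_norm \<alpha> (ennreal p) f powr p = (\<alpha> * p / (2 * pi)) ^ CARD('n) * I"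
    using assms \<open>0 \<le> I\<close> by (simp add: fock_norm_eq powr_powr flip: I_def)
  ultimately show ?thesis
    using assms by (simp add: power_divide)
qed

text \<open>
  The function \<open>F(u) = f(u + w) exp(- \<alpha>\<langle>u, w\<rangle> - \<alpha>|w|\<^sup>2/2)\<close> is entire, and its weighted modulus at \<open>u\<close> is
  that of \<open>f\<close> at \<open>w + u\<close>. This Weyl translation moves the centre to the origin; on the unit ball the
  remaining Gaussian factor lies between \<open>exp(- \<alpha>/2)\<close> and \<open>1\<close>.
\<close>

lemma fock_weight_submean:
  fixes \<alpha> p :: real
  assumes "0 < \<alpha>" "1 \<le> p"
  obtains C where "0 < C" "\<And>(f :: complex ^ 'n \<Rightarrow> complex) w. entire f \<Longrightarrow>
    ennreal (fock_weight \<alpha> f w powr p) \<le>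
      ennreal C * (\<integral>\<^sup>+u. ennreal (fock_weight \<alpha> f u powr p) * indicator (ball w 1) u \<partial>lborel)"
proof
  define V where "V = measure lborel (ball (0 :: complex ^ 'n) 1)"
  have V: "0 < V" "emeasure lborel (ball (0 :: complex ^ 'n) 1) = ennreal V"
    using content_ball_pos[of 1 "0::complex^'n"] emeasure_lborel_ball_finite[of "0::complex ^ 'n" 1]
    by (simp_all add: V_def emeasure_eq_ennreal_measure)
  show "0 < exp (\<alpha> * p / 2) / V" using V by simp
  fix f :: "complex ^ 'n \<Rightarrow> complex" and w :: "complex ^ 'n"
  assume f: "entire f"
  note [measurable] = entire_measurable[OF f]
  have [measurable]: "ball w 1 \<in> sets borel" by simp
  define F where "F u = of_real (exp (- (\<alpha> / 2) * (norm w)\<^sup>2)) * (f (u + w) * fock_kernel (- \<alpha>) w u)" for u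
  have "entire F"
    unfolding F_def by (intro entire_cmult entire_mult entire_translate entire_fock_kernel f)
  have F: "norm (F u) = fock_weight \<alpha> f (w + u) * exp (\<alpha> / 2 * (norm u)\<^sup>2)" for u
  proof -
    have "(norm (w + u))\<^sup>2 = (norm u)\<^sup>2 + 2 * (u \<bullet> w) + (norm w)\<^sup>2"
      by (simp add: power2_norm_eq_inner inner_add_left inner_add_right inner_commute)
    then have "- (\<alpha> / 2) * (norm w)\<^sup>2 + (- \<alpha>) * (u \<bullet> w) = - (\<alpha> / 2) * (norm (w + u))\<^sup>2 + \<alpha> / 2 * (norm u)\<^sup>2"
      by (simp add: field_simps)
    then have "exp (- (\<alpha> / 2) * (norm w)\<^sup>2) * exp ((- \<alpha>) * (u \<bullet> w)) =
        exp (- (\<alpha> / 2) * (norm (w + u))\<^sup>2) * exp (\<alpha> / 2 * (norm u)\<^sup>2)"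
      by (metis exp_add)
    then show ?thesis
      by (simp add: F_def norm_mult norm_fock_kernel fock_weight_def add.commute mult.left_commute)
  qed
  have le: "norm (F u) powr p \<le> exp (\<alpha> * p / 2) * fock_weight \<alpha> f (w + u) powr p" if "u \<in> ball 0 1" for u
  proof -
    have "(norm u)\<^sup>2 \<le> 1" using that by (simp add: abs_square_le_1)
    then have "exp (\<alpha> / 2 * (norm u)\<^sup>2) \<le> exp (\<alpha> / 2)"
      using assms(1) by simp
    then have "norm (F u) \<le> fock_weight \<alpha> f (w + u) * exp (\<alpha> / 2)"
      unfolding F by (rule mult_left_mono) simp
    then have "norm (F u) powr p \<le> (fock_weight \<alpha> f (w + u) * exp (\<alpha> / 2)) powr p"
      using assms by (intro powr_mono2) auto
    also have "\<dots> = exp (\<alpha> * p / 2) * fock_weight \<alpha> f (w + u) powr p"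
      by (simp add: powr_mult) (simp add: powr_def field_simps)
    finally show ?thesis .
  qed
  have "ennreal (fock_weight \<alpha> f w powr p) * ennreal V \<le>
      (\<integral>\<^sup>+u. ennreal (norm (F u) powr p) * indicator (ball 0 1) u \<partial>lborel)"
    using ball_submean[OF \<open>entire F\<close> assms(2)] F[of 0] by (simp add: V)
  also have "\<dots> \<le> (\<integral>\<^sup>+u. ennreal (exp (\<alpha> * p / 2)) *
      (ennreal (fock_weight \<alpha> f (w + u) powr p) * indicator (ball w 1) (w + u)) \<partial>lborel)"
    by (intro nn_integral_mono)
       (use le in \<open>auto simp: indicator_def dist_norm ennreal_mult'[symmetric] intro!: ennreal_leI\<close>)
  also have "\<dots> = ennreal (exp (\<alpha> * p / 2)) *
      (\<integral>\<^sup>+u. ennreal (fock_weight \<alpha> f (w + u) powr p) * indicator (ball w 1) (w + u) \<partial>lborel)"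
    by (rule nn_integral_cmult) measurable
  also have "(\<integral>\<^sup>+u. ennreal (fock_weight \<alpha> f (w + u) powr p) * indicator (ball w 1) (w + u) \<partial>lborel) =
      (\<integral>\<^sup>+u. ennreal (fock_weight \<alpha> f u powr p) * indicator (ball w 1) u \<partial>lborel)"
    by (rule nn_integral_lborel_translate) measurable
  finally have *: "ennreal (fock_weight \<alpha> f w powr p) * ennreal V \<le> ennreal (exp (\<alpha> * p / 2)) *
      (\<integral>\<^sup>+u. ennreal (fock_weight \<alpha> f u powr p) * indicator (ball w 1) u \<partial>lborel)" .
  have "ennreal (fock_weight \<alpha> f w powr p) = ennreal (1 / V) * (ennreal (fock_weight \<alpha> f w powr p) * ennreal V)"
    using V by (simp add: ennreal_mult'[symmetric])
  also have "\<dots> \<le> ennreal (1 / V) * (ennreal (exp (\<alpha> * p / 2)) *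
      (\<integral>\<^sup>+u. ennreal (fock_weight \<alpha> f u powr p) * indicator (ball w 1) u \<partial>lborel))"
    by (intro mult_left_mono *) simp
  also have "\<dots> = ennreal (exp (\<alpha> * p / 2) / V) *
      (\<integral>\<^sup>+u. ennreal (fock_weight \<alpha> f u powr p) * indicator (ball w 1) u \<partial>lborel)"
    using V by (simp add: ennreal_mult'[symmetric] mult.assoc[symmetric])
  finally show "ennreal (fock_weight \<alpha> f w powr p) \<le> ennreal (exp (\<alpha> * p / 2) / V) *
      (\<integral>\<^sup>+u. ennreal (fock_weight \<alpha> f u powr p) * indicator (ball w 1) u \<partial>lborel)" .
qed

lemma fock_weight_le_fock_norm:
  fixes \<alpha> p :: real
  assumes "0 < \<alpha>" "1 \<le> p"
  obtains C where "0 < C" "\<And>(f :: complex ^ 'n \<Rightarrow> complex) w. f \<in> fock_space \<alpha> (ennreal p) \<Longrightarrow>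
    fock_weight \<alpha> f w \<le> C * fock_norm \<alpha> (ennreal p) f"
proof -
  obtain C where C: "0 < C" "\<And>(f :: complex ^ 'n \<Rightarrow> complex) w. entire f \<Longrightarrow>
    ennreal (fock_weight \<alpha> f w powr p) \<le>
      ennreal C * (\<integral>\<^sup>+u. ennreal (fock_weight \<alpha> f u powr p) * indicator (ball w 1) u \<partial>lborel)"
    using fock_weight_submean[OF assms, where 'n = 'n] by blast
  define D where "D = C * (2 * pi / (\<alpha> * p)) ^ CARD('n)"
  have "0 < D" using C assms by (simp add: D_def)
  have "fock_weight \<alpha> f w \<le> D powr (1 / p) * fock_norm \<alpha> (ennreal p) f"
    if f: "f \<in> fock_space \<alpha> (ennreal p)" for f :: "complex ^ 'n \<Rightarrow> complex" and w
  proof -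
    have p: "0 < p" using assms by simp
    have "entire f" using f p by (simp add: fock_space_iff)
    then have "ennreal (fock_weight \<alpha> f w powr p) \<le> 
      ennreal C * (\<integral>\<^sup>+u. ennreal (fock_weight \<alpha> f u powr p) * indicator (ball w 1) u \<partial>lborel)"
      by (rule C(2))
    also have "\<dots> \<le> ennreal C * (\<integral>\<^sup>+u. ennreal (fock_weight \<alpha> f u powr p) \<partial>lborel)"
      by (intro mult_left_mono nn_integral_mono) (auto simp: indicator_def)
    also have "\<dots> = ennreal (D * fock_norm \<alpha> (ennreal p) f powr p)"
      using C assms p by (simp add: nn_integral_fock_weight[OF assms(1) p f] D_def mult.assoc flip: ennreal_mult')
    finally have "fock_weight \<alpha> f w powr p \<le> D * fock_norm \<alpha> (ennreal p) f powr p"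
      using \<open>0 < D\<close> by simp
    then have "(fock_weight \<alpha> f w powr p) powr (1 / p) \<le> (D * fock_norm \<alpha> (ennreal p) f powr p) powr (1 / p)"
      using p by (intro powr_mono2) auto
    then show ?thesis
      using p \<open>0 < D\<close> fock_norm_nonneg[OF p, of \<alpha> f] by (simp add: powr_powr powr_mult)
  qed
  then show thesis
    using \<open>0 < D\<close> by (intro that[of "D powr (1 / p)"]) auto
qed

section \<open>Measures with uniformly bounded unit balls\<close>

text \<open>
  The bound is a real number, nonnegative by definition: \<open>ennreal\<close> sends negative reals to \<open>0\<close>, and the
  estimates below multiply \<open>M\<close> by real constants before converting.
\<close>

definition unit_balls_le :: "'a::metric_space measure \<Rightarrow> real \<Rightarrow> bool" where
  "unit_balls_le \<mu> M \<longleftrightarrow> 0 \<le> M \<and> (\<forall>w. emeasure \<mu> (ball w 1) \<le> ennreal M)"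

lemma unit_balls_le_sigma_finite:
  fixes \<mu> :: "'a::{metric_space, second_countable_topology} measure"
  assumes sets: "sets \<mu> = sets borel" and M: "unit_balls_le \<mu> M"
  shows "sigma_finite_measure \<mu>"
proof
  obtain D :: "'a set" where D: "countable D" "\<And>X. open X \<Longrightarrow> X \<noteq> {} \<Longrightarrow> \<exists>d\<in>D. d \<in> X"
    by (rule countable_dense_setE) blast
  show "\<exists>A. countable A \<and> A \<subseteq> sets \<mu> \<and> \<Union> A = space \<mu> \<and> (\<forall>a\<in>A. emeasure \<mu> a \<noteq> \<infinity>)"
  proof (intro exI conjI)
    show "countable ((\<lambda>d. ball d 1) ` D)" using D by simp
    show "(\<lambda>d. ball d 1) ` D \<subseteq> sets \<mu>" by (auto simp: sets)
    have "\<exists>d\<in>D. dist d x < 1" for x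
      using D(2)[of "ball x 1"] by (auto simp: dist_commute)
    then show "\<Union> ((\<lambda>d. ball d 1) ` D) = space \<mu>"
      using sets_eq_imp_space_eq[OF sets] by auto
    show "\<forall>a\<in>(\<lambda>d. ball d 1) ` D. emeasure \<mu> a \<noteq> \<infinity>"
      using M by (auto simp: unit_balls_le_def) (metis ennreal_less_top leD)
  qed
qed

text \<open>
  Exchanging the integrals leaves \<open>\<integral> h(u) \<mu>(B(u, 1)) du\<close>. This is the only place where the masses of unit
  balls enter an upper estimate.
\<close>

lemma nn_integral_over_unit_balls_le:
  fixes \<mu> :: "'a::euclidean_space measure"
  assumes sets[measurable_cong]: "sets \<mu> = sets borel" and M: "unit_balls_le \<mu> M"
    and [measurable]: "h \<in> borel_measurable borel"
  shows "(\<integral>\<^sup>+w. (\<integral>\<^sup>+u. h u * indicator (ball w 1) u \<partial>lborel) \<partial>\<mu>) \<le> ennreal M * (\<integral>\<^sup>+u. h u \<partial>lborel)"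
proof -
  interpret mu: sigma_finite_measure \<mu> by (rule unit_balls_le_sigma_finite[OF sets M])
  interpret pair_sigma_finite \<mu> lborel ..
  have open_adj: "open {z :: 'a \<times> 'a. dist (fst z) (snd z) < 1}"
    by (intro open_Collect_less continuous_intros)
  have [measurable]: "{z :: 'a \<times> 'a. dist (fst z) (snd z) < 1} \<in> sets (borel \<Otimes>\<^sub>M borel)"
    unfolding borel_prod by (rule borel_open[OF open_adj])
  have ind: "indicator (ball w 1) u = (indicator {z :: 'a \<times> 'a. dist (fst z) (snd z) < 1} (w, u) :: ennreal)" for w u
    by (simp add: indicator_def)
  have "(\<integral>\<^sup>+w. (\<integral>\<^sup>+u. h u * indicator (ball w 1) u \<partial>lborel) \<partial>\<mu>) =
      (\<integral>\<^sup>+u. (\<integral>\<^sup>+w. h u * indicator (ball w 1) u \<partial>\<mu>) \<partial>lborel)"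
    unfolding ind by (rule Fubini'[symmetric]) measurable
  also have "\<dots> = (\<integral>\<^sup>+u. h u * emeasure \<mu> (ball u 1) \<partial>lborel)"
  proof (rule nn_integral_cong)
    fix u
    have "(\<integral>\<^sup>+w. h u * indicator (ball w 1) u \<partial>\<mu>) = (\<integral>\<^sup>+w. h u * indicator (ball u 1) w \<partial>\<mu>)"
      by (intro nn_integral_cong) (simp add: indicator_def dist_commute)
    also have "\<dots> = h u * emeasure \<mu> (ball u 1)"
      by (rule nn_integral_cmult_indicator) (simp add: sets)
    finally show "(\<integral>\<^sup>+w. h u * indicator (ball w 1) u \<partial>\<mu>) = \<dots>" .
  qed
  also have "\<dots> \<le> (\<integral>\<^sup>+u. h u * ennreal M \<partial>lborel)"
    using M by (intro nn_integral_mono mult_left_mono) (auto simp: unit_balls_le_def)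
  also have "\<dots> = ennreal M * (\<integral>\<^sup>+u. h u \<partial>lborel)"
    by (simp add: nn_integral_cmult mult.commute[of _ "ennreal M"])
  finally show ?thesis .
qed

text \<open>
  The Carleson inequality for \<open>q = 1\<close> is the sub-mean value property integrated against \<open>\<mu>\<close>. For larger
  \<open>q\<close> one factors out \<open>q - 1\<close> powers of the weighted modulus, which are bounded by the norm.
\<close>

lemma nn_integral_fock_weight_powr_le:
  fixes \<alpha> q :: real
  assumes "0 < \<alpha>" "1 \<le> q"
  obtains C where "0 < C" "\<And>(f :: complex ^ 'n \<Rightarrow> complex) \<mu> M.
    f \<in> fock_space \<alpha> 1 \<Longrightarrow> sets \<mu> = sets borel \<Longrightarrow> unit_balls_le \<mu> M \<Longrightarrow>
    (\<integral>\<^sup>+u. ennreal (fock_weight \<alpha> f u powr q) \<partial>\<mu>) \<le> ennreal (C * M * fock_norm \<alpha> 1 f powr q)"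
proof -
  obtain C1 where C1: "0 < C1" "\<And>(f :: complex ^ 'n \<Rightarrow> complex) w. entire f \<Longrightarrow>
    ennreal (fock_weight \<alpha> f w powr 1) \<le>
      ennreal C1 * (\<integral>\<^sup>+u. ennreal (fock_weight \<alpha> f u powr 1) * indicator (ball w 1) u \<partial>lborel)"
    using fock_weight_submean[OF assms(1), of 1] by auto
  obtain C2 where C2: "0 < C2" "\<And>(f :: complex ^ 'n \<Rightarrow> complex) w. f \<in> fock_space \<alpha> (ennreal 1) \<Longrightarrow>
    fock_weight \<alpha> f w \<le> C2 * fock_norm \<alpha> (ennreal 1) f"
    using fock_weight_le_fock_norm[OF assms(1), of 1] by auto
  define D where "D = C2 powr (q - 1) * C1 * (2 * pi / \<alpha>) ^ CARD('n)"
  have "0 < D" using C1 C2 assms by (simp add: D_def)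
  have "(\<integral>\<^sup>+u. ennreal (fock_weight \<alpha> f u powr q) \<partial>\<mu>) \<le> ennreal (D * M * fock_norm \<alpha> 1 f powr q)"
    if f: "f \<in> fock_space \<alpha> 1" and sets[measurable_cong]: "sets \<mu> = sets borel" and M: "unit_balls_le \<mu> M"
    for f :: "complex ^ 'n \<Rightarrow> complex" and \<mu> M
  proof -
    define N where "N = fock_norm \<alpha> 1 f"
    have "0 \<le> N" using fock_norm_nonneg[of 1 \<alpha> f] by (simp add: N_def)
    have "0 \<le> M" using M by (simp add: unit_balls_le_def)
    have f1: "f \<in> fock_space \<alpha> (ennreal 1)" using f by simp
    then have "entire f" using fock_space_iff[of 1 f \<alpha>] by simp
    note [measurable] = entire_measurable[OF this]
    have [measurable]: "ball x 1 \<in> sets borel" for x :: "complex ^ 'n" by simp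
    have int: "(\<integral>\<^sup>+u. ennreal (fock_weight \<alpha> f u) \<partial>lborel) = ennreal ((2 * pi / \<alpha>) ^ CARD('n) * N)"
      using nn_integral_fock_weight[OF assms(1) _ f1] \<open>0 \<le> N\<close> by (simp add: N_def)
    have "fock_weight \<alpha> f u powr q \<le> (C2 * N) powr (q - 1) * fock_weight \<alpha> f u" for u
    proof -
      have "fock_weight \<alpha> f u powr q = fock_weight \<alpha> f u powr (q - 1) * fock_weight \<alpha> f u"
        by (simp add: powr_diff)
      also have "\<dots> \<le> (C2 * N) powr (q - 1) * fock_weight \<alpha> f u"
        using C2(2)[OF f1, of u] assms by (intro mult_right_mono powr_mono2) (auto simp: N_def)
      finally show ?thesis .
    qed
    then have "(\<integral>\<^sup>+u. ennreal (fock_weight \<alpha> f u powr q) \<partial>\<mu>) \<le>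
        (\<integral>\<^sup>+u. ennreal ((C2 * N) powr (q - 1)) * ennreal (fock_weight \<alpha> f u) \<partial>\<mu>)"
      by (intro nn_integral_mono) (simp flip: ennreal_mult')
    also have "\<dots> = ennreal ((C2 * N) powr (q - 1)) * (\<integral>\<^sup>+u. ennreal (fock_weight \<alpha> f u) \<partial>\<mu>)"
      by (rule nn_integral_cmult) measurable
    also have "(\<integral>\<^sup>+u. ennreal (fock_weight \<alpha> f u) \<partial>\<mu>) \<le>
        (\<integral>\<^sup>+w. (\<integral>\<^sup>+u. (ennreal C1 * ennreal (fock_weight \<alpha> f u)) * indicator (ball w 1) u \<partial>lborel) \<partial>\<mu>)"
      using C1(2)[OF \<open>entire f\<close>]
      by (intro nn_integral_mono) (simp add: mult.assoc nn_integral_cmult)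
    also have "\<dots> \<le> ennreal M * (\<integral>\<^sup>+u. ennreal C1 * ennreal (fock_weight \<alpha> f u) \<partial>lborel)"
      by (rule nn_integral_over_unit_balls_le[OF sets M]) measurable
    also have "\<dots> = ennreal (M * (C1 * ((2 * pi / \<alpha>) ^ CARD('n) * N)))"
      using \<open>0 \<le> M\<close> \<open>0 < C1\<close> by (simp add: nn_integral_cmult int ennreal_mult')
    finally have "(\<integral>\<^sup>+u. ennreal (fock_weight \<alpha> f u powr q) \<partial>\<mu>) \<le> 
        ennreal ((C2 * N) powr (q - 1)) * ennreal (M * (C1 * ((2 * pi / \<alpha>) ^ CARD('n) * N)))"
      by (simp add: mult_left_mono)
    also have "\<dots> = ennreal (D * M * N powr q)"
    proof -
      have "N powr q = N powr (q - 1) * N"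
        using \<open>0 \<le> N\<close> by (simp add: powr_diff)
      then show ?thesis
        using \<open>0 < C2\<close> \<open>0 \<le> N\<close> by (simp add: D_def powr_mult mult_ac flip: ennreal_mult')
    qed
    finally show ?thesis by (simp add: N_def)
  qed
  with \<open>0 < D\<close> show thesis by (rule that)
qed

section \<open>Gaussian integrals\<close>

text \<open>
  These terms bound the Gaussian integrals over the shells \<open>k \<le> |u| < k + 1\<close> in dimension \<open>d\<close>,
  up to the volume of the unit ball.
\<close>

lemma summable_gaussian_shells:
  fixes c :: real
  assumes "0 < c"
  shows "summable (\<lambda>k. exp (- c * (real k)\<^sup>2) * (real k + 1) ^ d)"
proof (rule summable_comparison_test')
  show "summable (\<lambda>k. (fact d * exp 1) * exp (- 1 :: real) ^ k)"
    by (intro summable_mult summable_geometric) simp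
  fix k assume k: "nat \<lceil>2 / c\<rceil> \<le> k"
  then have "2 / c \<le> real k" by linarith
  then have "2 * real k \<le> c * real k * real k"
    using assms by (intro mult_right_mono) (simp_all add: field_simps)
  then have 1: "- c * (real k)\<^sup>2 + (real k + 1) \<le> 1 + real k * (- 1)"
    by (simp add: power2_eq_square mult.assoc)
  have "(real k + 1) ^ d / fact d \<le> exp (real k + 1)"
    using sum_le_suminf[of "\<lambda>n. (real k + 1) ^ n /\<^sub>R fact n" "{d}"] summable_exp_generic[of "real k + 1"]
    by (simp add: exp_def divide_inverse mult.commute)
  then have "(real k + 1) ^ d \<le> fact d * exp (real k + 1)"
    by (simp add: field_simps)
  then have "exp (- c * (real k)\<^sup>2) * (real k + 1) ^ d \<le> exp (- c * (real k)\<^sup>2) * (fact d * exp (real k + 1))"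
    by (rule mult_left_mono) simp
  also have "\<dots> = fact d * exp (- c * (real k)\<^sup>2 + (real k + 1))"
    unfolding exp_add by (simp add: mult_ac)
  also have "\<dots> \<le> fact d * exp (1 + real k * (- 1))"
    using 1 by (intro mult_left_mono) auto
  also have "\<dots> = (fact d * exp 1) * exp (- 1) ^ k"
    unfolding exp_add exp_of_nat_mult by simp
  finally show "norm (exp (- c * (real k)\<^sup>2) * (real k + 1) ^ d) \<le> (fact d * exp 1) * exp (- 1) ^ k"
    by simp
qed

lemma nn_integral_gaussian_finite:
  fixes c :: real
  assumes "0 < c"
  shows "(\<integral>\<^sup>+u. ennreal (exp (- c * (norm u)\<^sup>2)) \<partial>(lborel :: ('a::euclidean_space) measure)) < \<infinity>"
proof -
  define g where "g k u = ennreal (exp (- c * (real k)\<^sup>2)) * indicator (ball (0::'a) (real k + 1)) u" for k u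
  have [measurable]: "ball (0::'a) r \<in> sets borel" for r by simp
  have [measurable]: "g k \<in> borel_measurable borel" for k
    unfolding g_def by measurable
  define V where "V = measure lborel (ball (0 :: 'a) 1)"
  have "0 \<le> V" by (simp add: V_def)
  have V: "emeasure lborel (ball (0 :: 'a) (real k + 1)) = ennreal ((real k + 1) ^ DIM('a) * V)" for k
    using content_ball_conv_unit_ball[of "real k + 1" "0::'a"] emeasure_lborel_ball_finite[of "0::'a" "real k + 1"]
    by (simp add: V_def emeasure_eq_ennreal_measure)
  have "(\<integral>\<^sup>+u. ennreal (exp (- c * (norm u)\<^sup>2)) \<partial>(lborel :: ('a) measure)) \<le> (\<integral>\<^sup>+u. (\<Sum>k. g k u) \<partial>lborel)"
  proof (rule nn_integral_mono)
    fix u :: 'a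
    define k where "k = nat \<lfloor>norm u\<rfloor>"
    have k: "real k \<le> norm u" "norm u < real k + 1" by (simp_all add: k_def)
    then have "(real k)\<^sup>2 \<le> (norm u)\<^sup>2" by (intro power_mono) auto
    then have "ennreal (exp (- c * (norm u)\<^sup>2)) \<le> g k u"
      using k assms by (simp add: g_def ennreal_leI)
    also have "\<dots> \<le> (\<Sum>k. g k u)"
      using sum_le_suminf[of "\<lambda>k. g k u" "{k}"] by simp
    finally show "ennreal (exp (- c * (norm u)\<^sup>2)) \<le> (\<Sum>k. g k u)" .
  qed
  also have "\<dots> = (\<Sum>k. \<integral>\<^sup>+u. g k u \<partial>lborel)"
    by (rule nn_integral_suminf) measurable
  also have "\<dots> = (\<Sum>k. ennreal (exp (- c * (real k)\<^sup>2) * (real k + 1) ^ DIM('a) * V))"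
    unfolding g_def
    by (subst nn_integral_cmult_indicator) (simp_all add: V \<open>0 \<le> V\<close> mult.assoc flip: ennreal_mult')
  also have "\<dots> < \<infinity>"
  proof -
    have "summable (\<lambda>k. exp (- c * (real k)\<^sup>2) * (real k + 1) ^ DIM('a) * V)"
      by (intro summable_mult2 summable_gaussian_shells assms)
    then show ?thesis
      using \<open>0 \<le> V\<close> by (subst suminf_ennreal2) auto
  qed
  finally show ?thesis .
qed

text \<open>
  The Gaussian at \<open>w\<close> is bounded by a multiple of a flatter Gaussian averaged over the unit ball about
  \<open>w\<close>, since \<open>|u|\<^sup>2 \<le> 2|w|\<^sup>2 + 2\<close> there. So finiteness passes from Lebesgue measure to \<open>\<mu>\<close>.
\<close>

lemma nn_integral_gaussian_finite_unit_balls: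
  fixes c :: real and \<mu> :: "'a::euclidean_space measure"
  assumes "0 < c" and sets[measurable_cong]: "sets \<mu> = sets borel" and M: "unit_balls_le \<mu> M"
  shows "(\<integral>\<^sup>+u. ennreal (exp (- c * (norm u)\<^sup>2)) \<partial>\<mu>) < \<infinity>"
proof -
  define V where "V = measure lborel (ball (0 :: 'a) 1)"
  have V: "0 < V" "emeasure lborel (ball w 1) = ennreal V" for w :: 'a
    using content_ball_pos[of 1 "0::'a"] emeasure_lborel_ball_finite[of w 1]
      content_ball_conv_unit_ball[of 1 w]
    by (simp_all add: V_def emeasure_eq_ennreal_measure)
  define h where "h u = ennreal (exp c / V * exp (- (c / 2) * (norm u)\<^sup>2))" for u :: 'a
  have [measurable]: "h \<in> borel_measurable borel" unfolding h_def by measurable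
  have "ennreal (exp (- c * (norm w)\<^sup>2)) \<le> (\<integral>\<^sup>+u. h u * indicator (ball w 1) u \<partial>lborel)" for w :: 'a
  proof -
    have "exp (- c * (norm w)\<^sup>2) \<le> exp c * exp (- (c / 2) * (norm u)\<^sup>2)" if "u \<in> ball w 1" for u
    proof -
      have "norm u \<le> norm w + 1"
        using that norm_triangle_ineq2[of u w] by (simp add: dist_norm norm_minus_commute)
      then have "(norm u)\<^sup>2 \<le> (norm w + 1)\<^sup>2" by (intro power_mono) auto
      also have "\<dots> \<le> 2 * (norm w)\<^sup>2 + 2"
        using sum_squares_bound[of "norm w" 1] by (simp add: power2_sum)
      finally have "c * (norm u)\<^sup>2 \<le> c * (2 * (norm w)\<^sup>2 + 2)"
        using assms by (intro mult_left_mono) auto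
      then have "- c * (norm w)\<^sup>2 \<le> c + - (c / 2) * (norm u)\<^sup>2"
        by (simp add: algebra_simps)
      then show ?thesis
        by (simp flip: exp_add)
    qed
    then have "(\<integral>\<^sup>+u. ennreal (exp (- c * (norm w)\<^sup>2) / V) * indicator (ball w 1) u \<partial>lborel) \<le>
        (\<integral>\<^sup>+u. h u * indicator (ball w 1) u \<partial>lborel)"
      using V by (intro nn_integral_mono) (auto simp: h_def indicator_def intro!: ennreal_leI divide_right_mono)
    then show ?thesis
      using V(1) by (subst (asm) nn_integral_cmult_indicator) (simp_all add: V(2) flip: ennreal_mult')
  qed
  then have "(\<integral>\<^sup>+u. ennreal (exp (- c * (norm u)\<^sup>2)) \<partial>\<mu>) \<le>
      (\<integral>\<^sup>+w. (\<integral>\<^sup>+u. h u * indicator (ball w 1) u \<partial>lborel) \<partial>\<mu>)"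
    by (intro nn_integral_mono)
  also have "\<dots> \<le> ennreal M * (\<integral>\<^sup>+u. h u \<partial>lborel)"
    by (rule nn_integral_over_unit_balls_le[OF sets M]) measurable
  also have "\<dots> = ennreal M * (ennreal (exp c / V) * (\<integral>\<^sup>+u. ennreal (exp (- (c / 2) * (norm u)\<^sup>2)) \<partial>(lborel :: ('a) measure)))"
    unfolding h_def using V(1) by (subst nn_integral_cmult[symmetric]) (simp_all flip: ennreal_mult')
  also have "\<dots> < \<infinity>"
    using nn_integral_gaussian_finite[of "c / 2", where 'a = 'a] assms(1)
    by (auto simp: ennreal_mult_less_top)
  finally show ?thesis .
qed

section \<open>Normalized kernels\<close>

definition normalized_kernel :: "real \<Rightarrow> complex ^ 'n \<Rightarrow> complex ^ 'n \<Rightarrow> complex" where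
  "normalized_kernel \<alpha> w z = of_real (exp (- (\<alpha> / 2) * (norm w)\<^sup>2)) * fock_kernel \<alpha> w z"

lemma entire_normalized_kernel: "entire (normalized_kernel \<alpha> w)"
  unfolding normalized_kernel_def [abs_def] by (intro entire_cmult entire_fock_kernel)

lemma fock_kernel_weighted:
  "norm (fock_kernel \<alpha> w z) * exp (- (\<alpha> / 2) * (norm w)\<^sup>2) * exp (- (\<alpha> / 2) * (norm z)\<^sup>2) =
    exp (- (\<alpha> / 2) * (norm (z - w))\<^sup>2)"
  unfolding norm_fock_kernel norm_diff_sq exp_add[symmetric] by (simp add: field_simps)

lemma fock_weight_normalized_kernel:
  "fock_weight \<alpha> (normalized_kernel \<alpha> w) z = exp (- (\<alpha> / 2) * (norm (z - w))\<^sup>2)"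
  unfolding fock_kernel_weighted[symmetric] fock_weight_def normalized_kernel_def
  by (simp add: norm_mult)

lemma fock_weight_normalized_kernel_powr:
  "fock_weight \<alpha> (normalized_kernel \<alpha> w) z powr q = exp (- (\<alpha> * q / 2) * (norm (z - w))\<^sup>2)"
  by (simp add: fock_weight_normalized_kernel powr_def)

text \<open>
  The weighted modulus of \<open>k\<^sub>w\<close> is a translate of that of \<open>k\<^sub>0 = 1\<close>, so the norm does not depend on \<open>w\<close>.
\<close>

lemma normalized_kernel_fock:
  fixes \<alpha> p :: real
  assumes "0 < \<alpha>" "1 \<le> p"
  obtains C where "0 < C" "\<And>w :: complex ^ 'n. normalized_kernel \<alpha> w \<in> fock_space \<alpha> (ennreal p)"
    "\<And>w :: complex ^ 'n. fock_norm \<alpha> (ennreal p) (normalized_kernel \<alpha> w) \<le> C"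
proof -
  have p: "0 < p" using assms by simp
  define G where "G = (\<integral>\<^sup>+u. ennreal (exp (- (\<alpha> * p / 2) * (norm u)\<^sup>2)) \<partial>(lborel :: (complex ^ 'n) measure))"
  have G: "G < \<infinity>"
    unfolding G_def using assms by (intro nn_integral_gaussian_finite) simp
  have int: "(\<integral>\<^sup>+z. ennreal (fock_weight \<alpha> (normalized_kernel \<alpha> w) z powr p) \<partial>lborel) = G" for w :: "complex ^ 'n"
    using nn_integral_lborel_translate[of "\<lambda>u. ennreal (exp (- (\<alpha> * p / 2) * (norm u)\<^sup>2))" "- w"]
    by (simp add: G_def fock_weight_normalized_kernel_powr)
  have in_space: "normalized_kernel \<alpha> w \<in> fock_space \<alpha> (ennreal p)" for w :: "complex ^ 'n"
    unfolding fock_space_iff[OF p]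
    using entire_measurable[OF entire_normalized_kernel[of \<alpha> w]] G
    by (auto simp: entire_normalized_kernel int intro!: integrableI_nonneg)
  have "fock_norm \<alpha> (ennreal p) (normalized_kernel \<alpha> w) =
      ((\<alpha> * p / (2 * pi)) ^ CARD('n) * enn2real G) powr (1 / p)" for w :: "complex ^ 'n"
    using entire_measurable[OF entire_normalized_kernel[of \<alpha> w]] 
    by (simp add: fock_norm_eq[OF p] integral_eq_nn_integral int)
  then show thesis
    using in_space
    by (intro that[of "1 + ((\<alpha> * p / (2 * pi)) ^ CARD('n) * enn2real G) powr (1 / p)"])
       (auto intro: add_pos_nonneg)
qed

section \<open>The Toeplitz integral\<close>

lemma emeasure_unit_ball_le_gaussian:
  fixes c :: real and \<mu> :: "'a::euclidean_space measure"
  assumes "0 \<le> c" and sets: "sets \<mu> = sets borel"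
  shows "emeasure \<mu> (ball w 1) \<le> ennreal (exp c) * (\<integral>\<^sup>+u. ennreal (exp (- c * (norm (u - w))\<^sup>2)) \<partial>\<mu>)"
proof -
  note sets[measurable_cong]
  have "emeasure \<mu> (ball w 1) = (\<integral>\<^sup>+u. indicator (ball w 1) u \<partial>\<mu>)"
    by (simp add: sets)
  also have "\<dots> \<le> (\<integral>\<^sup>+u. ennreal (exp c) * ennreal (exp (- c * (norm (u - w))\<^sup>2)) \<partial>\<mu>)"
  proof (rule nn_integral_mono)
    fix u
    show "indicator (ball w 1) u \<le> ennreal (exp c) * ennreal (exp (- c * (norm (u - w))\<^sup>2))"
    proof (cases "u \<in> ball w 1")
      case True
      then have "(norm (u - w))\<^sup>2 \<le> 1"
        by (simp add: abs_square_le_1 dist_norm norm_minus_commute)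
      then have "c * (norm (u - w))\<^sup>2 \<le> c * 1"
        using assms(1) by (intro mult_left_mono) auto
      then have "1 \<le> exp (c + - c * (norm (u - w))\<^sup>2)" by simp
      then have "1 \<le> exp c * exp (- c * (norm (u - w))\<^sup>2)" by (simp only: exp_add)
      then show ?thesis by (simp add: indicator_def flip: ennreal_mult')
    qed simp
  qed
  also have "\<dots> = ennreal (exp c) * (\<integral>\<^sup>+u. ennreal (exp (- c * (norm (u - w))\<^sup>2)) \<partial>\<mu>)"
    by (rule nn_integral_cmult) measurable
  finally show ?thesis .
qed

lemma emeasure_cball_finite:
  fixes c :: real and \<mu> :: "'a::euclidean_space measure"
  assumes "0 \<le> c" and sets: "sets \<mu> = sets borel"
    and fin: "(\<integral>\<^sup>+u. ennreal (exp (- c * (norm u)\<^sup>2)) \<partial>\<mu>) < \<infinity>"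
  shows "emeasure \<mu> (cball 0 R) < \<infinity>"
proof -
  note sets[measurable_cong]
  have "emeasure \<mu> (cball 0 R) = (\<integral>\<^sup>+u. indicator (cball 0 R) u \<partial>\<mu>)"
    by (simp add: sets)
  also have "\<dots> \<le> (\<integral>\<^sup>+u. ennreal (exp (c * R\<^sup>2)) * ennreal (exp (- c * (norm u)\<^sup>2)) \<partial>\<mu>)"
  proof (rule nn_integral_mono)
    fix u :: 'a
    show "indicator (cball 0 R) u \<le> ennreal (exp (c * R\<^sup>2)) * ennreal (exp (- c * (norm u)\<^sup>2))"
    proof (cases "u \<in> cball 0 R")
      case True
      then have "(norm u)\<^sup>2 \<le> R\<^sup>2" by (intro power_mono) auto
      then have "c * (norm u)\<^sup>2 \<le> c * R\<^sup>2"
        using assms(1) by (intro mult_left_mono) auto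
      then have "1 \<le> exp (c * R\<^sup>2 + - c * (norm u)\<^sup>2)" by simp
      then have "1 \<le> exp (c * R\<^sup>2) * exp (- c * (norm u)\<^sup>2)" by (simp only: exp_add)
      then show ?thesis by (simp add: indicator_def flip: ennreal_mult')
    qed simp
  qed
  also have "\<dots> = ennreal (exp (c * R\<^sup>2)) * (\<integral>\<^sup>+u. ennreal (exp (- c * (norm u)\<^sup>2)) \<partial>\<mu>)"
    by (rule nn_integral_cmult) measurable
  also have "\<dots> < \<infinity>"
    using fin by (simp add: ennreal_mult_less_top)
  finally show ?thesis .
qed

text \<open>
  The Carleson inequality with \<open>q = 1\<close>, applied to the kernel at \<open>z\<close>.
\<close>

lemma nn_integral_shifted_gaussian_le:
  fixes \<alpha> :: real
  assumes "0 < \<alpha>"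
  obtains C where "0 < C" "\<And>(z :: complex ^ 'n) \<mu> M. sets \<mu> = sets borel \<Longrightarrow> unit_balls_le \<mu> M \<Longrightarrow>
    (\<integral>\<^sup>+u. ennreal (exp (- (\<alpha> / 2) * (norm (u - z))\<^sup>2)) \<partial>\<mu>) \<le> ennreal (C * M)"
proof -
  obtain C1 where C1: "0 < C1" "\<And>(f :: complex ^ 'n \<Rightarrow> complex) \<mu> M.
    f \<in> fock_space \<alpha> 1 \<Longrightarrow> sets \<mu> = sets borel \<Longrightarrow> unit_balls_le \<mu> M \<Longrightarrow>
    (\<integral>\<^sup>+u. ennreal (fock_weight \<alpha> f u powr 1) \<partial>\<mu>) \<le> ennreal (C1 * M * fock_norm \<alpha> 1 f powr 1)"
    using nn_integral_fock_weight_powr_le[OF assms, of 1, where 'n = 'n] by blast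
  obtain C2 where C2: "0 < C2" "\<And>w :: complex ^ 'n. normalized_kernel \<alpha> w \<in> fock_space \<alpha> (ennreal 1)"
    "\<And>w :: complex ^ 'n. fock_norm \<alpha> (ennreal 1) (normalized_kernel \<alpha> w) \<le> C2"
    using normalized_kernel_fock[OF assms, of 1, where 'n = 'n] by auto
  have "(\<integral>\<^sup>+u. ennreal (exp (- (\<alpha> / 2) * (norm (u - z))\<^sup>2)) \<partial>\<mu>) \<le> ennreal ((C1 * C2) * M)"
    if "sets \<mu> = sets borel" and M: "unit_balls_le \<mu> M" for z :: "complex ^ 'n" and \<mu> M
  proof -
    have "(\<integral>\<^sup>+u. ennreal (exp (- (\<alpha> / 2) * (norm (u - z))\<^sup>2)) \<partial>\<mu>) =
        (\<integral>\<^sup>+u. ennreal (fock_weight \<alpha> (normalized_kernel \<alpha> z) u powr 1) \<partial>\<mu>)"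
      by (simp add: fock_weight_normalized_kernel)
    also have "\<dots> \<le> ennreal (C1 * M * fock_norm \<alpha> 1 (normalized_kernel \<alpha> z) powr 1)"
      using C2(2)[of z] that by (intro C1(2)) auto
    also have "\<dots> \<le> ennreal ((C1 * C2) * M)"
    proof (rule ennreal_leI)
      have "C1 * M * fock_norm \<alpha> 1 (normalized_kernel \<alpha> z) \<le> C1 * M * C2"
        using C1(1) M C2(3)[of z] by (intro mult_left_mono) (auto simp: unit_balls_le_def)
      then show "C1 * M * fock_norm \<alpha> 1 (normalized_kernel \<alpha> z) powr 1 \<le> (C1 * C2) * M"
        using fock_norm_nonneg[of 1 \<alpha> "normalized_kernel \<alpha> z"] by (simp add: mult_ac)
    qed
    finally show ?thesis .
  qed
  with C1(1) C2(1) show thesis by (intro that[of "C1 * C2"]) auto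
qed

lemma norm_toeplitz_integrand:
  "norm (fock_kernel \<alpha> w z * f w * of_real (exp (- \<alpha> * (norm w)\<^sup>2))) =
    exp (\<alpha> / 2 * (norm z)\<^sup>2) * (exp (- (\<alpha> / 2) * (norm (w - z))\<^sup>2) * fock_weight \<alpha> f w)"
proof -
  have "exp (- \<alpha> * (norm w)\<^sup>2) = exp (- (\<alpha> / 2) * (norm w)\<^sup>2) * exp (- (\<alpha> / 2) * (norm w)\<^sup>2)"
    by (simp flip: exp_add)
  moreover have "exp (\<alpha> / 2 * (norm z)\<^sup>2) * exp (- (\<alpha> / 2) * (norm z)\<^sup>2) = 1"
    by (simp flip: exp_add)
  ultimately show ?thesis
    unfolding norm_minus_commute[of w z] fock_kernel_weighted[symmetric] fock_weight_def
    by (simp add: norm_mult mult_ac)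
qed

text \<open>
  If the defining integral diverges, the Toeplitz transform takes the default value \<open>0\<close>, and the estimate
  is trivial.
\<close>

lemma fock_weight_toeplitz_le:
  "ennreal (fock_weight \<alpha> (toeplitz \<alpha> \<mu> f) z) \<le>
    (\<integral>\<^sup>+w. ennreal (exp (- (\<alpha> / 2) * (norm (w - z))\<^sup>2) * fock_weight \<alpha> f w) \<partial>\<mu>)"
proof (cases "integrable \<mu> (\<lambda>w. fock_kernel \<alpha> w z * f w * of_real (exp (- \<alpha> * (norm w)\<^sup>2)))")
  case True
  define F where "F w = fock_kernel \<alpha> w z * f w * of_real (exp (- \<alpha> * (norm w)\<^sup>2))" for w
  have [measurable]: "F \<in> borel_measurable \<mu>"
    using True unfolding F_def [abs_def] by (rule borel_measurable_integrable)
  have weight: "exp (- (\<alpha> / 2) * (norm z)\<^sup>2) * norm (F w) =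
      exp (- (\<alpha> / 2) * (norm (w - z))\<^sup>2) * fock_weight \<alpha> f w" for w
    unfolding F_def norm_toeplitz_integrand by (simp add: mult.assoc[symmetric] flip: exp_add)
  have "ennreal (fock_weight \<alpha> (toeplitz \<alpha> \<mu> f) z) =
      ennreal (exp (- (\<alpha> / 2) * (norm z)\<^sup>2)) * ennreal (norm (LINT w|\<mu>. F w))"
    by (simp add: fock_weight_def toeplitz_def F_def mult.commute flip: ennreal_mult')
  also have "\<dots> \<le> ennreal (exp (- (\<alpha> / 2) * (norm z)\<^sup>2)) * (\<integral>\<^sup>+w. ennreal (norm (F w)) \<partial>\<mu>)"
    using True by (intro mult_left_mono integral_norm_bound_ennreal) (auto simp: F_def)
  also have "\<dots> = (\<integral>\<^sup>+w. ennreal (exp (- (\<alpha> / 2) * (norm z)\<^sup>2)) * ennreal (norm (F w)) \<partial>\<mu>)"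
    by (rule nn_integral_cmult[symmetric]) measurable
  finally show ?thesis
    by (simp only: weight ennreal_mult'[OF exp_ge_zero, symmetric])
next
  case False
  then show ?thesis
    by (simp add: fock_weight_def toeplitz_def not_integrable_integral_eq)
qed

lemma nn_integral_gaussian_fock_weight_le:
  assumes sets: "sets \<mu> = sets borel" and B: "\<And>w. fock_weight \<alpha> f w \<le> B"
    and L: "(\<integral>\<^sup>+w. ennreal (exp (- (\<alpha> / 2) * (norm (w - z))\<^sup>2)) \<partial>\<mu>) \<le> ennreal L"
  shows "(\<integral>\<^sup>+w. ennreal (exp (- (\<alpha> / 2) * (norm (w - z))\<^sup>2) * fock_weight \<alpha> f w) \<partial>\<mu>) \<le> ennreal (B * L)"
proof -
  note sets[measurable_cong]
  have "0 \<le> B" using B[of 0] fock_weight_nonneg order_trans by blast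
  have "(\<integral>\<^sup>+w. ennreal (exp (- (\<alpha> / 2) * (norm (w - z))\<^sup>2) * fock_weight \<alpha> f w) \<partial>\<mu>) \<le>
      (\<integral>\<^sup>+w. ennreal B * ennreal (exp (- (\<alpha> / 2) * (norm (w - z))\<^sup>2)) \<partial>\<mu>)"
    using B \<open>0 \<le> B\<close>
    by (intro nn_integral_mono) (simp add: mult.commute mult_right_mono flip: ennreal_mult')
  also have "\<dots> = ennreal B * (\<integral>\<^sup>+w. ennreal (exp (- (\<alpha> / 2) * (norm (w - z))\<^sup>2)) \<partial>\<mu>)"
    by (rule nn_integral_cmult) measurable
  also have "\<dots> \<le> ennreal B * ennreal L"
    by (intro mult_left_mono L) simp
  also have "\<dots> = ennreal (B * L)"
    using \<open>0 \<le> B\<close> by (simp add: ennreal_mult')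
  finally show ?thesis .
qed

lemma herm_commute: "herm w z = cnj (herm z w)"
  by (simp add: herm_def mult.commute)

text \<open>
  At the point \<open>w\<close> the integrand of \<open>T k\<^sub>w\<close> is nonnegative, because \<open>K\<^sub>u(w)\<close> and \<open>K\<^sub>w(u)\<close> are conjugate;
  so there is no cancellation and the value is an integral of a positive function.
\<close>

lemma toeplitz_normalized_kernel_diagonal:
  assumes "integrable \<mu> (\<lambda>u. fock_kernel \<alpha> u w * normalized_kernel \<alpha> w u * of_real (exp (- \<alpha> * (norm u)\<^sup>2)))"
  shows "(\<integral>\<^sup>+u. ennreal (exp (- \<alpha> * (norm (u - w))\<^sup>2)) \<partial>\<mu>) =
    ennreal (fock_weight \<alpha> (toeplitz \<alpha> \<mu> (normalized_kernel \<alpha> w)) w)"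
proof -
  have sq: "fock_kernel \<alpha> u w * fock_kernel \<alpha> w u = of_real ((exp (\<alpha> * (u \<bullet> w)))\<^sup>2)" for u
  proof -
    have "fock_kernel \<alpha> u w = cnj (fock_kernel \<alpha> w u)"
      by (simp add: fock_kernel_def herm_commute[of w u] exp_cnj)
    then show ?thesis
      using complex_norm_square[of "fock_kernel \<alpha> w u"]
      by (simp add: norm_fock_kernel mult.commute)
  qed
  have e: "(exp (\<alpha> * (u \<bullet> w)))\<^sup>2 * exp (- (\<alpha> / 2) * (norm w)\<^sup>2) * exp (- \<alpha> * (norm u)\<^sup>2) =
      exp (\<alpha> / 2 * (norm w)\<^sup>2) * exp (- \<alpha> * (norm (u - w))\<^sup>2)" for u
  proof -
    have "2 * (\<alpha> * (u \<bullet> w)) + - (\<alpha> / 2) * (norm w)\<^sup>2 + - \<alpha> * (norm u)\<^sup>2 =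
        \<alpha> / 2 * (norm w)\<^sup>2 + - \<alpha> * (norm (u - w))\<^sup>2"
      unfolding norm_diff_sq by (simp add: algebra_simps)
    then show ?thesis
      by (metis exp_add exp_double)
  qed
  have eq: "fock_kernel \<alpha> u w * normalized_kernel \<alpha> w u * of_real (exp (- \<alpha> * (norm u)\<^sup>2)) =
      of_real (exp (\<alpha> / 2 * (norm w)\<^sup>2) * exp (- \<alpha> * (norm (u - w))\<^sup>2))" for u
    unfolding e[symmetric] normalized_kernel_def of_real_mult sq[symmetric] by (simp only: mult_ac)
  have int: "integrable \<mu> (\<lambda>u. exp (\<alpha> / 2 * (norm w)\<^sup>2) * exp (- \<alpha> * (norm (u - w))\<^sup>2))"
    using assms unfolding eq complex_of_real_integrable_eq .
  then have int': "integrable \<mu> (\<lambda>u. exp (- \<alpha> * (norm (u - w))\<^sup>2))"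
    by (subst (asm) integrable_mult_left_iff) auto
  have "toeplitz \<alpha> \<mu> (normalized_kernel \<alpha> w) w =
      of_real (exp (\<alpha> / 2 * (norm w)\<^sup>2) * (LINT u|\<mu>. exp (- \<alpha> * (norm (u - w))\<^sup>2)))"
    unfolding toeplitz_def eq integral_of_real by simp
  then have "fock_weight \<alpha> (toeplitz \<alpha> \<mu> (normalized_kernel \<alpha> w)) w =
     (exp (\<alpha> / 2 * (norm w)\<^sup>2) * exp (- (\<alpha> / 2) * (norm w)\<^sup>2)) * (LINT u|\<mu>. exp (- \<alpha> * (norm (u - w))\<^sup>2))"
    by (simp add: fock_weight_def norm_mult abs_mult del: of_real_mult of_real_exp)
  also have "\<dots> = (LINT u|\<mu>. exp (- \<alpha> * (norm (u - w))\<^sup>2))"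
    by (simp flip: exp_add)
  finally show ?thesis
    using int' by (simp add: nn_integral_eq_integral)
qed

lemma norm_exp_remainder_le:
  fixes s :: complex
  shows "norm (exp s - 1 - s) \<le> (norm s)\<^sup>2 * exp (norm s)"
  using Taylor_exp_field[of s 1] by (simp add: power2_eq_square diff_diff_eq mult.commute)

context
  fixes \<alpha> B M :: real and f :: "complex ^ 'n \<Rightarrow> complex" and \<mu> :: "(complex ^ 'n) measure"
  assumes \<alpha>: "0 < \<alpha>" and sets: "sets \<mu> = sets borel" and M: "unit_balls_le \<mu> M"
    and f: "f \<in> borel_measurable borel" and B: "\<And>w. fock_weight \<alpha> f w \<le> B"
begin

text \<open>
  An integrable function of \<open>w\<close> that dominates the Toeplitz integrand for all \<open>|z| \<le> R\<close>, even after
  multiplication by \<open>2 exp(2\<alpha>|w|)\<close>. That factor absorbs the derivative and the quadratic remainder in \<open>z\<close>; the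
  constant results from completing the square in \<open>(2\<alpha> + \<alpha>R)|w| - \<alpha>|w|\<^sup>2/2\<close> at the expense of half of the
  Gaussian decay.
\<close>

definition gaussian_majorant :: "real \<Rightarrow> complex ^ 'n \<Rightarrow> real" where
  "gaussian_majorant R w = 2 * B * exp ((2 * \<alpha> + \<alpha> * R)\<^sup>2 / \<alpha>) * exp (- (\<alpha> / 4) * (norm w)\<^sup>2)"

lemma bound_nonneg: "0 \<le> B"
  using B[of 0] fock_weight_nonneg order_trans by blast

lemma integrable_gaussian_majorant: "integrable \<mu> (gaussian_majorant R)"
proof -
  note sets[measurable_cong]
  have "integrable \<mu> (\<lambda>w. exp (- (\<alpha> / 4) * (norm w)\<^sup>2))"
    using nn_integral_gaussian_finite_unit_balls[of "\<alpha> / 4", OF _ sets M] \<alpha>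
    by (intro integrableI_nonneg) auto
  then show ?thesis
    unfolding gaussian_majorant_def by (rule integrable_mult_right)
qed

lemma norm_integrand_majorant:
  assumes "norm z \<le> R" "0 \<le> t" "t \<le> 2 * exp (2 * \<alpha> * norm w)"
  shows "t * norm (fock_kernel \<alpha> w z * f w * of_real (exp (- \<alpha> * (norm w)\<^sup>2))) \<le> gaussian_majorant R w"
proof -
  define x where "x = norm w"
  have "z \<bullet> w \<le> R * x"
    using Cauchy_Schwarz_ineq2[of z w] assms(1) mult_right_mono[of "norm z" R x] by (simp add: x_def)
  then have K: "norm (fock_kernel \<alpha> w z) \<le> exp (\<alpha> * R * x)"
    using \<alpha> by (simp add: norm_fock_kernel mult.assoc)
  have "norm (f w) * exp (- \<alpha> * x\<^sup>2) = fock_weight \<alpha> f w * exp (- (\<alpha> / 2) * x\<^sup>2)"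
    by (simp add: fock_weight_def x_def mult.assoc flip: exp_add)
  also have "\<dots> \<le> B * exp (- (\<alpha> / 2) * x\<^sup>2)"
    using B by (intro mult_right_mono) auto
  finally have g: "norm (f w) * exp (- \<alpha> * x\<^sup>2) \<le> B * exp (- (\<alpha> / 2) * x\<^sup>2)" .
  have "t * norm (fock_kernel \<alpha> w z * f w * of_real (exp (- \<alpha> * (norm w)\<^sup>2))) =
      t * (norm (fock_kernel \<alpha> w z) * (norm (f w) * exp (- \<alpha> * x\<^sup>2)))"
    by (simp add: norm_mult x_def mult.assoc)
  also have "\<dots> \<le> (2 * exp (2 * \<alpha> * x)) * (exp (\<alpha> * R * x) * (B * exp (- (\<alpha> / 2) * x\<^sup>2)))"
    using assms K g bound_nonneg by (intro mult_mono[OF _ mult_mono]) (auto simp: x_def)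
  also have "\<dots> = 2 * B * exp ((2 * \<alpha> + \<alpha> * R) * x - \<alpha> / 2 * x\<^sup>2)"
    by (simp add: exp_add[symmetric] algebra_simps)
  also have "\<dots> \<le> 2 * B * exp ((2 * \<alpha> + \<alpha> * R)\<^sup>2 / \<alpha> - \<alpha> / 4 * x\<^sup>2)"
  proof -
    define s where "s = 2 * \<alpha> + \<alpha> * R"
    have "0 \<le> (s - \<alpha> * x / 2)\<^sup>2 / \<alpha>" using \<alpha> by simp
    also have "\<dots> = s\<^sup>2 / \<alpha> - s * x + \<alpha> / 4 * x\<^sup>2"
      using \<alpha> by (simp add: power2_eq_square field_simps)
    finally have "s * x - \<alpha> / 2 * x\<^sup>2 \<le> s\<^sup>2 / \<alpha> - \<alpha> / 4 * x\<^sup>2" by (simp add: algebra_simps)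
    then show ?thesis
      using bound_nonneg by (intro mult_left_mono) (auto simp: s_def)
  qed
  also have "\<dots> = gaussian_majorant R w"
    by (simp add: gaussian_majorant_def x_def mult.assoc flip: exp_add)
  finally show ?thesis .
qed

lemma toeplitz_integrand_measurable:
  "(\<lambda>w. fock_kernel \<alpha> w z * f w * of_real (exp (- \<alpha> * (norm w)\<^sup>2))) \<in> borel_measurable \<mu>"
proof -
  note sets[measurable_cong] f[measurable]
  have "continuous_on UNIV (\<lambda>w. fock_kernel \<alpha> w z)"
    unfolding fock_kernel_def herm_def by (intro continuous_intros)
  then have [measurable]: "(\<lambda>w. fock_kernel \<alpha> w z) \<in> borel_measurable borel"
    by (rule borel_measurable_continuous_onI)
  show ?thesis by measurable
qed

lemma toeplitz_integrable:
  "integrable \<mu> (\<lambda>w. fock_kernel \<alpha> w z * f w * of_real (exp (- \<alpha> * (norm w)\<^sup>2)))"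
proof (rule Bochner_Integration.integrable_bound[OF integrable_gaussian_majorant[of "norm z"]])
  have le: "norm (fock_kernel \<alpha> w z * f w * of_real (exp (- \<alpha> * (norm w)\<^sup>2))) \<le> gaussian_majorant (norm z) w" for w
  proof -
    have "1 \<le> exp (2 * \<alpha> * norm w)" using \<alpha> by simp
    then have "1 \<le> 2 * exp (2 * \<alpha> * norm w)" by linarith
    then show ?thesis
      using norm_integrand_majorant[of z "norm z" 1 w] by simp
  qed
  show "AE w in \<mu>. norm (fock_kernel \<alpha> w z * f w * of_real (exp (- \<alpha> * (norm w)\<^sup>2)))
      \<le> norm (gaussian_majorant (norm z) w)"
    unfolding real_norm_def by (intro AE_I2 order_trans[OF le abs_ge_self])
qed (rule toeplitz_integrand_measurable)

text \<open>
  Differentiation under the integral, with the quadratic remainder of the exponential series in place of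
  a mean value argument: the difference between \<open>T f(z + v)\<close> and its linear approximation is at most
  \<open>|v|\<^sup>2\<close> times the integral of the majorant. Here \<open>f\<close> is only measurable, which allows \<open>f\<close> to be a pointwise
  limit of entire functions.
\<close>

lemma entire_toeplitz: "entire (toeplitz \<alpha> \<mu> f)"
  unfolding entire_def
proof
  fix z :: "complex ^ 'n"
  define R where "R = norm z"
  define k where "k z w = fock_kernel \<alpha> w z * f w * of_real (exp (- \<alpha> * (norm w)\<^sup>2))" for z w
  define L where "L v = (LINT w|\<mu>. of_real \<alpha> * herm v w * k z w)" for v
  define I where "I = (LINT w|\<mu>. gaussian_majorant R w)"
  note maj = integrable_gaussian_majorant[of R]
  have x_exp: "\<alpha> * x \<le> 2 * exp (2 * \<alpha> * x)" "(\<alpha> * x)\<^sup>2 * exp (\<alpha> * x) \<le> 2 * exp (2 * \<alpha> * x)" if "0 \<le> x" for x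
  proof -
    have 0: "0 \<le> \<alpha> * x" using \<alpha> that by simp
    have sq: "(\<alpha> * x)\<^sup>2 / 2 \<le> exp (\<alpha> * x)"
      using exp_lower_Taylor_quadratic[OF 0] 0 by simp
    have dbl: "exp (2 * \<alpha> * x) = exp (\<alpha> * x) * exp (\<alpha> * x)"
      by (simp flip: exp_add)
    show "(\<alpha> * x)\<^sup>2 * exp (\<alpha> * x) \<le> 2 * exp (2 * \<alpha> * x)"
      unfolding dbl using sq by (simp add: field_simps)
    have "\<alpha> * x \<le> exp (\<alpha> * x)" using exp_ge_add_one_self[of "\<alpha> * x"] by linarith
    also have "\<dots> \<le> exp (2 * \<alpha> * x)" using 0 by simp
    also have "\<dots> \<le> 2 * exp (2 * \<alpha> * x)" by simp
    finally show "\<alpha> * x \<le> 2 * exp (2 * \<alpha> * x)" .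
  qed
  have k_int: "integrable \<mu> (k z')" for z'
    unfolding k_def by (rule toeplitz_integrable)
  have herm_meas: "(\<lambda>w. of_real \<alpha> * herm v w * k z w) \<in> borel_measurable \<mu>" for v
  proof -
    note sets[measurable_cong]
    have "continuous_on UNIV (\<lambda>w. of_real \<alpha> * herm v w :: complex)"
      unfolding herm_def by (intro continuous_intros)
    then have [measurable]: "(\<lambda>w. of_real \<alpha> * herm v w :: complex) \<in> borel_measurable borel"
      by (rule borel_measurable_continuous_onI)
    have [measurable]: "k z \<in> borel_measurable \<mu>"
      unfolding k_def by (rule toeplitz_integrand_measurable)
    show ?thesis by measurable
  qed
  have herm_bound: "norm (of_real \<alpha> * herm v w * k z w) \<le> norm v * gaussian_majorant R w" for v w
  proof -
    have "norm (of_real \<alpha> * herm v w * k z w) \<le> (\<alpha> * (norm v * norm w)) * norm (k z w)"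
      unfolding norm_mult using \<alpha> norm_herm_le[of v w] by (intro mult_right_mono) auto
    also have "\<dots> = norm v * ((\<alpha> * norm w) * norm (k z w))" by simp
    also have "\<dots> \<le> norm v * gaussian_majorant R w"
      unfolding k_def using \<alpha> x_exp(1)[of "norm w"]
      by (intro mult_left_mono norm_integrand_majorant) (auto simp: R_def)
    finally show ?thesis .
  qed
  have herm_int: "integrable \<mu> (\<lambda>w. of_real \<alpha> * herm v w * k z w)" for v
    by (rule Bochner_Integration.integrable_bound[OF integrable_mult_right[OF maj, of "norm v"] herm_meas])
       (unfold real_norm_def, intro AE_I2 order_trans[OF herm_bound abs_ge_self])
  have "bounded_linear L"
  proof (rule bounded_linear_intro[where K = I])
    show "L (x + y) = L x + L y" for x y
      unfolding L_def using herm_int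
      by (subst Bochner_Integration.integral_add[symmetric]) (auto simp: herm_simps algebra_simps)
    show "L (r *\<^sub>R x) = r *\<^sub>R L x" for r x
    proof -
      have "herm (r *\<^sub>R x) w = r *\<^sub>R herm x w" for w
        by (simp add: herm_def scaleR_sum_right)
      then show ?thesis
        unfolding L_def by (subst integral_scaleR_right[symmetric]) (auto simp: mult_ac)
    qed
    show "norm (L x) \<le> norm x * I" for x
    proof -
      have "norm (L x) \<le> (LINT w|\<mu>. norm x * gaussian_majorant R w)"
        unfolding L_def
        by (rule Bochner_Integration.integral_norm_bound_integral[OF herm_int integrable_mult_right[OF maj] herm_bound])
      then show ?thesis by (simp add: I_def)
    qed
  qed
  have rem: "norm (toeplitz \<alpha> \<mu> f (z + v) - toeplitz \<alpha> \<mu> f z - L v) \<le> (norm v)\<^sup>2 * I" if "norm v \<le> 1" for v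
  proof -
    have "toeplitz \<alpha> \<mu> f (z + v) - toeplitz \<alpha> \<mu> f z - L v =
        (LINT w|\<mu>. k (z + v) w - k z w - of_real \<alpha> * herm v w * k z w)"
      unfolding toeplitz_def L_def k_def[symmetric] using k_int herm_int
      by (simp add: Bochner_Integration.integral_diff)
    also have "norm \<dots> \<le> (LINT w|\<mu>. (norm v)\<^sup>2 * gaussian_majorant R w)"
    proof (rule Bochner_Integration.integral_norm_bound_integral)
      show "integrable \<mu> (\<lambda>w. k (z + v) w - k z w - of_real \<alpha> * herm v w * k z w)"
        using k_int herm_int by (intro Bochner_Integration.integrable_diff)
      show "integrable \<mu> (\<lambda>w. (norm v)\<^sup>2 * gaussian_majorant R w)"
        by (rule integrable_mult_right[OF maj])
      fix w
      define s where "s = of_real \<alpha> * herm v w"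
      define x where "x = norm w"
      have s: "norm s \<le> norm v * (\<alpha> * x)"
        unfolding s_def norm_mult x_def using \<alpha> norm_herm_le[of v w] by (simp add: mult.left_commute)
      then have s': "norm s \<le> \<alpha> * x"
        using that \<alpha> by (elim order_trans) (simp add: x_def mult_left_le_one_le)
      have "k (z + v) w - k z w - of_real \<alpha> * herm v w * k z w = (exp s - 1 - s) * k z w"
        by (simp add: k_def fock_kernel_def herm_simps distrib_left exp_add s_def algebra_simps)
      then have "norm (k (z + v) w - k z w - of_real \<alpha> * herm v w * k z w) \<le> 
          ((norm s)\<^sup>2 * exp (norm s)) * norm (k z w)"
        by (simp add: norm_mult mult_right_mono norm_exp_remainder_le)
      also have "\<dots> \<le> ((norm v * (\<alpha> * x))\<^sup>2 * exp (\<alpha> * x)) * norm (k z w)"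
        using s s' by (intro mult_right_mono mult_mono power_mono) auto
      also have "\<dots> = (norm v)\<^sup>2 * (((\<alpha> * x)\<^sup>2 * exp (\<alpha> * x)) * norm (k z w))"
        by (simp add: power_mult_distrib)
      also have "\<dots> \<le> (norm v)\<^sup>2 * gaussian_majorant R w"
        unfolding k_def using x_exp(2)[of "norm w"]
        by (intro mult_left_mono norm_integrand_majorant) (auto simp: R_def x_def)
      finally show "norm (k (z + v) w - k z w - of_real \<alpha> * herm v w * k z w) \<le> (norm v)\<^sup>2 * gaussian_majorant R w" .
    qed
    finally show ?thesis by (simp add: I_def)
  qed
  have "((\<lambda>v. norm (toeplitz \<alpha> \<mu> f (z + v) - toeplitz \<alpha> \<mu> f z - L v) / norm v) \<longlongrightarrow> 0) (at 0)"
  proof (rule Lim_null_comparison)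
    show "((\<lambda>v::complex ^ 'n. norm v * I) \<longlongrightarrow> 0) (at 0)"
      by (auto intro!: tendsto_eq_intros)
    have "\<forall>\<^sub>F v::complex ^ 'n in at 0. norm v \<le> 1 \<and> v \<noteq> 0"
      unfolding eventually_at by (intro exI[of _ 1]) auto
    then show "\<forall>\<^sub>F v in at 0. norm (norm (toeplitz \<alpha> \<mu> f (z + v) - toeplitz \<alpha> \<mu> f z - L v) / norm v) \<le> norm v * I"
    proof eventually_elim
      case (elim v)
      then show ?case
        using rem[of v] by (simp add: field_simps power2_eq_square)
    qed
  qed
  then have "(toeplitz \<alpha> \<mu> f has_derivative L) (at z)"
    using \<open>bounded_linear L\<close> by (simp add: has_derivative_at)
  moreover have "L (c *s v) = c * L v" for c v
    unfolding L_def by (subst integral_mult_right_zero[symmetric]) (simp add: herm_simps mult_ac)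
  ultimately show "\<exists>f'. (toeplitz \<alpha> \<mu> f has_derivative f') (at z) \<and> (\<forall>c v. f' (c *s v) = c * f' v)"
    by blast
qed

end


section \<open>Boundedness and comparison of the norms\<close>

lemma nn_integral_fock_sigma:
  assumes sets: "sets \<mu> = sets borel" and f: "f \<in> borel_measurable borel"
  shows "(\<integral>\<^sup>+z. ennreal (norm (f z) powr q) \<partial>fock_sigma \<alpha> q \<mu>) =
    (\<integral>\<^sup>+z. ennreal (fock_weight \<alpha> f z powr q) \<partial>\<mu>)"
proof -
  note sets[measurable_cong] f[measurable]
  have "(\<integral>\<^sup>+z. ennreal (norm (f z) powr q) \<partial>fock_sigma \<alpha> q \<mu>) =
    (\<integral>\<^sup>+z. ennreal (exp (- (q * \<alpha> / 2) * (norm z)\<^sup>2)) * ennreal (norm (f z) powr q) \<partial>\<mu>)"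
    unfolding fock_sigma_def by (rule nn_integral_density) measurable
  also have "\<dots> = (\<integral>\<^sup>+z. ennreal (fock_weight \<alpha> f z powr q) \<partial>\<mu>)"
    unfolding fock_weight_powr[symmetric] by (simp add: mult.commute flip: ennreal_mult')
  finally show ?thesis .
qed

lemma measurable_fock_sigma:
  "sets \<mu> = sets borel \<Longrightarrow> borel_measurable (fock_sigma \<alpha> q \<mu>) = borel_measurable borel"
  by (rule measurable_cong_sets) (simp_all add: fock_sigma_def)

lemma Lq_space_fock_sigma_iff:
  assumes sets: "sets \<mu> = sets borel"
  shows "f \<in> Lq_space q (fock_sigma \<alpha> q \<mu>) \<longleftrightarrow>
    f \<in> borel_measurable borel \<and> (\<integral>\<^sup>+z. ennreal (fock_weight \<alpha> f z powr q) \<partial>\<mu>) < \<infinity>"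
proof (cases "f \<in> borel_measurable borel")
  case True
  then have "f \<in> borel_measurable (fock_sigma \<alpha> q \<mu>)"
    by (simp add: measurable_fock_sigma sets)
  then have [measurable]: "(\<lambda>z. norm (f z) powr q) \<in> borel_measurable (fock_sigma \<alpha> q \<mu>)"
    by measurable
  show ?thesis
    using True unfolding Lq_space_def
    by (auto simp: measurable_fock_sigma[OF sets] integrable_iff_bounded
        nn_integral_fock_sigma[OF sets True])
qed (simp add: Lq_space_def measurable_fock_sigma[OF sets])

lemma Lq_norm_fock_sigma:
  assumes sets: "sets \<mu> = sets borel" and f: "f \<in> borel_measurable borel"
  shows "Lq_norm q (fock_sigma \<alpha> q \<mu>) f =
    enn2real (\<integral>\<^sup>+z. ennreal (fock_weight \<alpha> f z powr q) \<partial>\<mu>) powr (1 / q)"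
proof -
  have "f \<in> borel_measurable (fock_sigma \<alpha> q \<mu>)"
    using f by (simp add: measurable_fock_sigma sets)
  then have [measurable]: "(\<lambda>z. norm (f z) powr q) \<in> borel_measurable (fock_sigma \<alpha> q \<mu>)"
    by measurable
  show ?thesis
    by (simp add: Lq_norm_def integral_eq_nn_integral nn_integral_fock_sigma[OF sets f])
qed

lemma unit_balls_le_of_embedding:
  fixes \<alpha> q :: real
  assumes "0 < \<alpha>" "1 \<le> q"
  obtains E where "0 < E" "\<And>(\<mu> :: (complex ^ 'n) measure) C. sets \<mu> = sets borel \<Longrightarrow> 0 \<le> C \<Longrightarrow>
    (\<And>f. f \<in> fock_space \<alpha> 1 \<Longrightarrow>
      (\<integral>\<^sup>+u. ennreal (fock_weight \<alpha> f u powr q) \<partial>\<mu>) \<le> ennreal (C * fock_norm \<alpha> 1 f powr q)) \<Longrightarrow>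
    unit_balls_le \<mu> (E * C)"
proof -
  obtain C1 where C1: "0 < C1" "\<And>w :: complex ^ 'n. normalized_kernel \<alpha> w \<in> fock_space \<alpha> (ennreal 1)"
    "\<And>w :: complex ^ 'n. fock_norm \<alpha> (ennreal 1) (normalized_kernel \<alpha> w) \<le> C1"
    using normalized_kernel_fock[OF assms(1), of 1, where 'n = 'n] by auto
  define E where "E = exp (\<alpha> * q / 2) * C1 powr q"
  have "0 < E" using C1(1) by (simp add: E_def)
  have "unit_balls_le \<mu> (E * C)" if sets: "sets \<mu> = sets borel" and "0 \<le> C"
    and *: "\<And>f. f \<in> fock_space \<alpha> 1 \<Longrightarrow>
      (\<integral>\<^sup>+u. ennreal (fock_weight \<alpha> f u powr q) \<partial>\<mu>) \<le> ennreal (C * fock_norm \<alpha> 1 f powr q)"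
    for \<mu> :: "(complex ^ 'n) measure" and C
    unfolding unit_balls_le_def
  proof (intro conjI allI)
    show "0 \<le> E * C" using \<open>0 < E\<close> \<open>0 \<le> C\<close> by simp
    fix w :: "complex ^ 'n"
    let ?k = "normalized_kernel \<alpha> w"
    have "(\<integral>\<^sup>+u. ennreal (exp (- (\<alpha> * q / 2) * (norm (u - w))\<^sup>2)) \<partial>\<mu>) \<le> ennreal (C * fock_norm \<alpha> 1 ?k powr q)"
      using *[of ?k] C1(2)[of w] by (simp only: fock_weight_normalized_kernel_powr ennreal_1)
    also have "\<dots> \<le> ennreal (C * C1 powr q)"
      using C1(3)[of w] \<open>0 \<le> C\<close> assms fock_norm_nonneg[of 1 \<alpha> ?k]
      by (intro ennreal_leI mult_left_mono powr_mono2) auto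
    finally have int: "(\<integral>\<^sup>+u. ennreal (exp (- (\<alpha> * q / 2) * (norm (u - w))\<^sup>2)) \<partial>\<mu>) \<le> ennreal (C * C1 powr q)" .
    have "emeasure \<mu> (ball w 1) \<le>
        ennreal (exp (\<alpha> * q / 2)) * (\<integral>\<^sup>+u. ennreal (exp (- (\<alpha> * q / 2) * (norm (u - w))\<^sup>2)) \<partial>\<mu>)"
      using assms by (intro emeasure_unit_ball_le_gaussian sets) simp
    also have "\<dots> \<le> ennreal (exp (\<alpha> * q / 2)) * ennreal (C * C1 powr q)"
      by (rule mult_left_mono[OF int]) simp
    also have "\<dots> = ennreal (E * C)"
      unfolding ennreal_mult'[OF exp_ge_zero, symmetric] by (simp add: E_def mult_ac)
    finally show "emeasure \<mu> (ball w 1) \<le> ennreal (E * C)" .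
  qed
  with \<open>0 < E\<close> show thesis by (rule that)
qed

lemma fock_carleson_iff_unit_balls_le:
  fixes \<mu> :: "(complex ^ 'n) measure"
  assumes "0 < \<alpha>" "1 \<le> q" and sets: "sets \<mu> = sets borel"
  shows "fock_carleson \<alpha> 1 q \<mu> \<longleftrightarrow> (\<exists>M. unit_balls_le \<mu> M)"
proof
  assume "fock_carleson \<alpha> 1 q \<mu>"
  then obtain C where C: "\<And>f. f \<in> fock_space \<alpha> 1 \<Longrightarrow>
      (\<integral>\<^sup>+u. ennreal (fock_weight \<alpha> f u powr q) \<partial>\<mu>) \<le> ennreal (C * fock_norm \<alpha> 1 f powr q)"
    unfolding fock_carleson_def fock_weight_powr by blast
  have "(\<integral>\<^sup>+u. ennreal (fock_weight \<alpha> f u powr q) \<partial>\<mu>) \<le> ennreal (max C 0 * fock_norm \<alpha> 1 f powr q)"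
    if "f \<in> fock_space \<alpha> 1" for f
    by (rule order_trans[OF C[OF that]]) (intro ennreal_leI mult_right_mono, auto)
  then show "\<exists>M. unit_balls_le \<mu> M"
    using unit_balls_le_of_embedding[OF assms(1,2), where 'n = 'n] sets max.cobounded2[of 0 C] by metis
next
  assume "\<exists>M. unit_balls_le \<mu> M"
  then obtain M where M: "unit_balls_le \<mu> M" ..
  obtain C where C: "0 < C" "\<And>(f :: complex ^ 'n \<Rightarrow> complex) \<mu> M.
    f \<in> fock_space \<alpha> 1 \<Longrightarrow> sets \<mu> = sets borel \<Longrightarrow> unit_balls_le \<mu> M \<Longrightarrow>
    (\<integral>\<^sup>+u. ennreal (fock_weight \<alpha> f u powr q) \<partial>\<mu>) \<le> ennreal (C * M * fock_norm \<alpha> 1 f powr q)"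
    using nn_integral_fock_weight_powr_le[OF assms(1,2), where 'n = 'n] by blast
  show "fock_carleson \<alpha> 1 q \<mu>"
    unfolding fock_carleson_def fock_weight_powr using C(2)[OF _ sets M] by blast
qed

text \<open>
  For exponent one the operator bound of the embedding is literally the Carleson inequality, once
  membership in \<open>L\<^sup>1\<close> is read as finiteness of the integral.
\<close>

lemma embedding_op_bound_iff:
  fixes \<mu> :: "(complex ^ 'n) measure"
  assumes sets: "sets \<mu> = sets borel" and "0 \<le> C"
  shows "op_bound (fock_space \<alpha> 1) (fock_norm \<alpha> 1) (Lq_space 1 (fock_sigma \<alpha> 1 \<mu>))
      (Lq_norm 1 (fock_sigma \<alpha> 1 \<mu>)) (\<lambda>f. f) C \<longleftrightarrow>
    (\<forall>f\<in>fock_space \<alpha> 1.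
      (\<integral>\<^sup>+u. ennreal (fock_weight \<alpha> f u powr 1) \<partial>\<mu>) \<le> ennreal (C * fock_norm \<alpha> 1 f powr 1))"
  unfolding op_bound_def
proof (rule ball_cong[OF refl])
  fix f :: "complex ^ 'n \<Rightarrow> complex" assume f: "f \<in> fock_space \<alpha> 1"
  then have "entire f" using fock_space_iff[of 1 f \<alpha>] by simp
  then have [measurable]: "f \<in> borel_measurable borel" by (rule entire_measurable)
  have N: "0 \<le> fock_norm \<alpha> 1 f" using fock_norm_nonneg[of 1 \<alpha> f] by simp
  define I where "I = (\<integral>\<^sup>+u. ennreal (fock_weight \<alpha> f u powr 1) \<partial>\<mu>)"
  have "I < \<infinity> \<and> enn2real I \<le> C * fock_norm \<alpha> 1 f \<longleftrightarrow> I \<le> ennreal (C * fock_norm \<alpha> 1 f)"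
    using N \<open>0 \<le> C\<close>
    by (cases I) (auto simp: top_unique)
  then show "(f \<in> Lq_space 1 (fock_sigma \<alpha> 1 \<mu>) \<and> Lq_norm 1 (fock_sigma \<alpha> 1 \<mu>) f \<le> C * fock_norm \<alpha> 1 f) =
      (I \<le> ennreal (C * fock_norm \<alpha> 1 f powr 1))"
    using N by (simp add: Lq_space_fock_sigma_iff[OF sets] Lq_norm_fock_sigma[OF sets] I_def)
qed

lemma fock_weight_le_fock_norm_infinity:
  "f \<in> fock_space \<alpha> \<infinity> \<Longrightarrow> fock_weight \<alpha> f z \<le> fock_norm \<alpha> \<infinity> f"
  unfolding fock_space_infinity_iff fock_norm_infinity by (intro cSUP_upper) auto

lemma unit_balls_le_of_toeplitz:
  fixes \<alpha> p :: real
  assumes "0 < \<alpha>" "1 \<le> p"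
  obtains E where "0 < E" "\<And>(\<mu> :: (complex ^ 'n) measure) C. sets \<mu> = sets borel \<Longrightarrow> 0 \<le> C \<Longrightarrow>
    toeplitz_defined_on \<alpha> \<mu> (fock_space \<alpha> (ennreal p)) \<Longrightarrow>
    op_bound (fock_space \<alpha> (ennreal p)) (fock_norm \<alpha> (ennreal p)) (fock_space \<alpha> \<infinity>) (fock_norm \<alpha> \<infinity>)
      (toeplitz \<alpha> \<mu>) C \<Longrightarrow>
    unit_balls_le \<mu> (E * C)"
proof -
  obtain C1 where C1: "0 < C1" "\<And>w :: complex ^ 'n. normalized_kernel \<alpha> w \<in> fock_space \<alpha> (ennreal p)"
    "\<And>w :: complex ^ 'n. fock_norm \<alpha> (ennreal p) (normalized_kernel \<alpha> w) \<le> C1"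
    using normalized_kernel_fock[OF assms, where 'n = 'n] by blast
  have "unit_balls_le \<mu> (exp \<alpha> * C1 * C)" if sets: "sets \<mu> = sets borel" and "0 \<le> C"
    and def: "toeplitz_defined_on \<alpha> \<mu> (fock_space \<alpha> (ennreal p))"
    and bd: "op_bound (fock_space \<alpha> (ennreal p)) (fock_norm \<alpha> (ennreal p)) (fock_space \<alpha> \<infinity>)
      (fock_norm \<alpha> \<infinity>) (toeplitz \<alpha> \<mu>) C"
    for \<mu> :: "(complex ^ 'n) measure" and C
    unfolding unit_balls_le_def
  proof (intro conjI allI)
    show "0 \<le> exp \<alpha> * C1 * C" using C1(1) \<open>0 \<le> C\<close> by simp
    fix w :: "complex ^ 'n"
    let ?k = "normalized_kernel \<alpha> w"
    have "emeasure \<mu> (ball w 1) \<le> ennreal (exp \<alpha>) * (\<integral>\<^sup>+u. ennreal (exp (- \<alpha> * (norm (u - w))\<^sup>2)) \<partial>\<mu>)"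
      using assms by (intro emeasure_unit_ball_le_gaussian sets) simp
    also have "(\<integral>\<^sup>+u. ennreal (exp (- \<alpha> * (norm (u - w))\<^sup>2)) \<partial>\<mu>) =
        ennreal (fock_weight \<alpha> (toeplitz \<alpha> \<mu> ?k) w)"
      using def C1(2)[of w] unfolding toeplitz_defined_on_def
      by (intro toeplitz_normalized_kernel_diagonal) blast
    also have "ennreal (exp \<alpha>) * ennreal (fock_weight \<alpha> (toeplitz \<alpha> \<mu> ?k) w) \<le> ennreal (exp \<alpha>) * ennreal (C * C1)"
    proof (intro mult_left_mono ennreal_leI)
      have "fock_weight \<alpha> (toeplitz \<alpha> \<mu> ?k) w \<le> fock_norm \<alpha> \<infinity> (toeplitz \<alpha> \<mu> ?k)"
        using bd C1(2)[of w] unfolding op_bound_def by (intro fock_weight_le_fock_norm_infinity) blast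
      also have "\<dots> \<le> C * fock_norm \<alpha> (ennreal p) ?k"
        using bd C1(2)[of w] unfolding op_bound_def by blast
      also have "\<dots> \<le> C * C1"
        using C1(3)[of w] \<open>0 \<le> C\<close> by (rule mult_left_mono)
      finally show "fock_weight \<alpha> (toeplitz \<alpha> \<mu> ?k) w \<le> C * C1" .
    qed simp
    also have "\<dots> = ennreal (exp \<alpha> * C1 * C)"
      unfolding ennreal_mult'[OF exp_ge_zero, symmetric] by (simp add: mult_ac)
    finally show "emeasure \<mu> (ball w 1) \<le> ennreal (exp \<alpha> * C1 * C)" .
  qed
  with C1(1) show thesis by (intro that[of "exp \<alpha> * C1"]) auto
qed

lemma toeplitz_in_fock_space_infinity:
  fixes \<mu> :: "(complex ^ 'n) measure"
  assumes \<alpha>: "0 < \<alpha>" and sets: "sets \<mu> = sets borel" and M: "unit_balls_le \<mu> M"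
    and meas: "f \<in> borel_measurable borel" and B: "\<And>w. fock_weight \<alpha> f w \<le> B" and "0 \<le> L"
    and L: "\<And>z. (\<integral>\<^sup>+w. ennreal (exp (- (\<alpha> / 2) * (norm (w - z))\<^sup>2)) \<partial>\<mu>) \<le> ennreal L"
  shows "toeplitz \<alpha> \<mu> f \<in> fock_space \<alpha> \<infinity> \<and> fock_norm \<alpha> \<infinity> (toeplitz \<alpha> \<mu> f) \<le> B * L"
proof -
  have "0 \<le> B" using B[of 0] fock_weight_nonneg order_trans by blast
  have le: "fock_weight \<alpha> (toeplitz \<alpha> \<mu> f) z \<le> B * L" for z
    using order_trans[OF fock_weight_toeplitz_le nn_integral_gaussian_fock_weight_le[OF sets B L]]
      \<open>0 \<le> B\<close> \<open>0 \<le> L\<close> by simp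
  have "toeplitz \<alpha> \<mu> f \<in> fock_space \<alpha> \<infinity>"
    unfolding fock_space_infinity_iff
    using entire_toeplitz[OF \<alpha> sets M meas B] bdd_aboveI2[of UNIV, OF le] by simp
  moreover have "fock_norm \<alpha> \<infinity> (toeplitz \<alpha> \<mu> f) \<le> B * L"
    unfolding fock_norm_infinity by (intro cSUP_least le) auto
  ultimately show ?thesis ..
qed

lemma toeplitz_bounded_of_unit_balls_le:
  fixes \<alpha> p :: real
  assumes "0 < \<alpha>" "1 \<le> p"
  obtains E where "0 < E" "\<And>(\<mu> :: (complex ^ 'n) measure) M. sets \<mu> = sets borel \<Longrightarrow> unit_balls_le \<mu> M \<Longrightarrow>
    toeplitz_defined_on \<alpha> \<mu> (fock_space \<alpha> (ennreal p)) \<and>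
    op_bound (fock_space \<alpha> (ennreal p)) (fock_norm \<alpha> (ennreal p)) (fock_space \<alpha> \<infinity>) (fock_norm \<alpha> \<infinity>)
      (toeplitz \<alpha> \<mu>) (E * M)"
proof -
  have p: "0 < p" using assms by simp
  obtain C1 where C1: "0 < C1" "\<And>(f :: complex ^ 'n \<Rightarrow> complex) w. f \<in> fock_space \<alpha> (ennreal p) \<Longrightarrow>
    fock_weight \<alpha> f w \<le> C1 * fock_norm \<alpha> (ennreal p) f"
    using fock_weight_le_fock_norm[OF assms, where 'n = 'n] by blast
  obtain C2 where C2: "0 < C2" "\<And>(z :: complex ^ 'n) \<mu> M. sets \<mu> = sets borel \<Longrightarrow> unit_balls_le \<mu> M \<Longrightarrow>
    (\<integral>\<^sup>+u. ennreal (exp (- (\<alpha> / 2) * (norm (u - z))\<^sup>2)) \<partial>\<mu>) \<le> ennreal (C2 * M)"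
    using nn_integral_shifted_gaussian_le[OF assms(1), where 'n = 'n] by blast
  have "toeplitz_defined_on \<alpha> \<mu> (fock_space \<alpha> (ennreal p)) \<and>
    op_bound (fock_space \<alpha> (ennreal p)) (fock_norm \<alpha> (ennreal p)) (fock_space \<alpha> \<infinity>) (fock_norm \<alpha> \<infinity>)
      (toeplitz \<alpha> \<mu>) (C1 * C2 * M)"
    if sets: "sets \<mu> = sets borel" and M: "unit_balls_le \<mu> M" for \<mu> :: "(complex ^ 'n) measure" and M
  proof -
    note sets[measurable_cong]
    have *: "toeplitz \<alpha> \<mu> f \<in> fock_space \<alpha> \<infinity> \<and>
        fock_norm \<alpha> \<infinity> (toeplitz \<alpha> \<mu> f) \<le> C1 * C2 * M * fock_norm \<alpha> (ennreal p) f \<and>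
        (\<forall>z. integrable \<mu> (\<lambda>w. fock_kernel \<alpha> w z * f w * of_real (exp (- \<alpha> * (norm w)\<^sup>2))))"
      if f: "f \<in> fock_space \<alpha> (ennreal p)" for f
    proof -
      define B where "B = C1 * fock_norm \<alpha> (ennreal p) f"
      have "entire f" using f p by (simp add: fock_space_iff)
      then have meas: "f \<in> borel_measurable borel" by (rule entire_measurable)
      have B: "fock_weight \<alpha> f w \<le> B" for w using C1(2)[OF f] by (simp add: B_def)
      have "toeplitz \<alpha> \<mu> f \<in> fock_space \<alpha> \<infinity> \<and> fock_norm \<alpha> \<infinity> (toeplitz \<alpha> \<mu> f) \<le> B * (C2 * M)"
        using C2(1) M
        by (intro toeplitz_in_fock_space_infinity[OF assms(1) sets M meas B _ C2(2)[OF sets M]])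
           (simp add: unit_balls_le_def)
      then show ?thesis
        using toeplitz_integrable[OF assms(1) sets M meas B] by (simp add: B_def mult_ac)
    qed
    then show ?thesis
      unfolding toeplitz_defined_on_def op_bound_def by blast
  qed
  with C1(1) C2(1) show thesis by (intro that[of "C1 * C2"]) auto
qed

lemma toeplitz_bounded_iff_unit_balls_le:
  fixes \<mu> :: "(complex ^ 'n) measure"
  assumes "0 < \<alpha>" "1 \<le> p" and sets: "sets \<mu> = sets borel"
  shows "toeplitz_bounded \<alpha> (ennreal p) \<infinity> \<mu> \<longleftrightarrow> (\<exists>M. unit_balls_le \<mu> M)"
proof
  assume bd: "toeplitz_bounded \<alpha> (ennreal p) \<infinity> \<mu>"
  then obtain C where C: "op_bound (fock_space \<alpha> (ennreal p)) (fock_norm \<alpha> (ennreal p)) (fock_space \<alpha> \<infinity>)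
      (fock_norm \<alpha> \<infinity>) (toeplitz \<alpha> \<mu>) C" and def: "toeplitz_defined_on \<alpha> \<mu> (fock_space \<alpha> (ennreal p))"
    unfolding toeplitz_bounded_def by blast
  have "C * fock_norm \<alpha> (ennreal p) f \<le> max C 0 * fock_norm \<alpha> (ennreal p) f" for f :: "complex ^ 'n \<Rightarrow> complex"
    using assms by (intro mult_right_mono fock_norm_nonneg) auto
  then have "op_bound (fock_space \<alpha> (ennreal p)) (fock_norm \<alpha> (ennreal p)) (fock_space \<alpha> \<infinity>)
      (fock_norm \<alpha> \<infinity>) (toeplitz \<alpha> \<mu>) (max C 0)"
    using C unfolding op_bound_def by (meson order_trans)
  with def show "\<exists>M. unit_balls_le \<mu> M"
    using unit_balls_le_of_toeplitz[OF assms(1,2), where 'n = 'n] sets max.cobounded2[of 0 C] by metis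
next
  assume "\<exists>M. unit_balls_le \<mu> M"
  then show "toeplitz_bounded \<alpha> (ennreal p) \<infinity> \<mu>"
    unfolding toeplitz_bounded_def
    using toeplitz_bounded_of_unit_balls_le[OF assms(1,2), where 'n = 'n] sets by metis
qed

text \<open>
  The factor stands on the left as \<open>1/K\<close> so that a finite multiple of an infimum over a possibly empty
  set of bounds never has to be evaluated.
\<close>

lemma op_norm_le_cmult_op_norm:
  assumes "0 < K" and "\<And>C. 0 \<le> C \<Longrightarrow> op_bound X NX Y NY T C \<Longrightarrow> op_bound X' NX' Y' NY' T' (K * C)"
  shows "ennreal (1 / K) * op_norm X' NX' Y' NY' T' \<le> op_norm X NX Y NY T"
  unfolding op_norm_def[of X]
proof (rule Inf_greatest, elim imageE, clarify)
  fix C assume C: "0 \<le> C" "op_bound X NX Y NY T C"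
  then have "op_norm X' NX' Y' NY' T' \<le> ennreal (K * C)"
    using assms unfolding op_norm_def by (intro Inf_lower) auto
  then have "ennreal (1 / K) * op_norm X' NX' Y' NY' T' \<le> ennreal (1 / K) * ennreal (K * C)"
    by (rule mult_left_mono) simp
  also have "\<dots> = ennreal C"
    using assms(1) by (simp flip: ennreal_mult')
  finally show "ennreal (1 / K) * op_norm X' NX' Y' NY' T' \<le> ennreal C" .
qed

lemma embedding_norm_le_toeplitz_norm:
  assumes "0 < \<alpha>" "1 \<le> p"
  obtains K where "0 < K" "\<And>\<mu> :: (complex ^ 'n) measure. sets \<mu> = sets borel \<Longrightarrow>
    toeplitz_defined_on \<alpha> \<mu> (fock_space \<alpha> (ennreal p)) \<Longrightarrow>
    ennreal (1 / K) * embedding_norm \<alpha> 1 1 \<mu> \<le> toeplitz_norm \<alpha> (ennreal p) \<infinity> \<mu>"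
proof -
  obtain E where E: "0 < E" "\<And>(\<mu> :: (complex ^ 'n) measure) C. sets \<mu> = sets borel \<Longrightarrow> 0 \<le> C \<Longrightarrow>
    toeplitz_defined_on \<alpha> \<mu> (fock_space \<alpha> (ennreal p)) \<Longrightarrow>
    op_bound (fock_space \<alpha> (ennreal p)) (fock_norm \<alpha> (ennreal p)) (fock_space \<alpha> \<infinity>) (fock_norm \<alpha> \<infinity>)
      (toeplitz \<alpha> \<mu>) C \<Longrightarrow>
    unit_balls_le \<mu> (E * C)"
    using unit_balls_le_of_toeplitz[OF assms, where 'n = 'n] by blast
  obtain C1 where C1: "0 < C1" "\<And>(f :: complex ^ 'n \<Rightarrow> complex) \<mu> M.
    f \<in> fock_space \<alpha> 1 \<Longrightarrow> sets \<mu> = sets borel \<Longrightarrow> unit_balls_le \<mu> M \<Longrightarrow>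
    (\<integral>\<^sup>+u. ennreal (fock_weight \<alpha> f u powr 1) \<partial>\<mu>) \<le> ennreal (C1 * M * fock_norm \<alpha> 1 f powr 1)"
    using nn_integral_fock_weight_powr_le[OF assms(1), of 1, where 'n = 'n] by blast
  have "ennreal (1 / (C1 * E)) * embedding_norm \<alpha> 1 1 \<mu> \<le> toeplitz_norm \<alpha> (ennreal p) \<infinity> \<mu>"
    if sets: "sets \<mu> = sets borel" and def: "toeplitz_defined_on \<alpha> \<mu> (fock_space \<alpha> (ennreal p))"
    for \<mu> :: "(complex ^ 'n) measure"
    unfolding embedding_norm_def toeplitz_norm_def
  proof (rule op_norm_le_cmult_op_norm)
    show "0 < C1 * E" using C1 E by simp
    fix C assume C: "0 \<le> C" "op_bound (fock_space \<alpha> (ennreal p)) (fock_norm \<alpha> (ennreal p)) (fock_space \<alpha> \<infinity>)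
      (fock_norm \<alpha> \<infinity>) (toeplitz \<alpha> \<mu>) C"
    have M: "unit_balls_le \<mu> (E * C)" by (rule E(2)[OF sets C(1) def C(2)])
    show "op_bound (fock_space \<alpha> 1) (fock_norm \<alpha> 1) (Lq_space 1 (fock_sigma \<alpha> 1 \<mu>))
      (Lq_norm 1 (fock_sigma \<alpha> 1 \<mu>)) (\<lambda>f. f) (C1 * E * C)"
      using C(1) C1(1) E(1) C1(2)[OF _ sets M]
      by (subst embedding_op_bound_iff[OF sets]) (auto simp: mult.assoc)
  qed
  with C1 E show thesis by (intro that[of "C1 * E"]) auto
qed

lemma toeplitz_norm_le_embedding_norm:
  assumes "0 < \<alpha>" "1 \<le> p"
  obtains K where "0 < K" "\<And>\<mu> :: (complex ^ 'n) measure. sets \<mu> = sets borel \<Longrightarrow>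
    ennreal (1 / K) * toeplitz_norm \<alpha> (ennreal p) \<infinity> \<mu> \<le> embedding_norm \<alpha> 1 1 \<mu>"
proof -
  obtain E where E: "0 < E" "\<And>(\<mu> :: (complex ^ 'n) measure) C. sets \<mu> = sets borel \<Longrightarrow> 0 \<le> C \<Longrightarrow>
    (\<And>f. f \<in> fock_space \<alpha> 1 \<Longrightarrow>
      (\<integral>\<^sup>+u. ennreal (fock_weight \<alpha> f u powr 1) \<partial>\<mu>) \<le> ennreal (C * fock_norm \<alpha> 1 f powr 1)) \<Longrightarrow>
    unit_balls_le \<mu> (E * C)"
    using unit_balls_le_of_embedding[OF assms(1), of 1, where 'n = 'n] by (metis order_refl)
  obtain D where D: "0 < D" "\<And>(\<mu> :: (complex ^ 'n) measure) M. sets \<mu> = sets borel \<Longrightarrow> unit_balls_le \<mu> M \<Longrightarrow>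
    toeplitz_defined_on \<alpha> \<mu> (fock_space \<alpha> (ennreal p)) \<and>
    op_bound (fock_space \<alpha> (ennreal p)) (fock_norm \<alpha> (ennreal p)) (fock_space \<alpha> \<infinity>) (fock_norm \<alpha> \<infinity>)
      (toeplitz \<alpha> \<mu>) (D * M)"
    using toeplitz_bounded_of_unit_balls_le[OF assms, where 'n = 'n] by blast
  have "ennreal (1 / (D * E)) * toeplitz_norm \<alpha> (ennreal p) \<infinity> \<mu> \<le> embedding_norm \<alpha> 1 1 \<mu>"
    if sets: "sets \<mu> = sets borel" for \<mu> :: "(complex ^ 'n) measure"
    unfolding embedding_norm_def toeplitz_norm_def
  proof (rule op_norm_le_cmult_op_norm)
    show "0 < D * E" using D E by simp
    fix C assume C: "0 \<le> C" "op_bound (fock_space \<alpha> 1) (fock_norm \<alpha> 1) (Lq_space 1 (fock_sigma \<alpha> 1 \<mu>))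
      (Lq_norm 1 (fock_sigma \<alpha> 1 \<mu>)) (\<lambda>f. f) C"
    have "unit_balls_le \<mu> (E * C)"
      using C(2) unfolding embedding_op_bound_iff[OF sets C(1)] by (intro E(2) sets C(1)) blast
    from D(2)[OF sets this]
    show "op_bound (fock_space \<alpha> (ennreal p)) (fock_norm \<alpha> (ennreal p)) (fock_space \<alpha> \<infinity>)
      (fock_norm \<alpha> \<infinity>) (toeplitz \<alpha> \<mu>) (D * E * C)"
      by (simp add: mult.assoc)
  qed
  with D E show thesis by (intro that[of "D * E"]) auto
qed

lemma ennreal_inverse_mult_le:
  assumes "0 < K" "ennreal (1 / K) * a \<le> b"
  shows "a \<le> ennreal K * b"
proof -
  have "a = ennreal K * (ennreal (1 / K) * a)"
    using assms(1) by (simp add: mult.assoc[symmetric] flip: ennreal_mult')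
  also have "\<dots> \<le> ennreal K * b"
    by (rule mult_left_mono[OF assms(2)]) simp
  finally show ?thesis .
qed

lemma toeplitz_norm_equivalent_embedding_norm:
  assumes "0 < \<alpha>" "1 \<le> p"
  obtains C :: real where "0 < C" "\<And>\<mu> :: (complex ^ 'n) measure. sets \<mu> = sets borel \<Longrightarrow>
    toeplitz_defined_on \<alpha> \<mu> (fock_space \<alpha> (ennreal p)) \<Longrightarrow>
    ennreal (1 / C) * embedding_norm \<alpha> 1 1 \<mu> \<le> toeplitz_norm \<alpha> (ennreal p) \<infinity> \<mu> \<and>
    toeplitz_norm \<alpha> (ennreal p) \<infinity> \<mu> \<le> ennreal C * embedding_norm \<alpha> 1 1 \<mu>"
proof -
  obtain K where K: "0 < K" "\<And>\<mu> :: (complex ^ 'n) measure. sets \<mu> = sets borel \<Longrightarrow>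
    toeplitz_defined_on \<alpha> \<mu> (fock_space \<alpha> (ennreal p)) \<Longrightarrow>
    ennreal (1 / K) * embedding_norm \<alpha> 1 1 \<mu> \<le> toeplitz_norm \<alpha> (ennreal p) \<infinity> \<mu>"
    using embedding_norm_le_toeplitz_norm[OF assms, where 'n = 'n] by blast
  obtain L where L: "0 < L" "\<And>\<mu> :: (complex ^ 'n) measure. sets \<mu> = sets borel \<Longrightarrow>
    ennreal (1 / L) * toeplitz_norm \<alpha> (ennreal p) \<infinity> \<mu> \<le> embedding_norm \<alpha> 1 1 \<mu>"
    using toeplitz_norm_le_embedding_norm[OF assms, where 'n = 'n] by blast
  show thesis
  proof (rule that[of "max K L"], goal_cases)
    case 1
    show ?case using K by simp
  next
    case (2 \<mu>)
    have "ennreal (1 / max K L) \<le> ennreal (1 / K)"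
      using K(1) by (intro ennreal_leI) (simp add: frac_le)
    then have 1: "ennreal (1 / max K L) * embedding_norm \<alpha> 1 1 \<mu> \<le> ennreal (1 / K) * embedding_norm \<alpha> 1 1 \<mu>"
      by (rule mult_right_mono) simp
    have "toeplitz_norm \<alpha> (ennreal p) \<infinity> \<mu> \<le> ennreal L * embedding_norm \<alpha> 1 1 \<mu>"
      by (rule ennreal_inverse_mult_le[OF L(1) L(2)[OF 2(1)]])
    also have "\<dots> \<le> ennreal (max K L) * embedding_norm \<alpha> 1 1 \<mu>"
      by (intro mult_right_mono ennreal_leI) auto
    finally show ?case using order_trans[OF 1 K(2)[OF 2]] by blast
  qed
qed

section \<open>Pointwise convergent subsequences\<close>

text \<open>
  Schwarz's lemma on the unit disc of the complex line through \<open>z\<close> and \<open>w\<close>. The Lipschitz constant depends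
  on \<open>f\<close> only through the bound \<open>B\<close>, so a family with a common bound is equicontinuous at \<open>z\<close>. The added
  \<open>1\<close> makes the bound strict, as Schwarz's lemma requires, and positive.
\<close>

lemma entire_lipschitz_of_fock_weight:
  fixes f :: "complex ^ 'n \<Rightarrow> complex"
  assumes "0 \<le> \<alpha>" and f: "entire f" and B: "\<And>w. fock_weight \<alpha> f w \<le> B" and "norm (w - z) < 1"
  shows "norm (f w - f z) \<le> (2 * (B * exp (\<alpha> / 2 * (norm z + 1)\<^sup>2)) + 1) * norm (w - z)"
proof -
  define B' where "B' = B * exp (\<alpha> / 2 * (norm z + 1)\<^sup>2)"
  have "0 \<le> B" using B[of 0] fock_weight_nonneg order_trans by blast
  then have "0 \<le> B'" by (simp add: B'_def)
  have bound: "norm (f u) \<le> B'" if "norm u \<le> norm z + 1" for u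
  proof -
    have "norm (f u) = fock_weight \<alpha> f u * exp (\<alpha> / 2 * (norm u)\<^sup>2)"
      by (simp add: fock_weight_def mult.assoc flip: exp_add)
    also have "\<dots> \<le> B * exp (\<alpha> / 2 * (norm z + 1)\<^sup>2)"
      using B \<open>0 \<le> B\<close> that \<open>0 \<le> \<alpha>\<close> by (intro mult_mono) (auto intro!: mult_left_mono power_mono)
    finally show ?thesis by (simp add: B'_def)
  qed
  define b where "b = sgn (w - z)"
  have "norm b \<le> 1" by (simp add: b_def norm_sgn)
  define h where "h s = (f (z + s *s b) - f z) / of_real (2 * B' + 1)" for s
  have "norm (h (of_real (norm (w - z)))) \<le> norm (complex_of_real (norm (w - z)))"
  proof (rule Schwarz_Lemma(1))
    show "h holomorphic_on ball 0 1"
      unfolding h_def using \<open>0 \<le> B'\<close>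
      by (intro holomorphic_intros holomorphic_on_subset[OF entire_slice_holomorphic[OF f]])
         (auto simp flip: of_real_add of_real_mult)
    show "h 0 = 0" by (simp add: h_def)
    show "norm (h s) < 1" if "norm s < 1" for s
    proof -
      have "norm (s *s b) \<le> 1 * 1"
        unfolding norm_scale_vec using that \<open>norm b \<le> 1\<close> by (intro mult_mono) auto
      then have "norm (z + s *s b) \<le> norm z + 1"
        using norm_triangle_ineq[of z "s *s b"] by linarith
      then have "norm (f (z + s *s b) - f z) \<le> 2 * B'"
        using norm_triangle_ineq4[of "f (z + s *s b)" "f z"] bound[of "z + s *s b"] bound[of z] by simp
      then show ?thesis
        using \<open>0 \<le> B'\<close> by (simp add: h_def norm_divide del: of_real_add of_real_mult)
    qed
    show "norm (complex_of_real (norm (w - z))) < 1" using assms by simp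
  qed
  moreover have "z + complex_of_real (norm (w - z)) *s b = w"
  proof -
    have "complex_of_real (norm (w - z)) *s b = norm (w - z) *\<^sub>R b"
      by (simp add: vec_eq_iff) (simp add: scaleR_conv_of_real)
    then show ?thesis by (cases "w = z") (simp_all add: b_def sgn_div_norm)
  qed
  ultimately have "norm ((f w - f z) / of_real (2 * B' + 1)) \<le> norm (w - z)"
    by (simp add: h_def del: of_real_add of_real_mult)
  then show ?thesis
    unfolding B'_def[symmetric]
    using \<open>0 \<le> B'\<close> by (simp add: norm_divide pos_divide_le_eq mult.commute del: of_real_add of_real_mult)
qed

text \<open>
  The pointwise form of Montel's theorem. A diagonal subsequence converges on a countable dense set;
  equicontinuity extends this to every point.
\<close>

lemma entire_pointwise_convergent_subsequence:
  fixes f :: "nat \<Rightarrow> complex ^ 'n \<Rightarrow> complex"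
  assumes \<alpha>: "0 \<le> \<alpha>" and f: "\<And>k. entire (f k)" and B: "\<And>k w. fock_weight \<alpha> (f k) w \<le> B"
  shows "\<exists>g r. strict_mono (r :: nat \<Rightarrow> nat) \<and> (\<forall>z. (\<lambda>k. f (r k) z) \<longlonglongrightarrow> g z)"
proof -
  have "0 \<le> B" using B[of 0 0] fock_weight_nonneg order_trans by blast
  obtain D :: "(complex ^ 'n) set"
    where D: "countable D" "\<And>X. open X \<Longrightarrow> X \<noteq> {} \<Longrightarrow> \<exists>d\<in>D. d \<in> X"
    by (rule countable_dense_setE) blast
  \<comment> \<open>The diagonal argument needs a bound that is uniform on the dense set, hence the weight.\<close>
  define F where "F k z = of_real (exp (- (\<alpha> / 2) * (norm z)\<^sup>2)) * f k z" for k z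
  have "norm (F k z) \<le> B" for k z
    using B[of k z] by (simp add: F_def fock_weight_def norm_mult mult.commute)
  then obtain r where r: "strict_mono (r :: nat \<Rightarrow> nat)" "\<And>z. z \<in> D \<Longrightarrow> \<exists>l. (\<lambda>n. F (r n) z) \<longlonglongrightarrow> l"
    using function_convergent_subsequence[OF D(1), of F B] by blast
  have convD: "Cauchy (\<lambda>n. f (r n) d)" if d: "d \<in> D" for d
  proof -
    obtain l where "(\<lambda>n. F (r n) d) \<longlonglongrightarrow> l" using r(2)[OF d] by blast
    then have "(\<lambda>n. of_real (exp (\<alpha> / 2 * (norm d)\<^sup>2)) * F (r n) d) \<longlonglongrightarrow> of_real (exp (\<alpha> / 2 * (norm d)\<^sup>2)) * l"
      by (intro tendsto_intros)
    moreover have "of_real (exp (\<alpha> / 2 * (norm d)\<^sup>2)) * F k d = f k d" for k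
      unfolding F_def mult.assoc[symmetric] of_real_mult[symmetric] exp_add[symmetric] by simp
    ultimately have "(\<lambda>n. f (r n) d) \<longlonglongrightarrow> of_real (exp (\<alpha> / 2 * (norm d)\<^sup>2)) * l"
      by (simp only:)
    then show ?thesis
      by (rule LIMSEQ_imp_Cauchy)
  qed
  have "Cauchy (\<lambda>n. f (r n) z)" for z
  proof (rule metric_CauchyI)
    fix e :: real assume "0 < e"
    define K where "K = 2 * (B * exp (\<alpha> / 2 * (norm z + 1)\<^sup>2)) + 1"
    have "0 < K" using \<open>0 \<le> B\<close> by (simp add: K_def add_nonneg_pos)
    define \<delta> where "\<delta> = min 1 (e / (3 * K))"
    have "0 < \<delta>" using \<open>0 < e\<close> \<open>0 < K\<close> by (simp add: \<delta>_def)
    then obtain d where d: "d \<in> D" "dist z d < \<delta>"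
      using D(2)[of "ball z \<delta>"] by auto
    have close: "dist (f k d) (f k z) < e / 3" for k
    proof -
      have "norm (d - z) < 1" "norm (d - z) < e / (3 * K)"
        using d(2) by (auto simp: \<delta>_def dist_norm norm_minus_commute)
      then have "norm (f k d - f k z) \<le> K * norm (d - z)"
        unfolding K_def using entire_lipschitz_of_fock_weight[OF \<alpha> f B] by blast
      also have "\<dots> < K * (e / (3 * K))"
        using \<open>norm (d - z) < e / (3 * K)\<close> \<open>0 < K\<close> by (rule mult_strict_left_mono)
      finally show ?thesis using \<open>0 < K\<close> by (simp add: dist_norm)
    qed
    obtain N where N: "\<And>m n. N \<le> m \<Longrightarrow> N \<le> n \<Longrightarrow> dist (f (r m) d) (f (r n) d) < e / 3"
      using metric_CauchyD[OF convD[OF d(1)], of "e / 3"] \<open>0 < e\<close> by auto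
    show "\<exists>N. \<forall>m\<ge>N. \<forall>n\<ge>N. dist (f (r m) z) (f (r n) z) < e"
    proof (intro exI allI impI)
      fix m n assume "N \<le> m" "N \<le> n"
      have "dist (f (r m) z) (f (r n) z) \<le> dist (f (r m) d) (f (r m) z) + dist (f (r m) d) (f (r n) d) + dist (f (r n) d) (f (r n) z)"
        by metric
      then show "dist (f (r m) z) (f (r n) z) < e"
        using close[of "r m"] close[of "r n"] N[OF \<open>N \<le> m\<close> \<open>N \<le> n\<close>] by linarith
    qed
  qed
  then have "\<exists>l. (\<lambda>n. f (r n) z) \<longlonglongrightarrow> l" for z
    using Cauchy_convergent convergent_def by blast
  then obtain g where "\<And>z. (\<lambda>n. f (r n) z) \<longlonglongrightarrow> g z" by metis
  with r(1) show ?thesis by blast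
qed

section \<open>Compactness\<close>

definition unit_balls_vanish :: "'a::real_normed_vector measure \<Rightarrow> bool" where
  "unit_balls_vanish \<mu> \<longleftrightarrow>
    (\<forall>e>0. \<exists>R. \<forall>w. R \<le> norm w \<longrightarrow> emeasure \<mu> (ball w 1) \<le> ennreal e)"

text \<open>
  Removing a large ball from the measure makes all unit balls small simultaneously, so that the uniform
  estimates of the previous sections apply to the tail with a small constant.
\<close>

lemma unit_balls_vanish_tail:
  fixes \<mu> :: "'a::euclidean_space measure"
  assumes sets: "sets \<mu> = sets borel" and van: "unit_balls_vanish \<mu>" and "0 < e"
  obtains R where "unit_balls_le (density \<mu> (indicator (- cball 0 R))) e"
proof -
  obtain R where R: "\<And>w. R \<le> norm w \<Longrightarrow> emeasure \<mu> (ball w 1) \<le> ennreal e"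
    using van \<open>0 < e\<close> unfolding unit_balls_vanish_def by blast
  have "emeasure (density \<mu> (indicator (- cball 0 (R + 1)))) (ball w 1) \<le> ennreal e" for w
  proof -
    have "emeasure (density \<mu> (indicator (- cball 0 (R + 1)))) (ball w 1) =
        emeasure \<mu> (- cball 0 (R + 1) \<inter> ball w 1)"
      by (rule emeasure_restricted) (auto simp: sets)
    also have "\<dots> \<le> ennreal e"
    proof (cases "R \<le> norm w")
      case True
      have "emeasure \<mu> (- cball 0 (R + 1) \<inter> ball w 1) \<le> emeasure \<mu> (ball w 1)"
        by (rule emeasure_mono) (auto simp: sets)
      also have "\<dots> \<le> ennreal e" by (rule R[OF True])
      finally show ?thesis .
    next
      case False
      have "norm u \<le> R + 1" if "u \<in> ball w 1" for u
        using that False norm_triangle_ineq2[of u w] by (simp add: dist_norm norm_minus_commute)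
      then have "- cball 0 (R + 1) \<inter> ball w 1 = {}" by auto
      then show ?thesis by simp
    qed
    finally show ?thesis .
  qed
  with \<open>0 < e\<close> show thesis by (intro that[of "R + 1"]) (simp add: unit_balls_le_def)
qed

lemma nn_integral_split_cball:
  fixes \<mu> :: "'a::euclidean_space measure"
  assumes sets: "sets \<mu> = sets borel" and F: "F \<in> borel_measurable borel"
  shows "(\<integral>\<^sup>+u. F u \<partial>\<mu>) = (\<integral>\<^sup>+u. F u * indicator (cball 0 R) u \<partial>\<mu>) +
    (\<integral>\<^sup>+u. F u \<partial>density \<mu> (indicator (- cball 0 R)))"
proof -
  note sets[measurable_cong] F[measurable]
  have [measurable]: "cball (0::'a) R \<in> sets borel" "- cball (0::'a) R \<in> sets borel" by auto
  have "(\<integral>\<^sup>+u. F u \<partial>\<mu>) = (\<integral>\<^sup>+u. F u * indicator (cball 0 R) u + indicator (- cball 0 R) u * F u \<partial>\<mu>)"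
    by (intro nn_integral_cong) (simp add: indicator_def)
  also have "\<dots> = (\<integral>\<^sup>+u. F u * indicator (cball 0 R) u \<partial>\<mu>) + (\<integral>\<^sup>+u. indicator (- cball 0 R) u * F u \<partial>\<mu>)"
    by (rule nn_integral_add) measurable
  also have "(\<integral>\<^sup>+u. indicator (- cball 0 R) u * F u \<partial>\<mu>) = (\<integral>\<^sup>+u. F u \<partial>density \<mu> (indicator (- cball 0 R)))"
    by (rule nn_integral_density[symmetric]) measurable
  finally show ?thesis .
qed

lemma nn_integral_fock_weight_cball_tendsto_0:
  fixes h :: "nat \<Rightarrow> complex ^ 'n \<Rightarrow> complex"
  assumes sets: "sets \<mu> = sets borel" and fin: "emeasure \<mu> (cball 0 R) < \<infinity>" and q: "0 < q"
    and h: "\<And>k. h k \<in> borel_measurable borel" and B: "\<And>k u. fock_weight \<alpha> (h k) u \<le> B"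
    and lim: "\<And>u. (\<lambda>k. h k u) \<longlonglongrightarrow> 0"
  shows "(\<lambda>k. \<integral>\<^sup>+u. ennreal (fock_weight \<alpha> (h k) u powr q) * indicator (cball 0 R) u \<partial>\<mu>) \<longlonglongrightarrow> 0"
proof -
  note sets[measurable_cong] h[measurable]
  have [measurable]: "cball (0::complex ^ 'n) R \<in> sets borel" by auto
  have w0: "(\<lambda>k. fock_weight \<alpha> (h k) u powr q) \<longlonglongrightarrow> 0" for u
  proof -
    have "(\<lambda>k. fock_weight \<alpha> (h k) u) \<longlonglongrightarrow> 0"
      unfolding fock_weight_def using lim[of u] by (auto intro!: tendsto_eq_intros)
    then have "(\<lambda>k. fock_weight \<alpha> (h k) u powr q) \<longlonglongrightarrow> 0 powr q"
      by (rule tendsto_powr') (use q in auto)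
    then show ?thesis by simp
  qed
  have "(\<lambda>k. \<integral>\<^sup>+u. ennreal (fock_weight \<alpha> (h k) u powr q) * indicator (cball 0 R) u \<partial>\<mu>)
      \<longlonglongrightarrow> (\<integral>\<^sup>+u. 0 \<partial>\<mu>)"
  proof (rule nn_integral_dominated_convergence)
    show "AE u in \<mu>. ennreal (fock_weight \<alpha> (h k) u powr q) * indicator (cball 0 R) u \<le>
        ennreal (B powr q) * indicator (cball 0 R) u" for k
      using B q by (intro AE_I2 mult_right_mono ennreal_leI powr_mono2) auto
    show "(\<integral>\<^sup>+u. ennreal (B powr q) * indicator (cball 0 R) u \<partial>\<mu>) < \<infinity>"
      using fin by (subst nn_integral_cmult_indicator) (auto simp: sets ennreal_mult_less_top)
    show "AE u in \<mu>. (\<lambda>k. ennreal (fock_weight \<alpha> (h k) u powr q) * indicator (cball 0 R) u) \<longlonglongrightarrow> 0"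
    proof (rule AE_I2)
      fix u
      show "(\<lambda>k. ennreal (fock_weight \<alpha> (h k) u powr q) * indicator (cball 0 R) u) \<longlonglongrightarrow> 0"
        using tendsto_ennrealI[OF w0[of u]] by (cases "u \<in> cball 0 R") simp_all
    qed
  qed measurable
  then show ?thesis by simp
qed

text \<open>
  Vanishing at infinity controls all but the balls centred in a bounded set; those lie in one ball, whose
  mass is finite.
\<close>

lemma unit_balls_vanish_imp_le:
  fixes \<mu> :: "'a::real_normed_vector measure"
  assumes sets: "sets \<mu> = sets borel" and van: "unit_balls_vanish \<mu>"
    and fin: "\<And>R. emeasure \<mu> (cball 0 R) < \<infinity>"
  shows "\<exists>M. unit_balls_le \<mu> M"
proof -
  obtain R where R: "\<And>w. R \<le> norm w \<Longrightarrow> emeasure \<mu> (ball w 1) \<le> ennreal 1"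
    using van unfolding unit_balls_vanish_def by (metis zero_less_one)
  define M where "M = max 1 (enn2real (emeasure \<mu> (cball 0 (R + 1))))"
  have "emeasure \<mu> (ball w 1) \<le> ennreal M" for w
  proof (cases "R \<le> norm w")
    case True
    have "ennreal 1 \<le> ennreal M" by (intro ennreal_leI) (simp add: M_def)
    with R[OF True] show ?thesis by (rule order_trans)
  next
    case False
    have "norm u \<le> R + 1" if "u \<in> ball w 1" for u
      using that False norm_triangle_ineq2[of u w] by (simp add: dist_norm norm_minus_commute)
    then have "emeasure \<mu> (ball w 1) \<le> emeasure \<mu> (cball 0 (R + 1))"
      by (intro emeasure_mono) (auto simp: sets)
    also have "\<dots> = ennreal (enn2real (emeasure \<mu> (cball 0 (R + 1))))"
      using fin[of "R + 1"] by simp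
    also have "\<dots> \<le> ennreal M" by (intro ennreal_leI) (simp add: M_def)
    finally show ?thesis .
  qed
  then show ?thesis
    by (intro exI[of _ M]) (simp add: unit_balls_le_def M_def)
qed

lemma admissible_emeasure_cball_finite:
  fixes \<mu> :: "(complex ^ 'n) measure"
  assumes "0 < \<alpha>" and sets: "sets \<mu> = sets borel" and adm: "admissible \<alpha> \<mu>"
  shows "emeasure \<mu> (cball 0 R) < \<infinity>"
proof (rule emeasure_cball_finite[of \<alpha>])
  show "(\<integral>\<^sup>+u. ennreal (exp (- \<alpha> * (norm u)\<^sup>2)) \<partial>\<mu>) < \<infinity>"
    using adm[unfolded admissible_def, rule_format, of 0] by (simp add: norm_fock_kernel)
qed (use assms in \<open>simp_all\<close>)

lemma powr_add_le:
  fixes a b q :: real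
  assumes "0 \<le> a" "0 \<le> b" "0 \<le> q"
  shows "(a + b) powr q \<le> 2 powr q * (a powr q + b powr q)"
proof -
  have "(a + b) powr q \<le> (2 * max a b) powr q"
    using assms by (intro powr_mono2) auto
  also have "\<dots> = 2 powr q * max a b powr q"
    by (rule powr_mult)
  also have "\<dots> \<le> 2 powr q * (a powr q + b powr q)"
    by (intro mult_left_mono) (auto simp: max_def)
  finally show ?thesis .
qed

lemma nn_integral_fock_weight_diff_le:
  assumes sets: "sets \<mu> = sets borel" and q: "0 \<le> q"
    and f: "f \<in> borel_measurable borel" and g: "g \<in> borel_measurable borel"
  shows "(\<integral>\<^sup>+u. ennreal (fock_weight \<alpha> (\<lambda>z. f z - g z) u powr q) \<partial>\<mu>) \<le> ennreal (2 powr q) *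
    ((\<integral>\<^sup>+u. ennreal (fock_weight \<alpha> f u powr q) \<partial>\<mu>) + (\<integral>\<^sup>+u. ennreal (fock_weight \<alpha> g u powr q) \<partial>\<mu>))"
proof -
  note sets[measurable_cong] f[measurable] g[measurable]
  have "(\<integral>\<^sup>+u. ennreal (fock_weight \<alpha> (\<lambda>z. f z - g z) u powr q) \<partial>\<mu>) \<le>
      (\<integral>\<^sup>+u. ennreal (2 powr q) * (ennreal (fock_weight \<alpha> f u powr q) + ennreal (fock_weight \<alpha> g u powr q)) \<partial>\<mu>)"
  proof (rule nn_integral_mono)
    fix u
    have "fock_weight \<alpha> (\<lambda>z. f z - g z) u powr q \<le> (fock_weight \<alpha> f u + fock_weight \<alpha> g u) powr q"
      using q by (intro powr_mono2 fock_weight_triangle) auto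
    also have "\<dots> \<le> 2 powr q * (fock_weight \<alpha> f u powr q + fock_weight \<alpha> g u powr q)"
      using q by (intro powr_add_le) auto
    finally show "ennreal (fock_weight \<alpha> (\<lambda>z. f z - g z) u powr q) \<le>
        ennreal (2 powr q) * (ennreal (fock_weight \<alpha> f u powr q) + ennreal (fock_weight \<alpha> g u powr q))"
      by (simp add: ennreal_leI flip: ennreal_mult' ennreal_plus)
  qed
  also have "\<dots> = ennreal (2 powr q) * (\<integral>\<^sup>+u. ennreal (fock_weight \<alpha> f u powr q) + ennreal (fock_weight \<alpha> g u powr q) \<partial>\<mu>)"
    by (rule nn_integral_cmult) measurable
  also have "(\<integral>\<^sup>+u. ennreal (fock_weight \<alpha> f u powr q) + ennreal (fock_weight \<alpha> g u powr q) \<partial>\<mu>) =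
      (\<integral>\<^sup>+u. ennreal (fock_weight \<alpha> f u powr q) \<partial>\<mu>) + (\<integral>\<^sup>+u. ennreal (fock_weight \<alpha> g u powr q) \<partial>\<mu>)"
    by (rule nn_integral_add) measurable
  finally show ?thesis .
qed

lemma nn_integral_fock_weight_Fatou:
  assumes sets: "sets \<mu> = sets borel" and q: "0 < q"
    and f: "\<And>k. f k \<in> borel_measurable borel" and lim: "\<And>u. (\<lambda>k. f k u) \<longlonglongrightarrow> g u"
  shows "(\<integral>\<^sup>+u. ennreal (fock_weight \<alpha> g u powr q) \<partial>\<mu>) \<le>
    liminf (\<lambda>k. \<integral>\<^sup>+u. ennreal (fock_weight \<alpha> (f k) u powr q) \<partial>\<mu>)"
proof -
  note sets[measurable_cong] f[measurable]
  have "(\<lambda>k. ennreal (fock_weight \<alpha> (f k) u powr q)) \<longlonglongrightarrow> ennreal (fock_weight \<alpha> g u powr q)" for u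
  proof -
    have "(\<lambda>k. fock_weight \<alpha> (f k) u) \<longlonglongrightarrow> fock_weight \<alpha> g u"
      unfolding fock_weight_def using lim[of u] by (auto intro!: tendsto_eq_intros)
    then have "(\<lambda>k. fock_weight \<alpha> (f k) u powr q) \<longlonglongrightarrow> fock_weight \<alpha> g u powr q"
      by (rule tendsto_powr') (use q in auto)
    then show ?thesis by (rule tendsto_ennrealI)
  qed
  then have "ennreal (fock_weight \<alpha> g u powr q) = liminf (\<lambda>k. ennreal (fock_weight \<alpha> (f k) u powr q))" for u
    by (metis lim_imp_Liminf sequentially_bot)
  then have "(\<integral>\<^sup>+u. ennreal (fock_weight \<alpha> g u powr q) \<partial>\<mu>) =
      (\<integral>\<^sup>+u. liminf (\<lambda>k. ennreal (fock_weight \<alpha> (f k) u powr q)) \<partial>\<mu>)"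
    by simp
  also have "\<dots> \<le> liminf (\<lambda>k. \<integral>\<^sup>+u. ennreal (fock_weight \<alpha> (f k) u powr q) \<partial>\<mu>)"
    by (rule nn_integral_liminf) measurable
  finally show ?thesis .
qed

lemma liminf_le_of_le:
  fixes a :: "nat \<Rightarrow> ennreal"
  assumes "\<And>k. a k \<le> c"
  shows "liminf a \<le> c"
  using Liminf_mono[of a "\<lambda>_. c" sequentially] assms by (simp add: Liminf_const)

lemma enn2real_tendsto_0I:
  assumes "\<And>e. 0 < e \<Longrightarrow> \<forall>\<^sub>F k in sequentially. a k \<le> ennreal e"
  shows "(\<lambda>k. enn2real (a k)) \<longlonglongrightarrow> 0"
proof (rule tendstoI)
  fix e :: real assume "0 < e"
  have "\<forall>\<^sub>F k in sequentially. a k \<le> ennreal (e / 2)"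
    using assms[of "e / 2"] \<open>0 < e\<close> by simp
  then show "\<forall>\<^sub>F k in sequentially. dist (enn2real (a k)) 0 < e"
  proof eventually_elim
    case (elim k)
    then have "enn2real (a k) \<le> e / 2"
      using \<open>0 < e\<close> enn2real_mono[OF elim] by simp
    then show ?case using \<open>0 < e\<close> by simp
  qed
qed

lemma ennreal_eventually_le:
  fixes b :: "nat \<Rightarrow> ennreal"
  assumes "b \<longlonglongrightarrow> 0" "0 < e"
  shows "\<forall>\<^sub>F k in sequentially. b k \<le> ennreal e"
  using order_tendstoD(2)[OF assms(1), of "ennreal e"] assms(2)
  by (auto elim: eventually_mono)

text \<open>
  Given a bounded sequence, let \<open>g\<close> be the pointwise limit of a subsequence. On a large ball the
  \<open>q\<close>-th powers converge to \<open>0\<close> in the mean by dominated convergence. On the complement the Carleson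
  inequality for the restricted measure makes the contribution of each member small, and that of \<open>g\<close> by
  Fatou's lemma.
\<close>

lemma vanishing_fock_carleson_of_unit_balls_vanish:
  fixes \<mu> :: "(complex ^ 'n) measure"
  assumes \<alpha>: "0 < \<alpha>" and q: "1 \<le> q" and sets: "sets \<mu> = sets borel"
    and van: "unit_balls_vanish \<mu>" and fin: "\<And>R. emeasure \<mu> (cball 0 R) < \<infinity>"
  shows "vanishing_fock_carleson \<alpha> 1 q \<mu>"
proof -
  obtain M where M: "unit_balls_le \<mu> M"
    using unit_balls_vanish_imp_le[OF sets van fin] by blast
  obtain C where C: "0 < C" "\<And>(f :: complex ^ 'n \<Rightarrow> complex) \<mu> M.
    f \<in> fock_space \<alpha> 1 \<Longrightarrow> sets \<mu> = sets borel \<Longrightarrow> unit_balls_le \<mu> M \<Longrightarrow>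
    (\<integral>\<^sup>+u. ennreal (fock_weight \<alpha> f u powr q) \<partial>\<mu>) \<le> ennreal (C * M * fock_norm \<alpha> 1 f powr q)"
    using nn_integral_fock_weight_powr_le[OF \<alpha> q, where 'n = 'n] by blast
  obtain C1 where C1: "0 < C1" "\<And>(f :: complex ^ 'n \<Rightarrow> complex) w. f \<in> fock_space \<alpha> (ennreal 1) \<Longrightarrow>
    fock_weight \<alpha> f w \<le> C1 * fock_norm \<alpha> (ennreal 1) f"
    using fock_weight_le_fock_norm[OF \<alpha>, of 1, where 'n = 'n] by auto
  have entire: "entire f" if "f \<in> fock_space \<alpha> 1" for f :: "complex ^ 'n \<Rightarrow> complex"
    using that fock_space_iff[of 1 f \<alpha>] by simp
  show ?thesis
    unfolding vanishing_fock_carleson_def op_compact_def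
  proof (intro conjI allI impI ballI)
    fix f :: "complex ^ 'n \<Rightarrow> complex" assume f: "f \<in> fock_space \<alpha> 1"
    show "f \<in> Lq_space q (fock_sigma \<alpha> q \<mu>)"
      using C(2)[OF f sets M] entire_measurable[OF entire[OF f]]
      by (auto simp: Lq_space_fock_sigma_iff[OF sets] intro: le_less_trans)
  next
    fix f :: "nat \<Rightarrow> complex ^ 'n \<Rightarrow> complex"
    assume "(\<forall>k. f k \<in> fock_space \<alpha> 1) \<and> (\<exists>B. \<forall>k. fock_norm \<alpha> 1 (f k) \<le> B)"
    then obtain B where f: "\<And>k. f k \<in> fock_space \<alpha> 1" and B: "\<And>k. fock_norm \<alpha> 1 (f k) \<le> B"
      by blast
    have N: "0 \<le> fock_norm \<alpha> 1 (f k)" for k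
      using fock_norm_nonneg[of 1 \<alpha> "f k"] by simp
    have "0 \<le> B" using N[of 0] B[of 0] by simp
    have wB: "fock_weight \<alpha> (f k) u \<le> C1 * B" for k u
      using f[of k] B[of k] C1(1) by (intro order_trans[OF C1(2)] mult_left_mono) auto
    obtain g r where r: "strict_mono (r :: nat \<Rightarrow> nat)" and g: "\<And>z. (\<lambda>k. f (r k) z) \<longlonglongrightarrow> g z"
      using entire_pointwise_convergent_subsequence[of \<alpha> f "C1 * B", OF less_imp_le[OF \<alpha>] entire[OF f] wB] by blast
    have fm: "f k \<in> borel_measurable borel" for k by (rule entire_measurable[OF entire[OF f]])
    have gm: "g \<in> borel_measurable borel" by (rule borel_measurable_LIMSEQ_metric[OF fm g])
    have int_f: "(\<integral>\<^sup>+u. ennreal (fock_weight \<alpha> (f k) u powr q) \<partial>\<nu>) \<le> ennreal (C * e * B powr q)"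
      if "sets \<nu> = sets borel" and e: "unit_balls_le \<nu> e" for \<nu> e k
    proof (rule order_trans[OF C(2)[OF f that]], intro ennreal_leI mult_left_mono powr_mono2)
      show "0 \<le> C * e" using C(1) e by (simp add: unit_balls_le_def)
    qed (use q N B in auto)
    have int_g: "(\<integral>\<^sup>+u. ennreal (fock_weight \<alpha> g u powr q) \<partial>\<nu>) \<le> ennreal (C * e * B powr q)"
      if "sets \<nu> = sets borel" and e: "unit_balls_le \<nu> e" for \<nu> e
      using nn_integral_fock_weight_Fatou[OF that(1) _ fm g, of q \<alpha>] q
        liminf_le_of_le[OF int_f[OF that], of "\<lambda>k. r k"]
      by (auto intro: order_trans)
    have wg: "fock_weight \<alpha> g u \<le> C1 * B" for u
    proof (rule LIMSEQ_le_const2)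
      show "(\<lambda>k. fock_weight \<alpha> (f (r k)) u) \<longlonglongrightarrow> fock_weight \<alpha> g u"
        unfolding fock_weight_def using g[of u] by (auto intro!: tendsto_eq_intros)
    qed (use wB in auto)
    define d where "d k z = f (r k) z - g z" for k z
    have dm: "d k \<in> borel_measurable borel" for k
      unfolding d_def using fm gm by (intro borel_measurable_diff) auto
    have wd: "fock_weight \<alpha> (d k) u \<le> 2 * (C1 * B)" for k u
      using fock_weight_triangle[of \<alpha> "f (r k)" g u] wB[of "r k" u] wg[of u] by (simp add: d_def [abs_def])
    have d0: "(\<lambda>k. d k u) \<longlonglongrightarrow> 0" for u
      using tendsto_diff[OF g[of u] tendsto_const[of "g u"]] by (simp add: d_def)
    have "(\<lambda>k. enn2real (\<integral>\<^sup>+u. ennreal (fock_weight \<alpha> (d k) u powr q) \<partial>\<mu>)) \<longlonglongrightarrow> 0"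
    proof (rule enn2real_tendsto_0I)
      fix e :: real assume "0 < e"
      define K where "K = 2 powr q * (2 * (C * B powr q))"
      have "0 \<le> K" using C(1) by (simp add: K_def)
      \<comment> \<open>chosen such that the tail contributes at most \<open>K e' \<le> e/2\<close>\<close>
      define e' where "e' = e / (2 * (K + 1))"
      have "0 < e'" using \<open>0 < e\<close> \<open>0 \<le> K\<close> by (simp add: e'_def)
      have "K * e' \<le> e / 2"
        using \<open>0 < e\<close> \<open>0 \<le> K\<close> by (simp add: e'_def field_simps)
      obtain R where R: "unit_balls_le (density \<mu> (indicator (- cball 0 R))) e'"
        using unit_balls_vanish_tail[OF sets van \<open>0 < e'\<close>] .
      define \<nu> where "\<nu> = density \<mu> (indicator (- cball 0 R) :: complex ^ 'n \<Rightarrow> ennreal)"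
      have \<nu>: "sets \<nu> = sets borel" "unit_balls_le \<nu> e'"
        using R by (simp_all add: \<nu>_def sets)
      have tail: "(\<integral>\<^sup>+u. ennreal (fock_weight \<alpha> (d k) u powr q) \<partial>\<nu>) \<le> ennreal (e / 2)" for k
      proof -
        have "(\<integral>\<^sup>+u. ennreal (fock_weight \<alpha> (d k) u powr q) \<partial>\<nu>) \<le> ennreal (2 powr q) *
           ((\<integral>\<^sup>+u. ennreal (fock_weight \<alpha> (f (r k)) u powr q) \<partial>\<nu>) + (\<integral>\<^sup>+u. ennreal (fock_weight \<alpha> g u powr q) \<partial>\<nu>))"
          unfolding d_def using q by (intro nn_integral_fock_weight_diff_le \<nu> fm gm) simp
        also have "\<dots> \<le> ennreal (2 powr q) * (ennreal (C * e' * B powr q) + ennreal (C * e' * B powr q))"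
          by (intro mult_left_mono add_mono int_f int_g \<nu>) simp
        also have "\<dots> = ennreal (K * e')"
          using C(1) \<open>0 < e'\<close> by (simp add: K_def mult_ac flip: ennreal_mult' ennreal_plus)
        also have "\<dots> \<le> ennreal (e / 2)" using \<open>K * e' \<le> e / 2\<close> by (rule ennreal_leI)
        finally show ?thesis .
      qed
      have "(\<lambda>k. \<integral>\<^sup>+u. ennreal (fock_weight \<alpha> (d k) u powr q) * indicator (cball 0 R) u \<partial>\<mu>) \<longlonglongrightarrow> 0"
        using q by (intro nn_integral_fock_weight_cball_tendsto_0[OF sets fin _ dm wd d0]) simp
      then have "\<forall>\<^sub>F k in sequentially.
          (\<integral>\<^sup>+u. ennreal (fock_weight \<alpha> (d k) u powr q) * indicator (cball 0 R) u \<partial>\<mu>) \<le> ennreal (e / 2)"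
        using \<open>0 < e\<close> by (intro ennreal_eventually_le) auto
      then show "\<forall>\<^sub>F k in sequentially. (\<integral>\<^sup>+u. ennreal (fock_weight \<alpha> (d k) u powr q) \<partial>\<mu>) \<le> ennreal e"
      proof eventually_elim
        case (elim k)
        have [measurable]: "d k \<in> borel_measurable borel" by (rule dm)
        have "(\<integral>\<^sup>+u. ennreal (fock_weight \<alpha> (d k) u powr q) \<partial>\<mu>) =
            (\<integral>\<^sup>+u. ennreal (fock_weight \<alpha> (d k) u powr q) * indicator (cball 0 R) u \<partial>\<mu>) +
            (\<integral>\<^sup>+u. ennreal (fock_weight \<alpha> (d k) u powr q) \<partial>\<nu>)"
          unfolding \<nu>_def by (rule nn_integral_split_cball[OF sets]) measurable
        also have "\<dots> \<le> ennreal (e / 2) + ennreal (e / 2)"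
          by (intro add_mono elim tail)
        also have "\<dots> = ennreal e"
          using \<open>0 < e\<close> by (simp flip: ennreal_plus)
        finally show ?case .
      qed
    qed
    then have "(\<lambda>k. enn2real (\<integral>\<^sup>+u. ennreal (fock_weight \<alpha> (d k) u powr q) \<partial>\<mu>) powr (1 / q)) \<longlonglongrightarrow> 0 powr (1 / q)"
      by (rule tendsto_powr') (use q in auto)
    then have "(\<lambda>k. Lq_norm q (fock_sigma \<alpha> q \<mu>) (\<lambda>z. f (r k) z - g z)) \<longlonglongrightarrow> 0"
      using q by (simp add: Lq_norm_fock_sigma[OF sets dm] flip: d_def)
    moreover have "g \<in> Lq_space q (fock_sigma \<alpha> q \<mu>)"
      using int_g[OF sets M] gm by (auto simp: Lq_space_fock_sigma_iff[OF sets] intro: le_less_trans)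
    ultimately show "\<exists>g\<in>Lq_space q (fock_sigma \<alpha> q \<mu>). \<exists>r. strict_mono r \<and>
        (\<lambda>k. Lq_norm q (fock_sigma \<alpha> q \<mu>) (\<lambda>z. f (r k) z - g z)) \<longlonglongrightarrow> 0"
      using r by blast
  qed
qed

text \<open>
  The limit of the images is \<open>T g\<close>, where \<open>g\<close> is the pointwise limit of a subsequence. It is an entire
  function because \<open>T\<close> maps measurable functions of bounded weighted modulus to entire functions.
\<close>

lemma toeplitz_compact_of_unit_balls_vanish:
  fixes \<mu> :: "(complex ^ 'n) measure"
  assumes \<alpha>: "0 < \<alpha>" and p: "1 \<le> p" and sets: "sets \<mu> = sets borel"
    and van: "unit_balls_vanish \<mu>" and fin: "\<And>R. emeasure \<mu> (cball 0 R) < \<infinity>"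
  shows "toeplitz_compact \<alpha> (ennreal p) \<infinity> \<mu>"
proof -
  obtain M where M: "unit_balls_le \<mu> M"
    using unit_balls_vanish_imp_le[OF sets van fin] by blast
  have bd: "toeplitz_bounded \<alpha> (ennreal p) \<infinity> \<mu>"
    using toeplitz_bounded_iff_unit_balls_le[OF \<alpha> p sets] M by blast
  obtain C1 where C1: "0 < C1" "\<And>(f :: complex ^ 'n \<Rightarrow> complex) w. f \<in> fock_space \<alpha> (ennreal p) \<Longrightarrow>
    fock_weight \<alpha> f w \<le> C1 * fock_norm \<alpha> (ennreal p) f"
    using fock_weight_le_fock_norm[OF \<alpha> p, where 'n = 'n] by blast
  obtain C2 where C2: "0 < C2" "\<And>(z :: complex ^ 'n) \<mu> M. sets \<mu> = sets borel \<Longrightarrow> unit_balls_le \<mu> M \<Longrightarrow>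
    (\<integral>\<^sup>+u. ennreal (exp (- (\<alpha> / 2) * (norm (u - z))\<^sup>2)) \<partial>\<mu>) \<le> ennreal (C2 * M)"
    using nn_integral_shifted_gaussian_le[OF \<alpha>, where 'n = 'n] by blast
  have entire: "entire f" if "f \<in> fock_space \<alpha> (ennreal p)" for f :: "complex ^ 'n \<Rightarrow> complex"
    using that p by (simp add: fock_space_iff)
  show ?thesis
    unfolding toeplitz_compact_def op_compact_def
  proof (intro conjI allI impI ballI)
    show "toeplitz_defined_on \<alpha> \<mu> (fock_space \<alpha> (ennreal p))"
      using bd by (simp add: toeplitz_bounded_def)
    show "toeplitz \<alpha> \<mu> f \<in> fock_space \<alpha> \<infinity>" if "f \<in> fock_space \<alpha> (ennreal p)" for f
      using bd that unfolding toeplitz_bounded_def op_bound_def by blast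
  next
    fix f :: "nat \<Rightarrow> complex ^ 'n \<Rightarrow> complex"
    assume "(\<forall>k. f k \<in> fock_space \<alpha> (ennreal p)) \<and> (\<exists>B. \<forall>k. fock_norm \<alpha> (ennreal p) (f k) \<le> B)"
    then obtain B where f: "\<And>k. f k \<in> fock_space \<alpha> (ennreal p)" and B: "\<And>k. fock_norm \<alpha> (ennreal p) (f k) \<le> B"
      by blast
    define D where "D = C1 * B"
    have wD: "fock_weight \<alpha> (f k) u \<le> D" for k u
      unfolding D_def using C1(1) by (intro order_trans[OF C1(2)[OF f]] mult_left_mono B) simp
    have "0 \<le> D" using wD[of 0 0] fock_weight_nonneg order_trans by blast
    obtain g r where r: "strict_mono (r :: nat \<Rightarrow> nat)" and g: "\<And>z. (\<lambda>k. f (r k) z) \<longlonglongrightarrow> g z"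
      using entire_pointwise_convergent_subsequence[of \<alpha> f D, OF less_imp_le[OF \<alpha>] entire[OF f] wD] by blast
    have fm: "f k \<in> borel_measurable borel" for k by (rule entire_measurable[OF entire[OF f]])
    have gm: "g \<in> borel_measurable borel" by (rule borel_measurable_LIMSEQ_metric[OF fm g])
    have wg: "fock_weight \<alpha> g u \<le> D" for u
    proof (rule LIMSEQ_le_const2)
      show "(\<lambda>k. fock_weight \<alpha> (f (r k)) u) \<longlonglongrightarrow> fock_weight \<alpha> g u"
        unfolding fock_weight_def using g[of u] by (auto intro!: tendsto_eq_intros)
    qed (use wD in auto)
    define d where "d k z = f (r k) z - g z" for k z
    have dm: "d k \<in> borel_measurable borel" for k
      unfolding d_def using fm gm by (intro borel_measurable_diff) auto
    have wd: "fock_weight \<alpha> (d k) u \<le> 2 * D" for k u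
      using fock_weight_triangle[of \<alpha> "f (r k)" g u] wD[of "r k" u] wg[of u] by (simp add: d_def [abs_def])
    have d0: "(\<lambda>k. d k u) \<longlonglongrightarrow> 0" for u
      using tendsto_diff[OF g[of u] tendsto_const[of "g u"]] by (simp add: d_def)
    have Td: "toeplitz \<alpha> \<mu> (f (r k)) z - toeplitz \<alpha> \<mu> g z = toeplitz \<alpha> \<mu> (d k) z" for k z
      unfolding toeplitz_def d_def
      using toeplitz_integrable[OF \<alpha> sets M fm wD] toeplitz_integrable[OF \<alpha> sets M gm wg]
      by (subst Bochner_Integration.integral_diff[symmetric]) (simp_all add: left_diff_distrib right_diff_distrib)
    \<comment> \<open>Near the origin the Gaussian is at most 1 and dominated convergence applies; far away the
      Gaussian integral over the thinned-out measure is small for every \<open>z\<close>. Both bounds are free of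
      \<open>z\<close>, which gives uniform smallness.\<close>
    have small: "\<forall>\<^sub>F k in sequentially. \<forall>z. fock_weight \<alpha> (toeplitz \<alpha> \<mu> (d k)) z \<le> e" if "0 < e" for e
    proof -
      define e' where "e' = e / (2 * (2 * D * C2 + 1))"
      have K: "0 \<le> 2 * D * C2" using \<open>0 \<le> D\<close> C2(1) by simp
      have "0 < e'" using \<open>0 < e\<close> K by (simp add: e'_def add_nonneg_pos)
      have "2 * D * C2 * e' \<le> e / 2"
        using \<open>0 < e\<close> K by (simp add: e'_def pos_divide_le_eq add_nonneg_pos)
      obtain R where R: "unit_balls_le (density \<mu> (indicator (- cball 0 R))) e'"
        using unit_balls_vanish_tail[OF sets van \<open>0 < e'\<close>] .
      define \<nu> where "\<nu> = density \<mu> (indicator (- cball 0 R) :: complex ^ 'n \<Rightarrow> ennreal)"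
      have \<nu>: "sets \<nu> = sets borel" "unit_balls_le \<nu> e'"
        using R by (simp_all add: \<nu>_def sets)
      note sets[measurable_cong] \<nu>(1)[measurable_cong] dm[measurable]
      have [measurable]: "cball (0::complex ^ 'n) R \<in> sets borel" by auto
      have "(\<lambda>k. \<integral>\<^sup>+u. ennreal (fock_weight \<alpha> (d k) u powr 1) * indicator (cball 0 R) u \<partial>\<mu>) \<longlonglongrightarrow> 0"
        by (intro nn_integral_fock_weight_cball_tendsto_0[OF sets fin _ dm wd d0]) simp
      then have "\<forall>\<^sub>F k in sequentially.
          (\<integral>\<^sup>+u. ennreal (fock_weight \<alpha> (d k) u) * indicator (cball 0 R) u \<partial>\<mu>) \<le> ennreal (e / 2)"
        using \<open>0 < e\<close> by (intro ennreal_eventually_le) auto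
      then show ?thesis
      proof eventually_elim
        case (elim k)
        show ?case
        proof
          fix z
          have "ennreal (fock_weight \<alpha> (toeplitz \<alpha> \<mu> (d k)) z) \<le>
              (\<integral>\<^sup>+w. ennreal (exp (- (\<alpha> / 2) * (norm (w - z))\<^sup>2) * fock_weight \<alpha> (d k) w) \<partial>\<mu>)"
            by (rule fock_weight_toeplitz_le)
          also have "\<dots> = (\<integral>\<^sup>+w. ennreal (exp (- (\<alpha> / 2) * (norm (w - z))\<^sup>2) * fock_weight \<alpha> (d k) w) * indicator (cball 0 R) w \<partial>\<mu>) +
              (\<integral>\<^sup>+w. ennreal (exp (- (\<alpha> / 2) * (norm (w - z))\<^sup>2) * fock_weight \<alpha> (d k) w) \<partial>\<nu>)"
            unfolding \<nu>_def by (rule nn_integral_split_cball[OF sets]) measurable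
          also have "\<dots> \<le> ennreal (e / 2) + ennreal (e / 2)"
          proof (rule add_mono)
            have "(\<integral>\<^sup>+w. ennreal (exp (- (\<alpha> / 2) * (norm (w - z))\<^sup>2) * fock_weight \<alpha> (d k) w) * indicator (cball 0 R) w \<partial>\<mu>)
                \<le> (\<integral>\<^sup>+w. ennreal (fock_weight \<alpha> (d k) w) * indicator (cball 0 R) w \<partial>\<mu>)"
              using \<alpha> by (intro nn_integral_mono mult_right_mono ennreal_leI mult_left_le_one_le) auto
            with elim show "(\<integral>\<^sup>+w. ennreal (exp (- (\<alpha> / 2) * (norm (w - z))\<^sup>2) * fock_weight \<alpha> (d k) w) * indicator (cball 0 R) w \<partial>\<mu>)
                \<le> ennreal (e / 2)"
              by (rule order_trans[rotated])
            have "(\<integral>\<^sup>+w. ennreal (exp (- (\<alpha> / 2) * (norm (w - z))\<^sup>2) * fock_weight \<alpha> (d k) w) \<partial>\<nu>) \<le>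
                ennreal ((2 * D) * (C2 * e'))"
              by (intro nn_integral_gaussian_fock_weight_le wd C2(2) \<nu>)
            also have "\<dots> = ennreal (2 * D * C2 * e')"
              by (simp add: mult.assoc)
            also have "\<dots> \<le> ennreal (e / 2)"
              using \<open>2 * D * C2 * e' \<le> e / 2\<close> by (rule ennreal_leI)
            finally show "(\<integral>\<^sup>+w. ennreal (exp (- (\<alpha> / 2) * (norm (w - z))\<^sup>2) * fock_weight \<alpha> (d k) w) \<partial>\<nu>) \<le> ennreal (e / 2)" .
          qed
          also have "\<dots> = ennreal e"
            using \<open>0 < e\<close> by (simp flip: ennreal_plus)
          finally show "fock_weight \<alpha> (toeplitz \<alpha> \<mu> (d k)) z \<le> e"
            using \<open>0 < e\<close> by simp
        qed
      qed
    qed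
    have "(\<lambda>k. fock_norm \<alpha> \<infinity> (\<lambda>z. toeplitz \<alpha> \<mu> (f (r k)) z - toeplitz \<alpha> \<mu> g z)) \<longlonglongrightarrow> 0"
    proof (rule tendstoI)
      fix e :: real assume "0 < e"
      have "\<forall>\<^sub>F k in sequentially. \<forall>z. fock_weight \<alpha> (toeplitz \<alpha> \<mu> (d k)) z \<le> e / 2"
        using small[of "e / 2"] \<open>0 < e\<close> by simp
      then show "\<forall>\<^sub>F k in sequentially. dist (fock_norm \<alpha> \<infinity> (\<lambda>z. toeplitz \<alpha> \<mu> (f (r k)) z - toeplitz \<alpha> \<mu> g z)) 0 < e"
      proof eventually_elim
        case (elim k)
        have "bdd_above (range (fock_weight \<alpha> (toeplitz \<alpha> \<mu> (d k))))"
          using elim by (intro bdd_aboveI2[of _ _ "e / 2"]) auto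
        then have "0 \<le> (SUP z. fock_weight \<alpha> (toeplitz \<alpha> \<mu> (d k)) z)"
          by (intro order_trans[OF fock_weight_nonneg cSUP_upper[of 0]]) auto
        moreover have "(SUP z. fock_weight \<alpha> (toeplitz \<alpha> \<mu> (d k)) z) \<le> e / 2"
          using elim by (intro cSUP_least) auto
        ultimately show ?case
          unfolding Td fock_norm_infinity using \<open>0 < e\<close> by simp
      qed
    qed
    moreover have "toeplitz \<alpha> \<mu> g \<in> fock_space \<alpha> \<infinity>"
      using toeplitz_in_fock_space_infinity[OF \<alpha> sets M gm wg _ C2(2)[OF sets M]] C2(1) M
      by (simp add: unit_balls_le_def)
    ultimately show "\<exists>g\<in>fock_space \<alpha> \<infinity>. \<exists>r. strict_mono r \<and>
        (\<lambda>k. fock_norm \<alpha> \<infinity> (\<lambda>z. toeplitz \<alpha> \<mu> (f (r k)) z - g z)) \<longlonglongrightarrow> 0"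
      using r by blast
  qed
qed


text \<open>
  From \<open>x\<^sup>2 \<ge> 2x - 1\<close> the Gaussian is dominated by a geometric sequence.
\<close>

lemma gaussian_tendsto_0:
  fixes w :: "nat \<Rightarrow> 'a::real_normed_vector" and c :: real
  assumes "0 < c" and w: "\<And>j. real j \<le> norm (w j)"
  shows "(\<lambda>j. exp (- c * (norm (z - w j))\<^sup>2)) \<longlonglongrightarrow> 0"
proof (rule real_tendsto_sandwich[OF _ _ tendsto_const])
  have "(\<lambda>j. exp (- (2 * c)) ^ j) \<longlonglongrightarrow> 0"
    using assms(1) by (intro LIMSEQ_realpow_zero) auto
  then show "(\<lambda>j. exp (c + 2 * c * norm z) * exp (- (2 * c)) ^ j) \<longlonglongrightarrow> 0"
    by (rule tendsto_mult_right_zero)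
  show "\<forall>\<^sub>F j in sequentially. exp (- c * (norm (z - w j))\<^sup>2) \<le> exp (c + 2 * c * norm z) * exp (- (2 * c)) ^ j"
  proof (rule always_eventually, rule allI)
    fix j
    have "real j - norm z \<le> norm (z - w j)"
      using w[of j] norm_triangle_ineq2[of "w j" z] by (simp add: norm_minus_commute)
    then have "2 * (real j - norm z) - 1 \<le> 2 * norm (z - w j) - 1" by simp
    also have "2 * norm (z - w j) - 1 \<le> (norm (z - w j))\<^sup>2"
      using zero_le_power2[of "norm (z - w j) - 1"] by (simp add: power2_diff)
    finally have "c * (2 * (real j - norm z) - 1) \<le> c * (norm (z - w j))\<^sup>2"
      using assms(1) by (intro mult_left_mono) auto
    then have "- c * (norm (z - w j))\<^sup>2 \<le> (c + 2 * c * norm z) + real j * (- (2 * c))"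
      by (simp add: algebra_simps)
    then have "exp (- c * (norm (z - w j))\<^sup>2) \<le> exp ((c + 2 * c * norm z) + real j * (- (2 * c)))"
      by simp
    then show "exp (- c * (norm (z - w j))\<^sup>2) \<le> exp (c + 2 * c * norm z) * exp (- (2 * c)) ^ j"
      by (simp only: exp_add exp_of_nat_mult)
  qed
qed simp

text \<open>
  The product of the Gaussians centred at \<open>z\<close> and \<open>w\<close> is a Gaussian in \<open>u\<close> centred at the midpoint, times a
  factor that decays in \<open>|z - w|\<close> (parallelogram law). Hence \<open>T k\<^sub>w\<close> tends to \<open>0\<close> pointwise as
  \<open>|w| \<rightarrow> \<infinity>\<close>.
\<close>

lemma fock_weight_toeplitz_normalized_kernel_le:
  fixes \<mu> :: "(complex ^ 'n) measure"
  assumes sets: "sets \<mu> = sets borel" and "0 \<le> M"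
    and M: "\<And>c. (\<integral>\<^sup>+u. ennreal (exp (- \<alpha> * (norm (u - c))\<^sup>2)) \<partial>\<mu>) \<le> ennreal M"
  shows "fock_weight \<alpha> (toeplitz \<alpha> \<mu> (normalized_kernel \<alpha> w)) z \<le> exp (- (\<alpha> / 4) * (norm (z - w))\<^sup>2) * M"
proof -
  note sets[measurable_cong]
  define c where "c = (1 / 2) *\<^sub>R (z + w)"
  define E where "E = exp (- (\<alpha> / 4) * (norm (z - w))\<^sup>2)"
  have "- (\<alpha> / 2) * (norm (u - z))\<^sup>2 + - (\<alpha> / 2) * (norm (u - w))\<^sup>2 =
      - (\<alpha> / 4) * (norm (z - w))\<^sup>2 + - \<alpha> * (norm (u - c))\<^sup>2" for u
    unfolding c_def power2_norm_eq_inner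
    by (simp add: inner_simps inner_commute field_simps)
  then have eq: "exp (- (\<alpha> / 2) * (norm (u - z))\<^sup>2) * fock_weight \<alpha> (normalized_kernel \<alpha> w) u =
      E * exp (- \<alpha> * (norm (u - c))\<^sup>2)" for u
    unfolding fock_weight_normalized_kernel E_def exp_add[symmetric] by simp
  have "ennreal (fock_weight \<alpha> (toeplitz \<alpha> \<mu> (normalized_kernel \<alpha> w)) z) \<le>
      (\<integral>\<^sup>+u. ennreal (E * exp (- \<alpha> * (norm (u - c))\<^sup>2)) \<partial>\<mu>)"
    unfolding eq[symmetric] by (rule fock_weight_toeplitz_le)
  also have "\<dots> = (\<integral>\<^sup>+u. ennreal E * ennreal (exp (- \<alpha> * (norm (u - c))\<^sup>2)) \<partial>\<mu>)"
    by (simp add: E_def ennreal_mult')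
  also have "\<dots> = ennreal E * (\<integral>\<^sup>+u. ennreal (exp (- \<alpha> * (norm (u - c))\<^sup>2)) \<partial>\<mu>)"
    by (rule nn_integral_cmult) measurable
  also have "\<dots> \<le> ennreal E * ennreal M"
    by (intro mult_left_mono M) simp
  also have "\<dots> = ennreal (E * M)"
    by (simp add: E_def ennreal_mult')
  finally show ?thesis
    using \<open>0 \<le> M\<close> by (simp add: E_def)
qed

lemma toeplitz_compact_kernel_subsequence:
  fixes \<mu> :: "(complex ^ 'n) measure" and w :: "nat \<Rightarrow> complex ^ 'n"
  assumes \<alpha>: "0 < \<alpha>" and p: "1 \<le> p" and cpt: "toeplitz_compact \<alpha> (ennreal p) \<infinity> \<mu>"
  shows "\<exists>g\<in>fock_space \<alpha> \<infinity>. \<exists>r e. strict_mono (r :: nat \<Rightarrow> nat) \<and> e \<longlonglongrightarrow> (0 :: real) \<and>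
    (\<forall>j z. fock_weight \<alpha> (\<lambda>z. toeplitz \<alpha> \<mu> (normalized_kernel \<alpha> (w (r j))) z - g z) z \<le> e j)"
proof -
  obtain C where k: "\<And>w :: complex ^ 'n. normalized_kernel \<alpha> w \<in> fock_space \<alpha> (ennreal p)"
    "\<And>w :: complex ^ 'n. fock_norm \<alpha> (ennreal p) (normalized_kernel \<alpha> w) \<le> C"
    using normalized_kernel_fock[OF \<alpha> p, where 'n = 'n] by blast
  obtain g r where g: "g \<in> fock_space \<alpha> \<infinity>" and r: "strict_mono (r :: nat \<Rightarrow> nat)"
    and lim: "(\<lambda>j. fock_norm \<alpha> \<infinity> (\<lambda>z. toeplitz \<alpha> \<mu> (normalized_kernel \<alpha> (w (r j))) z - g z)) \<longlonglongrightarrow> 0"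
    using cpt[unfolded toeplitz_compact_def op_compact_def, THEN conjunct2, THEN conjunct2,
        rule_format, of "\<lambda>j. normalized_kernel \<alpha> (w j)"] k by blast
  have "fock_weight \<alpha> (\<lambda>z. toeplitz \<alpha> \<mu> (normalized_kernel \<alpha> (w (r j))) z - g z) z \<le>
      fock_norm \<alpha> \<infinity> (\<lambda>z. toeplitz \<alpha> \<mu> (normalized_kernel \<alpha> (w (r j))) z - g z)" for j z
    unfolding fock_norm_infinity
  proof (rule cSUP_upper)
    let ?T = "toeplitz \<alpha> \<mu> (normalized_kernel \<alpha> (w (r j)))"
    have T: "?T \<in> fock_space \<alpha> \<infinity>"
      using cpt k(1) unfolding toeplitz_compact_def op_compact_def by blast
    show "bdd_above (range (fock_weight \<alpha> (\<lambda>z. ?T z - g z)))"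
    proof (rule bdd_aboveI2)
      fix z
      show "fock_weight \<alpha> (\<lambda>z. ?T z - g z) z \<le> fock_norm \<alpha> \<infinity> ?T + fock_norm \<alpha> \<infinity> g"
        using fock_weight_triangle[of \<alpha> ?T g z] fock_weight_le_fock_norm_infinity[OF T, of z]
          fock_weight_le_fock_norm_infinity[OF g, of z] by linarith
    qed
  qed simp
  with g r lim show ?thesis by blast
qed

text \<open>
  Let \<open>G(w)\<close> be the weighted modulus of \<open>T k\<^sub>w\<close> at \<open>w\<close>, a Gaussian integral of \<open>\<mu>\<close>. Compactness first
  gives a bound for \<open>G\<close>: along a sequence with \<open>G(w\<^sub>j) > j\<close> no subsequence of the images \<open>T k\<^sub>w\<close> stays bounded. With
  this bound \<open>T k\<^sub>w \<rightarrow> 0\<close> pointwise, so along any sequence escaping to infinity the norm limit of a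
  subsequence is \<open>0\<close>, and \<open>G\<close> tends to \<open>0\<close> along that subsequence.
\<close>

lemma unit_balls_vanish_of_toeplitz_compact:
  fixes \<mu> :: "(complex ^ 'n) measure"
  assumes \<alpha>: "0 < \<alpha>" and p: "1 \<le> p" and sets: "sets \<mu> = sets borel"
    and cpt: "toeplitz_compact \<alpha> (ennreal p) \<infinity> \<mu>"
  shows "unit_balls_vanish \<mu>"
proof -
  define T where "T w = toeplitz \<alpha> \<mu> (normalized_kernel \<alpha> w)" for w
  define G where "G w = fock_weight \<alpha> (T w) w" for w
  have k: "normalized_kernel \<alpha> w \<in> fock_space \<alpha> (ennreal p)" for w :: "complex ^ 'n"
    using normalized_kernel_fock[OF \<alpha> p, where 'n = 'n] by blast
  have G: "(\<integral>\<^sup>+u. ennreal (exp (- \<alpha> * (norm (u - w))\<^sup>2)) \<partial>\<mu>) = ennreal (G w)" for w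
    unfolding G_def T_def
    using cpt k[of w] unfolding toeplitz_compact_def toeplitz_defined_on_def
    by (intro toeplitz_normalized_kernel_diagonal) blast
  have G_le: "G v \<le> fock_weight \<alpha> (\<lambda>z. T v z - g z) v + fock_weight \<alpha> g v" for v g
    using fock_weight_triangle[of \<alpha> "\<lambda>z. T v z - g z" "\<lambda>z. - g z" v] by (simp add: G_def fock_weight_def)
  obtain M where M: "\<And>w. G w \<le> M"
  proof (rule ccontr)
    assume "\<not> thesis"
    then have "\<exists>w. real j < G w" for j
      using that by (meson not_le)
    then obtain w where w: "\<And>j. real j < G (w j)" by metis
    obtain g r e where g: "g \<in> fock_space \<alpha> \<infinity>" and r: "strict_mono (r :: nat \<Rightarrow> nat)"
      and e: "e \<longlonglongrightarrow> (0 :: real)" "\<And>j z. fock_weight \<alpha> (\<lambda>z. T (w (r j)) z - g z) z \<le> e j"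
      using toeplitz_compact_kernel_subsequence[OF \<alpha> p cpt, of w] unfolding T_def by blast
    have "\<forall>\<^sub>F j in sequentially. e j < 1"
      using order_tendstoD(2)[OF e(1), of 1] by simp
    moreover have "\<forall>\<^sub>F j in sequentially. 1 + fock_norm \<alpha> \<infinity> g \<le> real j"
      using eventually_ge_at_top[of "nat \<lceil>1 + fock_norm \<alpha> \<infinity> g\<rceil>"]
      by eventually_elim linarith
    ultimately have "\<forall>\<^sub>F j in sequentially. False"
    proof eventually_elim
      case (elim j)
      have "G (w (r j)) \<le> e j + fock_norm \<alpha> \<infinity> g"
        using G_le[of "w (r j)" g] e(2)[of j "w (r j)"] fock_weight_le_fock_norm_infinity[OF g, of "w (r j)"]
        by linarith
      moreover have "real j \<le> real (r j)" using seq_suble[OF r, of j] by simp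
      ultimately show False using w[of "r j"] elim by linarith
    qed
    then show False by simp
  qed
  have "0 \<le> M" using M[of 0] by (simp add: G_def order_trans[OF fock_weight_nonneg])
  have "\<exists>R. \<forall>w. R \<le> norm w \<longrightarrow> G w \<le> \<epsilon>" if "0 < \<epsilon>" for \<epsilon>
  proof (rule ccontr)
    assume "\<not> ?thesis"
    then have "\<forall>R. \<exists>w. R \<le> norm w \<and> \<epsilon> < G w" by (simp add: not_le)
    then have "\<forall>j::nat. \<exists>w. real j \<le> norm w \<and> \<epsilon> < G w" by blast
    then obtain w where w: "\<And>j. real j \<le> norm (w j)" "\<And>j. \<epsilon> < G (w j)" by metis
    obtain g r e where g: "g \<in> fock_space \<alpha> \<infinity>" and r: "strict_mono (r :: nat \<Rightarrow> nat)"
      and e: "e \<longlonglongrightarrow> (0 :: real)" "\<And>j z. fock_weight \<alpha> (\<lambda>z. T (w (r j)) z - g z) z \<le> e j"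
      using toeplitz_compact_kernel_subsequence[OF \<alpha> p cpt, of w] unfolding T_def by blast
    have wr: "real j \<le> norm (w (r j))" for j
      using seq_suble[OF r, of j] w(1)[of "r j"] by linarith
    have "fock_weight \<alpha> g z \<le> 0" for z
    proof (rule LIMSEQ_le_const)
      show "(\<lambda>j. e j + exp (- (\<alpha> / 4) * (norm (z - w (r j)))\<^sup>2) * M) \<longlonglongrightarrow> 0"
        using tendsto_add[OF e(1) tendsto_mult_left_zero[OF gaussian_tendsto_0[of "\<alpha> / 4" "\<lambda>j. w (r j)" z, OF _ wr], of M]] \<alpha>
        by simp
      have "fock_weight \<alpha> g z \<le> e j + exp (- (\<alpha> / 4) * (norm (z - w (r j)))\<^sup>2) * M" for j
      proof -
        have "fock_weight \<alpha> g z \<le> fock_weight \<alpha> (\<lambda>z. T (w (r j)) z - g z) z + fock_weight \<alpha> (T (w (r j))) z"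
          using fock_weight_triangle[of \<alpha> "T (w (r j))" "\<lambda>z. T (w (r j)) z - g z" z] by simp
        also have "\<dots> \<le> e j + exp (- (\<alpha> / 4) * (norm (z - w (r j)))\<^sup>2) * M"
          unfolding T_def using e(2)[of j z] G M
          by (intro add_mono fock_weight_toeplitz_normalized_kernel_le sets \<open>0 \<le> M\<close>)
             (auto simp: T_def intro: ennreal_leI)
        finally show ?thesis .
      qed
      then show "\<exists>N. \<forall>j\<ge>N. fock_weight \<alpha> g z \<le> e j + exp (- (\<alpha> / 4) * (norm (z - w (r j)))\<^sup>2) * M"
        by blast
    qed
    then have "G (w (r j)) \<le> e j" for j
      using G_le[of "w (r j)" g] e(2)[of j "w (r j)"] \<open>fock_weight \<alpha> g (w (r j)) \<le> 0\<close> by linarith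
    then have "\<epsilon> \<le> e j" for j
      using w(2)[of "r j"] by (meson less_imp_le order_trans)
    then have "\<epsilon> \<le> 0"
      using LIMSEQ_le_const[OF e(1)] by blast
    with \<open>0 < \<epsilon>\<close> show False by simp
  qed
  note G_small = this
  show ?thesis
    unfolding unit_balls_vanish_def
  proof (intro allI impI)
    fix \<epsilon> :: real assume "0 < \<epsilon>"
    then obtain R where R: "\<And>w. R \<le> norm w \<Longrightarrow> G w \<le> \<epsilon> / exp \<alpha>"
      using G_small[of "\<epsilon> / exp \<alpha>"] by auto
    have "emeasure \<mu> (ball w 1) \<le> ennreal \<epsilon>" if "R \<le> norm w" for w
    proof -
      have "emeasure \<mu> (ball w 1) \<le> ennreal (exp \<alpha>) * ennreal (G w)"
        using emeasure_unit_ball_le_gaussian[OF less_imp_le[OF \<alpha>] sets, of w] by (simp only: G)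
      also have "\<dots> \<le> ennreal (exp \<alpha>) * ennreal (\<epsilon> / exp \<alpha>)"
        by (intro mult_left_mono ennreal_leI R that) simp
      also have "\<dots> = ennreal \<epsilon>"
        by (simp flip: ennreal_mult')
      finally show ?thesis .
    qed
    then show "\<exists>R. \<forall>w. R \<le> norm w \<longrightarrow> emeasure \<mu> (ball w 1) \<le> ennreal \<epsilon>" by blast
  qed
qed

text \<open>
  Along a sequence escaping to infinity the kernels tend to \<open>0\<close> pointwise, so by Fatou's lemma a limit \<open>g\<close>
  of a subsequence in \<open>L\<^sup>q\<close> vanishes almost everywhere. Then the \<open>L\<^sup>q\<close> norms of the kernels themselves, which
  are Gaussian integrals of \<open>\<mu>\<close>, tend to \<open>0\<close>.
\<close>

lemma unit_balls_vanish_of_vanishing_fock_carleson: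
  fixes \<mu> :: "(complex ^ 'n) measure"
  assumes \<alpha>: "0 < \<alpha>" and q: "1 \<le> q" and sets: "sets \<mu> = sets borel"
    and van: "vanishing_fock_carleson \<alpha> 1 q \<mu>"
  shows "unit_balls_vanish \<mu>"
proof -
  have q0: "0 < q" using q by simp
  define k where "k = (normalized_kernel \<alpha> :: complex ^ 'n \<Rightarrow> complex ^ 'n \<Rightarrow> complex)"
  define I where "I f = (\<integral>\<^sup>+u. ennreal (fock_weight \<alpha> f u powr q) \<partial>\<mu>)" for f
  obtain C where "0 < C" and k: "\<And>w. k w \<in> fock_space \<alpha> 1" "\<And>w. fock_norm \<alpha> 1 (k w) \<le> C"
    using normalized_kernel_fock[OF \<alpha>, of 1, where 'n = 'n] unfolding k_def by (auto simp: ennreal_1)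
  have km: "k w \<in> borel_measurable borel" for w
    unfolding k_def by (rule entire_measurable[OF entire_normalized_kernel])
  have "\<exists>R. \<forall>w. R \<le> norm w \<longrightarrow> I (k w) \<le> ennreal \<epsilon>" if "0 < \<epsilon>" for \<epsilon>
  proof (rule ccontr)
    assume "\<not> ?thesis"
    then have "\<forall>R. \<exists>w. R \<le> norm w \<and> ennreal \<epsilon> < I (k w)" by (simp add: not_le)
    then have "\<forall>j::nat. \<exists>w. real j \<le> norm w \<and> ennreal \<epsilon> < I (k w)" by blast
    then obtain w where w: "\<And>j. real j \<le> norm (w j)" "\<And>j. ennreal \<epsilon> < I (k (w j))" by metis
    obtain g r where g: "g \<in> Lq_space q (fock_sigma \<alpha> q \<mu>)" and r: "strict_mono (r :: nat \<Rightarrow> nat)"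
      and lim: "(\<lambda>j. Lq_norm q (fock_sigma \<alpha> q \<mu>) (\<lambda>z. k (w (r j)) z - g z)) \<longlonglongrightarrow> 0"
      using van[unfolded vanishing_fock_carleson_def op_compact_def, THEN conjunct2,
        rule_format, of "\<lambda>j. k (w j)"] k by blast
    have wr: "real j \<le> norm (w (r j))" for j
      using seq_suble[OF r, of j] w(1)[of "r j"] by linarith
    have gm: "g \<in> borel_measurable borel" and Ig: "I g < \<infinity>"
      using g by (simp_all add: Lq_space_fock_sigma_iff[OF sets] I_def)
    note sets[measurable_cong] gm[measurable] km[measurable]
    define d where "d j z = k (w (r j)) z - g z" for j z
    have [measurable]: "d j \<in> borel_measurable borel" for j unfolding d_def by measurable
    have "I (d j) < \<infinity>" for j
    proof -
      have "k (w (r j)) \<in> Lq_space q (fock_sigma \<alpha> q \<mu>)"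
        using van k(1) unfolding vanishing_fock_carleson_def op_compact_def by blast
      then have "I (k (w (r j))) < \<infinity>"
        by (simp add: Lq_space_fock_sigma_iff[OF sets] I_def)
      then have "ennreal (2 powr q) * (I (k (w (r j))) + I g) < \<infinity>"
        using Ig by (simp add: ennreal_mult_less_top)
      then show ?thesis
        unfolding I_def d_def
        by (rule le_less_trans[OF nn_integral_fock_weight_diff_le[OF sets less_imp_le[OF q0] km gm]])
    qed
    then have Id: "ennreal (enn2real (I (d j))) = I (d j)" for j by simp
    have "(\<lambda>j. enn2real (I (d j)) powr (1 / q)) \<longlonglongrightarrow> 0"
      using lim unfolding d_def[symmetric] by (subst (asm) Lq_norm_fock_sigma[OF sets]) (simp_all add: I_def)
    then have "(\<lambda>j. (enn2real (I (d j)) powr (1 / q)) powr q) \<longlonglongrightarrow> 0 powr q"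
      by (rule tendsto_powr') (use q in auto)
    then have "(\<lambda>j. enn2real (I (d j))) \<longlonglongrightarrow> 0"
      using q by (simp add: powr_powr)
    then have I0: "(\<lambda>j. I (d j)) \<longlonglongrightarrow> 0"
      using tendsto_ennrealI[of "\<lambda>j. enn2real (I (d j))" 0 sequentially] by (simp only: Id ennreal_0)
    have k0: "(\<lambda>j. k (w (r j)) u) \<longlonglongrightarrow> 0" for u
    proof -
      have "(\<lambda>j. exp (\<alpha> / 2 * (norm u)\<^sup>2) * exp (- (\<alpha> / 2) * (norm (u - w (r j)))\<^sup>2)) \<longlonglongrightarrow> 0"
        using \<alpha> by (intro tendsto_mult_right_zero gaussian_tendsto_0 wr) simp
      moreover have "norm (k (w (r j)) u) = exp (\<alpha> / 2 * (norm u)\<^sup>2) * exp (- (\<alpha> / 2) * (norm (u - w (r j)))\<^sup>2)" for j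
        unfolding fock_weight_normalized_kernel[symmetric] fock_weight_def k_def
        by (simp add: mult.left_commute flip: exp_add)
      ultimately have "(\<lambda>j. norm (k (w (r j)) u)) \<longlonglongrightarrow> 0"
        by (simp only:)
      then show ?thesis
        by (rule tendsto_norm_zero_cancel)
    qed
    have "(\<lambda>j. d j u) \<longlonglongrightarrow> - g u" for u
      unfolding d_def using tendsto_diff[OF k0[of u] tendsto_const[of "g u"]] by simp
    then have "I (\<lambda>u. - g u) \<le> liminf (\<lambda>j. I (d j))"
      unfolding I_def by (intro nn_integral_fock_weight_Fatou sets q0) measurable
    also have "\<dots> = 0"
      by (rule lim_imp_Liminf[OF _ I0]) simp
    finally have "I g = 0"
      by (simp add: I_def fock_weight_def)
    then have AE0: "AE u in \<mu>. fock_weight \<alpha> g u = 0"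
      unfolding I_def using q0 by (subst (asm) nn_integral_0_iff_AE) (auto simp: powr_eq_0_iff)
    have "I (k (w (r j))) = I (d j)" for j
      unfolding I_def
    proof (rule nn_integral_cong_AE)
      show "AE u in \<mu>. ennreal (fock_weight \<alpha> (k (w (r j))) u powr q) = ennreal (fock_weight \<alpha> (d j) u powr q)"
        using AE0 by eventually_elim (simp add: fock_weight_def d_def)
    qed
    then have "ennreal \<epsilon> \<le> I (d j)" for j
      using w(2)[of "r j"] by (metis less_imp_le)
    then have "ennreal \<epsilon> \<le> 0"
      using LIMSEQ_le_const[OF I0] by blast
    with \<open>0 < \<epsilon>\<close> show False by simp
  qed
  note I_small = this
  show ?thesis
    unfolding unit_balls_vanish_def
  proof (intro allI impI)
    fix \<epsilon> :: real assume "0 < \<epsilon>"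
    define c where "c = \<alpha> * q / 2"
    have "0 \<le> c" using \<alpha> q by (simp add: c_def)
    obtain R where R: "\<And>w. R \<le> norm w \<Longrightarrow> I (k w) \<le> ennreal (\<epsilon> / exp c)"
      using I_small[of "\<epsilon> / exp c"] \<open>0 < \<epsilon>\<close> by auto
    have "emeasure \<mu> (ball w 1) \<le> ennreal \<epsilon>" if "R \<le> norm w" for w
    proof -
      have "emeasure \<mu> (ball w 1) \<le> ennreal (exp c) * I (k w)"
        using emeasure_unit_ball_le_gaussian[OF \<open>0 \<le> c\<close> sets, of w]
        unfolding I_def k_def fock_weight_normalized_kernel_powr c_def .
      also have "\<dots> \<le> ennreal (exp c) * ennreal (\<epsilon> / exp c)"
        by (intro mult_left_mono R that) simp
      also have "\<dots> = ennreal \<epsilon>"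
        by (simp flip: ennreal_mult')
      finally show ?thesis .
    qed
    then show "\<exists>R. \<forall>w. R \<le> norm w \<longrightarrow> emeasure \<mu> (ball w 1) \<le> ennreal \<epsilon>" by blast
  qed
qed


section \<open>The characterization\<close>

theorem theorem2p1:
  fixes \<alpha> p :: real
  assumes "\<alpha> > 0" and "1 \<le> p"
  shows
    "(\<forall>\<mu> :: (complex ^ 'n) measure. sets \<mu> = sets borel \<and> admissible \<alpha> \<mu> \<longrightarrow>
        (toeplitz_bounded \<alpha> (ennreal p) \<infinity> \<mu> \<longleftrightarrow> (\<exists>q::real. q \<ge> p \<and> fock_carleson \<alpha> 1 q \<mu>)) \<and>
        (toeplitz_bounded \<alpha> (ennreal p) \<infinity> \<mu> \<longleftrightarrow> (\<forall>q::real. q \<ge> p \<longrightarrow> fock_carleson \<alpha> 1 q \<mu>))) \<and>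
     (\<exists>C::real. C > 0 \<and>
        (\<forall>\<mu> :: (complex ^ 'n) measure. sets \<mu> = sets borel \<and> admissible \<alpha> \<mu> \<and>
           toeplitz_bounded \<alpha> (ennreal p) \<infinity> \<mu> \<longrightarrow>
           ennreal (1 / C) * embedding_norm \<alpha> 1 1 \<mu> \<le> toeplitz_norm \<alpha> (ennreal p) \<infinity> \<mu> \<and>
           toeplitz_norm \<alpha> (ennreal p) \<infinity> \<mu> \<le> ennreal C * embedding_norm \<alpha> 1 1 \<mu>)) \<and>
     (\<forall>\<mu> :: (complex ^ 'n) measure. sets \<mu> = sets borel \<and> admissible \<alpha> \<mu> \<longrightarrow>
        (toeplitz_compact \<alpha> (ennreal p) \<infinity> \<mu> \<longleftrightarrow>
           (\<exists>q::real. q \<ge> p \<and> vanishing_fock_carleson \<alpha> 1 q \<mu>)) \<and>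
        (toeplitz_compact \<alpha> (ennreal p) \<infinity> \<mu> \<longleftrightarrow>
           (\<forall>q::real. q \<ge> p \<longrightarrow> vanishing_fock_carleson \<alpha> 1 q \<mu>)))"
proof (intro conjI)
  have bounded: "toeplitz_bounded \<alpha> (ennreal p) \<infinity> \<mu> \<longleftrightarrow> fock_carleson \<alpha> 1 q \<mu>"
    if "sets \<mu> = sets borel" "q \<ge> p" for \<mu> :: "(complex ^ 'n) measure" and q
    using toeplitz_bounded_iff_unit_balls_le[OF assms that(1)]
      fock_carleson_iff_unit_balls_le[OF assms(1) _ that(1), of q] that(2) assms(2) by simp
  then show "\<forall>\<mu> :: (complex ^ 'n) measure. sets \<mu> = sets borel \<and> admissible \<alpha> \<mu> \<longrightarrow>
        (toeplitz_bounded \<alpha> (ennreal p) \<infinity> \<mu> \<longleftrightarrow> (\<exists>q::real. q \<ge> p \<and> fock_carleson \<alpha> 1 q \<mu>)) \<and>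
        (toeplitz_bounded \<alpha> (ennreal p) \<infinity> \<mu> \<longleftrightarrow> (\<forall>q::real. q \<ge> p \<longrightarrow> fock_carleson \<alpha> 1 q \<mu>))"
    by blast
  show "\<exists>C::real. C > 0 \<and>
        (\<forall>\<mu> :: (complex ^ 'n) measure. sets \<mu> = sets borel \<and> admissible \<alpha> \<mu> \<and>
           toeplitz_bounded \<alpha> (ennreal p) \<infinity> \<mu> \<longrightarrow>
           ennreal (1 / C) * embedding_norm \<alpha> 1 1 \<mu> \<le> toeplitz_norm \<alpha> (ennreal p) \<infinity> \<mu> \<and>
           toeplitz_norm \<alpha> (ennreal p) \<infinity> \<mu> \<le> ennreal C * embedding_norm \<alpha> 1 1 \<mu>)"
    using toeplitz_norm_equivalent_embedding_norm[OF assms, where 'n = 'n]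
    unfolding toeplitz_bounded_def by metis
  have compact: "toeplitz_compact \<alpha> (ennreal p) \<infinity> \<mu> \<longleftrightarrow> vanishing_fock_carleson \<alpha> 1 q \<mu>"
    if \<mu>: "sets \<mu> = sets borel" "admissible \<alpha> \<mu>" and "q \<ge> p" for \<mu> :: "(complex ^ 'n) measure" and q
  proof -
    have q: "1 \<le> q" using that assms by simp
    note fin = admissible_emeasure_cball_finite[OF assms(1) \<mu>]
    show ?thesis
      using unit_balls_vanish_of_toeplitz_compact[OF assms \<mu>(1)]
        toeplitz_compact_of_unit_balls_vanish[OF assms \<mu>(1) _ fin]
        unit_balls_vanish_of_vanishing_fock_carleson[OF assms(1) q \<mu>(1)]
        vanishing_fock_carleson_of_unit_balls_vanish[OF assms(1) q \<mu>(1) _ fin]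
      by blast
  qed
  then show "\<forall>\<mu> :: (complex ^ 'n) measure. sets \<mu> = sets borel \<and> admissible \<alpha> \<mu> \<longrightarrow>
        (toeplitz_compact \<alpha> (ennreal p) \<infinity> \<mu> \<longleftrightarrow>
           (\<exists>q::real. q \<ge> p \<and> vanishing_fock_carleson \<alpha> 1 q \<mu>)) \<and>
        (toeplitz_compact \<alpha> (ennreal p) \<infinity> \<mu> \<longleftrightarrow>
           (\<forall>q::real. q \<ge> p \<longrightarrow> vanishing_fock_carleson \<alpha> 1 q \<mu>))"
    by blast
qed

end
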